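(* Assume overlap: $Q_{T,X}\ll P_{T,X}$ and $\frac{\partial Q_{T,X}}{\partial P_{T,X}}\le W_0$ for some $W_0>0$. Let $\mathrm{IPM}_{\mathcal{F}}\in\{\mathcal{W}_1,\mathrm{MMD}_{\mathcal{K}}\}$, where $\mathcal{K}$ is a universal kernel on $\mathcal{Z}$. Let $\mathbf{w}(n)$ be the CBDM weights built on $(Z_i)_{i=1}^n$, $$\mathbf{w}(n)=\operatorname*{arg\,min}_{\mathbf{w}'\in\Lambda_n;\ w'_i\le W/n\ \forall i}\ \mathrm{IPM}^2_{\mathcal{F}}\big(\hat P^{\mathbf{w}'}_{T,X},\hat Q_{T,X}\big)+\lambda R_n(\mathbf{w}'),$$ with $W>W_0$ and $\hat Q_{T,X}=\hat P_T\otimes\hat P_X$. Then, almost surely, $$\hat P^{\mathbf{w}(n)}=\sum_{i=1}^nw_i(n)\,\delta_{(Z_i,Y_i)}\xrightarrow[n\to+\infty]{d}Q.$$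
   Context: $(T_i,X_i,Y_i)_{i\ge1}$ are i.i.d. with law $P=P_{T,X}\otimes P_{Y|T,X}$ (treatment in $\mathbb{R}^{d_T}$, covariates in $\mathbb{R}^{d_X}$, real outcome), $Z_i=(T_i,X_i)$. The supports $\mathcal{Z}\subset\mathbb{R}^{d_T}\times\mathbb{R}^{d_X}$ of $P_{T,X}$ and $\mathcal{Y}\subset\mathbb{R}$ of $P_Y$ are compact. $Q=P_T\otimes P_X\otimes P_{Y|T,X}$ and $Q_{T,X}=P_T\otimes P_X$. $\Lambda_n=\{\mathbf{w}\in\mathbb{R}^n:\mathbf{w}\ge0,\sum_iw_i=1\}$; $\lambda\ge0$; $\hat P^{\mathbf{w}}_{T,X}=\sum_iw_i\delta_{Z_i}$; $\hat P_T,\hat P_X$ are the marginal empirical distributions of $T_1,\dots,T_n$ and $X_1,\dots,X_n$; $R_n(\mathbf{w})=n^{-2}\sum_{i=1}^n\rho(nw_i)$ with $\rho$ strictly convex and continuous on $[0,W]$ and differentiable on $(0,W)$. $\mathrm{IPM}_{\mathcal{F}}(P_0,Q_0)=\sup_{f\in\mathcal{F}}|\mathbb{E}_{P_0}[f(Z)]-\mathbb{E}_{Q_0}[f(Z)]|$; $\mathcal{W}_1$ is the IPM over functions with Lipschitz constant at most $1$ (Euclidean distance), $\mathrm{MMD}_{\mathcal{K}}$ the IPM over the unit ball of the RKHS of $\mathcal{K}$. A continuous kernel is universal if every continuous function on the compact set $\mathcal{Z}$ can be uniformly approximated by elements of its RKHS. $\xrightarrow{d}$ denotes convergence in distribution (weak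 convergence of probability measures). *)

theory Defs
  imports "HOL-Probability.Probability"
begin

definition msupport :: "'a::topological_space measure \<Rightarrow> 'a set" where
  "msupport \<mu> = {x. \<forall>U. open U \<and> x \<in> U \<longrightarrow> emeasure \<mu> U > 0}"

text \<open>The law of \<open>(z, y)\<close> when \<open>z\<close> is drawn from \<open>\<mu>\<close> and then \<open>y\<close> from \<open>\<kappa> z\<close>.\<close>

definition kernel_prod ::
  "'a::second_countable_topology measure \<Rightarrow> ('a \<Rightarrow> 'b::second_countable_topology measure)
    \<Rightarrow> ('a \<times> 'b) measure" where
  "kernel_prod \<mu> \<kappa> = \<mu> \<bind> (\<lambda>z. \<kappa> z \<bind> (\<lambda>y. return borel (z, y)))"

text \<open>Product of the two marginals of a law on a product space; its sigma-algebra is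
  \<open>borel \<Otimes>\<^sub>M borel\<close>, which is equal to \<open>borel\<close> on the product.\<close>

definition marginal_prod ::
  "('a::second_countable_topology \<times> 'b::second_countable_topology) measure \<Rightarrow> ('a \<times> 'b) measure" where
  "marginal_prod \<mu> = distr \<mu> borel fst \<Otimes>\<^sub>M distr \<mu> borel snd"

text \<open>The measure \<open>\<Sum>i<n. w i \<delta>\<^bsub>z i\<^esub>\<close>, for nonnegative weights.\<close>

definition weighted_empirical ::
  "nat \<Rightarrow> (nat \<Rightarrow> real) \<Rightarrow> (nat \<Rightarrow> 'a::topological_space) \<Rightarrow> 'a measure" where
  "weighted_empirical n w z = distr (point_measure {..<n} (\<lambda>i. ennreal (w i))) borel z"

definition empirical :: "nat \<Rightarrow> (nat \<Rightarrow> 'a::topological_space) \<Rightarrow> 'a measure" where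
  "empirical n z = weighted_empirical n (\<lambda>_. 1 / real n) z"

definition weight_simplex :: "nat \<Rightarrow> (nat \<Rightarrow> real) set" where
  "weight_simplex n = {w. (\<forall>i<n. 0 \<le> w i) \<and> (\<Sum>i<n. w i) = 1}"

text \<open>The supremum is taken in the extended reals, so it is meaningful for every class.\<close>

definition ipm :: "('a \<Rightarrow> real) set \<Rightarrow> 'a measure \<Rightarrow> 'a measure \<Rightarrow> ereal" where
  "ipm F \<mu> \<nu> = (SUP f\<in>F. ereal \<bar>integral\<^sup>L \<mu> f - integral\<^sup>L \<nu> f\<bar>)"

text \<open>The metric of a product of Euclidean spaces is the Euclidean one, so
  on \<open>'a \<times> 'b\<close> this is the class defining the Wasserstein distance.\<close>

definition lipschitz_class :: "('a::metric_space \<Rightarrow> real) set" where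
  "lipschitz_class = {f. 1-lipschitz_on UNIV f}"

text \<open>Hilbert spaces of real functions on a set \<open>S\<close>. A function on \<open>S\<close> is encoded as a total
  function that vanishes outside \<open>S\<close>; \<open>ip\<close> is only constrained on \<open>H\<close>.\<close>

definition hilbert_function_space ::
  "'a set \<Rightarrow> ('a \<Rightarrow> real) set \<Rightarrow> (('a \<Rightarrow> real) \<Rightarrow> ('a \<Rightarrow> real) \<Rightarrow> real) \<Rightarrow> bool" where
  "hilbert_function_space S H ip \<longleftrightarrow>
     (\<forall>f\<in>H. \<forall>x. x \<notin> S \<longrightarrow> f x = 0) \<and>
     (\<lambda>_. 0) \<in> H \<and>
     (\<forall>f\<in>H. \<forall>g\<in>H. (\<lambda>x. f x + g x) \<in> H) \<and>
     (\<forall>c. \<forall>f\<in>H. (\<lambda>x. c * f x) \<in> H) \<and>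
     (\<forall>f\<in>H. \<forall>g\<in>H. ip f g = ip g f) \<and>
     (\<forall>f\<in>H. \<forall>g\<in>H. \<forall>h\<in>H. ip (\<lambda>x. f x + g x) h = ip f h + ip g h) \<and>
     (\<forall>c. \<forall>f\<in>H. \<forall>g\<in>H. ip (\<lambda>x. c * f x) g = c * ip f g) \<and>
     (\<forall>f\<in>H. 0 \<le> ip f f \<and> (ip f f = 0 \<longrightarrow> f = (\<lambda>_. 0))) \<and>
     (let dst = (\<lambda>f g. sqrt (ip (\<lambda>x. f x - g x) (\<lambda>x. f x - g x))) in
       \<forall>s :: nat \<Rightarrow> 'a \<Rightarrow> real.
         (\<forall>n. s n \<in> H) \<and> (\<forall>e>0. \<exists>N. \<forall>m\<ge>N. \<forall>n\<ge>N. dst (s m) (s n) < e)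
         \<longrightarrow> (\<exists>f\<in>H. (\<lambda>n. dst (s n) f) \<longlonglongrightarrow> 0))"

text \<open>\<open>(H, ip)\<close> is the reproducing kernel Hilbert space of \<open>K\<close> on \<open>S\<close>. Symmetry and positive
  definiteness of \<open>K\<close> on \<open>S\<close> follow from the reproducing property.\<close>

definition is_rkhs ::
  "'a set \<Rightarrow> ('a \<Rightarrow> 'a \<Rightarrow> real) \<Rightarrow> ('a \<Rightarrow> real) set
    \<Rightarrow> (('a \<Rightarrow> real) \<Rightarrow> ('a \<Rightarrow> real) \<Rightarrow> real) \<Rightarrow> bool" where
  "is_rkhs S K H ip \<longleftrightarrow>
     hilbert_function_space S H ip \<and>
     (\<forall>x\<in>S. (\<lambda>y. if y \<in> S then K x y else 0) \<in> H \<and>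
       (\<forall>f\<in>H. f x = ip f (\<lambda>y. if y \<in> S then K x y else 0)))"

definition rkhs_unit_ball ::
  "('a \<Rightarrow> real) set \<Rightarrow> (('a \<Rightarrow> real) \<Rightarrow> ('a \<Rightarrow> real) \<Rightarrow> real) \<Rightarrow> ('a \<Rightarrow> real) set" where
  "rkhs_unit_ball H ip = {f \<in> H. sqrt (ip f f) \<le> 1}"

text \<open>Universality on \<open>S\<close> of a kernel \<open>K\<close> whose reproducing kernel Hilbert space is \<open>H\<close>.\<close>

definition universal_kernel ::
  "'a::topological_space set \<Rightarrow> ('a \<Rightarrow> 'a \<Rightarrow> real) \<Rightarrow> ('a \<Rightarrow> real) set \<Rightarrow> bool" where
  "universal_kernel S K H \<longleftrightarrow>
     continuous_on (S \<times> S) (\<lambda>(x, y). K x y) \<and>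
     (\<forall>g. continuous_on S g \<longrightarrow> (\<forall>e>0. \<exists>f\<in>H. \<forall>x\<in>S. \<bar>f x - g x\<bar> < e))"

definition strictly_convex_on :: "real set \<Rightarrow> (real \<Rightarrow> real) \<Rightarrow> bool" where
  "strictly_convex_on S f \<longleftrightarrow> convex S \<and>
     (\<forall>x\<in>S. \<forall>y\<in>S. \<forall>t. x \<noteq> y \<and> 0 < t \<and> t < 1 \<longrightarrow>
        f ((1 - t) * x + t * y) < (1 - t) * f x + t * f y)"

definition weight_penalty :: "(real \<Rightarrow> real) \<Rightarrow> nat \<Rightarrow> (nat \<Rightarrow> real) \<Rightarrow> real" where
  "weight_penalty \<rho> n w = (1 / (real n)\<^sup>2) * (\<Sum>i<n. \<rho> (real n * w i))"

definition cbdm_objective ::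
  "(('a::second_countable_topology \<times> 'b::second_countable_topology) \<Rightarrow> real) set \<Rightarrow> real
    \<Rightarrow> (real \<Rightarrow> real) \<Rightarrow> nat \<Rightarrow> (nat \<Rightarrow> 'a \<times> 'b) \<Rightarrow> (nat \<Rightarrow> real) \<Rightarrow> ereal" where
  "cbdm_objective F lam \<rho> n z w =
     (ipm F (weighted_empirical n w z)
        (empirical n (\<lambda>i. fst (z i)) \<Otimes>\<^sub>M empirical n (\<lambda>i. snd (z i))))\<^sup>2
     + ereal (lam * weight_penalty \<rho> n w)"

text \<open>The minimiser need not be unique (for instance when \<open>lam = 0\<close>), so being a vector of
  CBDM weights is a predicate. Only the entries of \<open>w\<close> and \<open>z\<close> with index below \<open>n\<close> matter.\<close>

definition is_cbdm_weights ::
  "(('a::second_countable_topology \<times> 'b::second_countable_topology) \<Rightarrow> real) set \<Rightarrow> real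
    \<Rightarrow> (real \<Rightarrow> real) \<Rightarrow> real \<Rightarrow> nat \<Rightarrow> (nat \<Rightarrow> 'a \<times> 'b) \<Rightarrow> (nat \<Rightarrow> real) \<Rightarrow> bool" where
  "is_cbdm_weights F lam \<rho> W n z w \<longleftrightarrow>
     is_arg_min (cbdm_objective F lam \<rho> n z)
       (\<lambda>w'. w' \<in> weight_simplex n \<and> (\<forall>i<n. w' i \<le> W / real n)) w"

text \<open>Weak convergence of probability measures; the weak convergence of the library is
  restricted to measures on the real line.\<close>

definition converges_in_distribution ::
  "(nat \<Rightarrow> 'a::topological_space measure) \<Rightarrow> 'a measure \<Rightarrow> bool" where
  "converges_in_distribution \<mu> \<nu> \<longleftrightarrow>
     (\<forall>f :: 'a \<Rightarrow> real. continuous_on UNIV f \<and> bounded (range f) \<longrightarrow>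
        (\<lambda>n. integral\<^sup>L (\<mu> n) f) \<longlonglongrightarrow> integral\<^sup>L \<nu> f)"

end

theory Submission
  imports Defs
begin

text \<open>
  The weights proportional to the density \<open>g = dQ/dP\<close> are eventually feasible, because their
  normalisation tends to \<open>1\<close> and \<open>W\<^sub>0 < W\<close>. By the strong law on the cells of a finite
  partition and equicontinuity of the test class, their imbalance tends to \<open>0\<close> uniformly over
  the class; hence so does the imbalance of the CBDM weights, the penalty being \<open>O(1/n)\<close>. So both
  weightings have the same limit on the test class. Since no weight exceeds \<open>W/n\<close>,
  weighted averages are controlled by \<open>L\<^sup>1(P)\<close>-norms, and density of the test class extends the
  limit to every bounded Borel function of \<open>Z\<close>, in particular to the (merely measurable)
  conditional mean \<open>z \<mapsto> E[f(z, Y) | Z = z]\<close>. The remaining noise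
  \<open>\<Sum>i. w i (f(Z i, Y i) - E[f(Z i, Y i) | Z i])\<close> is, given the covariates, a sum of independent
  centred terms of size \<open>O(1/n)\<close>, and vanishes by Hoeffding's lemma and Borel--Cantelli.
  Finally, countably many cell indicators determine weak convergence on a compact set.
\<close>

section \<open>Kernel products\<close>

text \<open>Two obstacles shape the argument. First, the balancing target is random: the product of
  the empirical marginals charges mixed points (T_i, X_j) that are mostly not sample points. Overlap
  forces \<open>msupport \<mu>\<close> to be a rectangle, so mixed points stay in the compact set
  where the test class is equicontinuous and where the functions of a kernel space live. On
  rectangular cells this target factorises into two ordinary averages, although the mixed points are
  far from independent. Comparing the CBDM weights with the density weights at the same
  \<open>n\<close> then cancels the target altogether. Second, the weights are optimised over the
  whole sample and weights for different \<open>n\<close> are unrelated, so no strong law for a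
  fixed sequence applies to the outcome noise. What saves the argument is that the weights are
  measurable functions of the covariates alone: with the covariate vector frozen, exponential
  moments can be bounded one outcome at a time, and an exponential rate is summable whatever happens
  between different \<open>n\<close>.\<close>

lemma measurable_kernel_prod_arg:
  fixes \<kappa> :: "'a::second_countable_topology \<Rightarrow> 'b::second_countable_topology measure"
  assumes \<kappa>: "\<kappa> \<in> borel \<rightarrow>\<^sub>M subprob_algebra borel"
  shows "(\<lambda>z. \<kappa> z \<bind> (\<lambda>y. return borel (z, y))) \<in> borel \<rightarrow>\<^sub>M subprob_algebra borel"
proof (rule measurable_bind[OF \<kappa>])
  have "(\<lambda>x. return borel x) \<in> (borel :: ('a \<times> 'b) measure) \<rightarrow>\<^sub>M subprob_algebra borel"
    by measurable
  then show "(\<lambda>x. return borel (fst x, snd x)) \<in> (borel :: 'a measure) \<Otimes>\<^sub>M (borel :: 'b measure) \<rightarrow>\<^sub>M subprob_algebra borel"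
    by (simp add: borel_prod)
qed

lemma nn_integral_kernel_prod:
  fixes \<kappa> :: "'a::second_countable_topology \<Rightarrow> 'b::second_countable_topology measure"
  assumes \<mu>: "sets \<mu> = sets borel"
    and \<kappa>: "\<kappa> \<in> borel \<rightarrow>\<^sub>M subprob_algebra borel"
    and f[measurable]: "f \<in> borel_measurable borel"
  shows "(\<integral>\<^sup>+x. f x \<partial>kernel_prod \<mu> \<kappa>) = (\<integral>\<^sup>+z. \<integral>\<^sup>+y. f (z, y) \<partial>\<kappa> z \<partial>\<mu>)"
proof -
  have "(\<integral>\<^sup>+x. f x \<partial>kernel_prod \<mu> \<kappa>) = (\<integral>\<^sup>+z. \<integral>\<^sup>+x. f x \<partial>(\<kappa> z \<bind> (\<lambda>y. return borel (z, y))) \<partial>\<mu>)"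
    unfolding kernel_prod_def
  proof (rule nn_integral_bind[OF f])
    show "(\<lambda>z. \<kappa> z \<bind> (\<lambda>y. return borel (z, y))) \<in> \<mu> \<rightarrow>\<^sub>M subprob_algebra borel"
      using measurable_kernel_prod_arg[OF \<kappa>] \<mu> by (simp cong: measurable_cong_sets)
  qed
  also have "\<dots> = (\<integral>\<^sup>+z. \<integral>\<^sup>+y. f (z, y) \<partial>\<kappa> z \<partial>\<mu>)"
  proof (rule nn_integral_cong)
    fix z
    have s: "sets (\<kappa> z) = sets borel"
      using sets_kernel[OF \<kappa>, of z] by simp
    have "(\<lambda>y. return borel (z, y)) \<in> \<kappa> z \<rightarrow>\<^sub>M subprob_algebra borel"
      unfolding measurable_cong_sets[OF s refl]
      by (rule measurable_compose[OF _ return_measurable]) (simp add: measurable_Pair1' flip: borel_prod)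
    then show "(\<integral>\<^sup>+x. f x \<partial>(\<kappa> z \<bind> (\<lambda>y. return borel (z, y)))) = (\<integral>\<^sup>+y. f (z, y) \<partial>\<kappa> z)"
      by (subst nn_integral_bind[OF f]) (auto simp: nn_integral_return)
  qed
  finally show ?thesis .
qed

lemma sets_kernel_prod:
  fixes \<kappa> :: "'a::second_countable_topology \<Rightarrow> 'b::second_countable_topology measure"
  assumes \<mu>: "sets \<mu> = sets borel" and \<kappa>: "\<kappa> \<in> borel \<rightarrow>\<^sub>M subprob_algebra borel"
  shows "sets (kernel_prod \<mu> \<kappa>) = sets borel"
proof -
  have "(\<lambda>z. \<kappa> z \<bind> (\<lambda>y. return borel (z, y))) \<in> \<mu> \<rightarrow>\<^sub>M subprob_algebra borel"
    using measurable_kernel_prod_arg[OF \<kappa>] \<mu> by (simp cong: measurable_cong_sets)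
  moreover have "space \<mu> \<noteq> {}"
    using sets_eq_imp_space_eq[OF \<mu>] by simp
  ultimately show ?thesis
    unfolding kernel_prod_def by (intro sets_bind sets_kernel)
qed

text \<open>The density depends on the first coordinate only, so it passes through the inner
  integral. This makes \<open>Q\<close> absolutely continuous with respect to the law of one
  observation, hence carried by the same compact set.\<close>

lemma kernel_prod_density:
  fixes \<kappa> :: "'a::second_countable_topology \<Rightarrow> 'b::second_countable_topology measure"
  assumes \<mu>: "sets \<mu> = sets borel" and \<kappa>: "\<kappa> \<in> borel \<rightarrow>\<^sub>M subprob_algebra borel"
    and g[measurable]: "g \<in> borel_measurable borel"
  shows "kernel_prod (density \<mu> g) \<kappa> = density (kernel_prod \<mu> \<kappa>) (\<lambda>x. g (fst x))"
proof (rule measure_eqI)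
  have s: "sets (density \<mu> g) = sets borel" by (simp add: \<mu>)
  note sk = sets_kernel_prod[OF \<mu> \<kappa>] sets_kernel_prod[OF s \<kappa>]
  show "sets (kernel_prod (density \<mu> g) \<kappa>) = sets (density (kernel_prod \<mu> \<kappa>) (\<lambda>x. g (fst x)))"
    by (simp add: sk)
  note [measurable_cong] = \<mu>
  fix A assume "A \<in> sets (kernel_prod (density \<mu> g) \<kappa>)"
  then have A[measurable]: "A \<in> sets borel" by (simp add: sk)
  have [measurable]: "fst \<in> borel_measurable (borel :: ('a \<times> 'b) measure)"
    "(\<lambda>z. \<kappa> z) \<in> borel \<rightarrow>\<^sub>M subprob_algebra borel"
    using \<kappa> by (auto intro!: borel_measurable_continuous_onI continuous_intros)
  have [measurable]: "A \<in> sets (borel \<Otimes>\<^sub>M borel)" unfolding borel_prod by (rule A)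
  have m: "(\<lambda>z. \<integral>\<^sup>+y. indicator A (z, y) \<partial>\<kappa> z) \<in> borel_measurable borel"
    by (rule nn_integral_measurable_subprob_algebra2[OF _ \<kappa>]) measurable
  have "emeasure (kernel_prod (density \<mu> g) \<kappa>) A = (\<integral>\<^sup>+x. indicator A x \<partial>kernel_prod (density \<mu> g) \<kappa>)"
    using A by (simp add: sk)
  also have "\<dots> = (\<integral>\<^sup>+z. \<integral>\<^sup>+y. indicator A (z, y) \<partial>\<kappa> z \<partial>density \<mu> g)"
    by (rule nn_integral_kernel_prod[OF s \<kappa>]) auto
  also have "\<dots> = (\<integral>\<^sup>+z. g z * (\<integral>\<^sup>+y. indicator A (z, y) \<partial>\<kappa> z) \<partial>\<mu>)"
    using m by (intro nn_integral_density) (auto cong: measurable_cong_sets simp: \<mu>)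
  also have "\<dots> = (\<integral>\<^sup>+z. \<integral>\<^sup>+y. g (fst (z, y)) * indicator A (z, y) \<partial>\<kappa> z \<partial>\<mu>)"
  proof (rule nn_integral_cong)
    fix z
    have s: "sets (\<kappa> z) = sets borel"
      using sets_kernel[OF \<kappa>, of z] by simp
    have "(\<lambda>y. indicator A (z, y) :: ennreal) \<in> borel_measurable (\<kappa> z)"
      unfolding measurable_cong_sets[OF s refl] by measurable
    then show "g z * (\<integral>\<^sup>+y. indicator A (z, y) \<partial>\<kappa> z) = (\<integral>\<^sup>+y. g (fst (z, y)) * indicator A (z, y) \<partial>\<kappa> z)"
      by (simp add: nn_integral_cmult)
  qed
  also have "\<dots> = (\<integral>\<^sup>+x. g (fst x) * indicator A x \<partial>kernel_prod \<mu> \<kappa>)"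
    by (rule nn_integral_kernel_prod[OF \<mu> \<kappa>, symmetric]) measurable
  also have "\<dots> = emeasure (density (kernel_prod \<mu> \<kappa>) (\<lambda>x. g (fst x))) A"
    by (subst emeasure_density) (auto simp: sk cong: measurable_cong_sets)
  finally show "emeasure (kernel_prod (density \<mu> g) \<kappa>) A
    = emeasure (density (kernel_prod \<mu> \<kappa>) (\<lambda>x. g (fst x))) A" .
qed

lemma prob_space_kernel_prod:
  fixes \<kappa> :: "'a::second_countable_topology \<Rightarrow> 'b::second_countable_topology measure"
  assumes "prob_space \<mu>" "sets \<mu> = sets borel" "\<kappa> \<in> borel \<rightarrow>\<^sub>M prob_algebra borel"
  shows "prob_space (kernel_prod \<mu> \<kappa>)"
proof
  have \<kappa>: "\<kappa> \<in> borel \<rightarrow>\<^sub>M subprob_algebra borel"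
    using assms(3) by (rule measurable_prob_algebraD)
  have "emeasure (kernel_prod \<mu> \<kappa>) (space (kernel_prod \<mu> \<kappa>)) = (\<integral>\<^sup>+x. 1 \<partial>kernel_prod \<mu> \<kappa>)"
    by simp
  also have "\<dots> = (\<integral>\<^sup>+z. \<integral>\<^sup>+y. 1 \<partial>\<kappa> z \<partial>\<mu>)"
    by (rule nn_integral_kernel_prod[OF assms(2) \<kappa>]) simp
  also have "\<dots> = (\<integral>\<^sup>+z. 1 \<partial>\<mu>)"
  proof (rule nn_integral_cong)
    fix z
    have "prob_space (\<kappa> z)"
      using measurable_space[OF assms(3), of z] by (simp add: space_prob_algebra)
    then show "(\<integral>\<^sup>+y. 1 \<partial>\<kappa> z) = 1"
      by (simp add: prob_space.emeasure_space_1)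
  qed
  also have "\<dots> = 1" using assms(1) by (simp add: prob_space.emeasure_space_1)
  finally show "emeasure (kernel_prod \<mu> \<kappa>) (space (kernel_prod \<mu> \<kappa>)) = 1" .
qed

lemma distr_fst_kernel_prod:
  fixes \<kappa> :: "'a::second_countable_topology \<Rightarrow> 'b::second_countable_topology measure"
  assumes \<mu>: "sets \<mu> = sets borel" and \<kappa>: "\<kappa> \<in> borel \<rightarrow>\<^sub>M prob_algebra borel"
  shows "distr (kernel_prod \<mu> \<kappa>) borel fst = \<mu>"
proof (rule measure_eqI)
  have \<kappa>': "\<kappa> \<in> borel \<rightarrow>\<^sub>M subprob_algebra borel"
    using \<kappa> by (rule measurable_prob_algebraD)
  note sk = sets_kernel_prod[OF \<mu> \<kappa>']
  have [measurable]: "fst \<in> borel_measurable (borel :: ('a \<times> 'b) measure)"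
    by (auto intro!: borel_measurable_continuous_onI continuous_intros)
  show "sets (distr (kernel_prod \<mu> \<kappa>) borel fst) = sets \<mu>" using \<mu> by simp
  fix A assume "A \<in> sets (distr (kernel_prod \<mu> \<kappa>) borel fst)"
  then have [measurable]: "A \<in> sets borel" by simp
  have "emeasure (distr (kernel_prod \<mu> \<kappa>) borel fst) A = (\<integral>\<^sup>+x. indicator A x \<partial>distr (kernel_prod \<mu> \<kappa>) borel fst)"
    by simp
  also have "\<dots> = (\<integral>\<^sup>+x. indicator A (fst x) \<partial>kernel_prod \<mu> \<kappa>)"
    by (rule nn_integral_distr) (auto cong: measurable_cong_sets simp: sk)
  also have "\<dots> = (\<integral>\<^sup>+z. \<integral>\<^sup>+y. indicator A (fst (z, y)) \<partial>\<kappa> z \<partial>\<mu>)"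
    by (rule nn_integral_kernel_prod[OF \<mu> \<kappa>']) measurable
  also have "\<dots> = (\<integral>\<^sup>+z. indicator A z \<partial>\<mu>)"
  proof (rule nn_integral_cong)
    fix z
    have "prob_space (\<kappa> z)"
      using measurable_space[OF \<kappa>, of z] by (simp add: space_prob_algebra)
    then show "(\<integral>\<^sup>+y. indicator A (fst (z, y)) \<partial>\<kappa> z) = indicator A z"
      by (simp add: prob_space.emeasure_space_1)
  qed
  also have "\<dots> = emeasure \<mu> A" using \<mu> by simp
  finally show "emeasure (distr (kernel_prod \<mu> \<kappa>) borel fst) A = emeasure \<mu> A" .
qed

text \<open>Conditional independence of the second coordinates given all the first ones: each factor may
  depend on the whole vector of first coordinates, but only on its own second coordinate.
  Integrating out one pair at a time avoids building the product of the kernels.\<close>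

lemma nn_integral_PiM_kernel_prod_le:
  fixes \<kappa> :: "'a::second_countable_topology \<Rightarrow> 'b::second_countable_topology measure"
    and g :: "'i \<Rightarrow> ('i \<Rightarrow> 'a) \<Rightarrow> 'a \<times> 'b \<Rightarrow> ennreal"
  assumes \<mu>: "prob_space \<mu>" "sets \<mu> = sets borel"
    and \<kappa>: "\<kappa> \<in> borel \<rightarrow>\<^sub>M prob_algebra borel"
    and J: "finite J"
    and meas: "\<And>j. j \<in> J \<Longrightarrow> (\<lambda>(z, x). g j z x) \<in> borel_measurable ((\<Pi>\<^sub>M i\<in>J. borel) \<Otimes>\<^sub>M borel)"
    and bound: "\<And>j z. j \<in> J \<Longrightarrow> z \<in> extensional J \<Longrightarrow> (\<integral>\<^sup>+y. g j z (z j, y) \<partial>\<kappa> (z j)) \<le> b j"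
  shows "(\<integral>\<^sup>+x. (\<Prod>j\<in>J. g j (\<lambda>i\<in>J. fst (x i)) (x j)) \<partial>(\<Pi>\<^sub>M i\<in>J. kernel_prod \<mu> \<kappa>)) \<le> (\<Prod>j\<in>J. b j)"
  using J meas bound
proof (induction J arbitrary: g)
  case empty
  show ?case by (simp add: PiM_empty)
next
  case (insert i J)
  let ?P = "kernel_prod \<mu> \<kappa>"
  have \<kappa>': "\<kappa> \<in> borel \<rightarrow>\<^sub>M subprob_algebra borel"
    using \<kappa> by (rule measurable_prob_algebraD)
  interpret P: prob_space ?P by (rule prob_space_kernel_prod[OF \<mu> \<kappa>])
  interpret Ps: product_prob_space "\<lambda>_. ?P" by standard
  interpret \<mu>: prob_space \<mu> by fact
  interpret PJ: prob_space "\<Pi>\<^sub>M i\<in>J. ?P" by (rule prob_space_PiM) unfold_locales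
  interpret pair_sigma_finite "\<mu>" "\<Pi>\<^sub>M i\<in>J. ?P" by standard
  note [measurable_cong] = sets_kernel_prod[OF \<mu>(2) \<kappa>'] \<mu>(2)
  have [measurable]: "fst \<in> borel_measurable (borel :: ('a \<times> 'b) measure)"
    by (auto intro!: borel_measurable_continuous_onI continuous_intros)
  have idm[measurable]: "(\<lambda>x. x) \<in> borel \<Otimes>\<^sub>M borel \<rightarrow>\<^sub>M (borel :: ('a \<times> 'b) measure)"
    by (simp add: borel_prod)
  have gm: "(\<lambda>x. g j (h x) (k x)) \<in> borel_measurable N"
    if "j \<in> insert i J" "h \<in> N \<rightarrow>\<^sub>M (\<Pi>\<^sub>M i\<in>insert i J. borel)" "k \<in> N \<rightarrow>\<^sub>M borel" for j h k and N :: "'n measure"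
    using measurable_compose[OF measurable_Pair[OF that(2,3)] insert.prems(1)[OF that(1)]] by simp
  have upd: "(\<lambda>k\<in>insert i J. fst ((x(i := (z, y))) k)) = (\<lambda>k\<in>J. fst (x k))(i := z)" for x :: "'i \<Rightarrow> 'a \<times> 'b" and z y
    by (auto simp: restrict_def fun_eq_iff)
  have comp: "(\<lambda>x. x k) \<in> (\<Pi>\<^sub>M i\<in>I. ?P) \<rightarrow>\<^sub>M borel" if "k \<in> I" for k and I :: "'i set"
    using measurable_component_singleton[OF that, of "\<lambda>_. ?P"]
    unfolding measurable_cong_sets[OF refl sets_kernel_prod[OF \<mu>(2) \<kappa>']] .
  have fstcomp: "(\<lambda>x. fst (x k)) \<in> (\<Pi>\<^sub>M i\<in>I. ?P) \<rightarrow>\<^sub>M borel" if "k \<in> I" for k and I :: "'i set"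
    by (rule measurable_compose[OF comp[OF that]]) (auto intro!: borel_measurable_continuous_onI continuous_intros)
  have updm: "(\<lambda>x. (h x)(i := k x)) \<in> N \<rightarrow>\<^sub>M (\<Pi>\<^sub>M i\<in>insert i J. borel)"
    if "h \<in> N \<rightarrow>\<^sub>M (\<Pi>\<^sub>M i\<in>J. borel)" "k \<in> N \<rightarrow>\<^sub>M borel" for h k and N :: "'n measure"
    using that by (intro measurable_fun_upd[where J=J]) auto
  have "(\<integral>\<^sup>+x. (\<Prod>j\<in>insert i J. g j (\<lambda>i\<in>insert i J. fst (x i)) (x j)) \<partial>(\<Pi>\<^sub>M i\<in>insert i J. ?P))
     = (\<integral>\<^sup>+x. \<integral>\<^sup>+v. (\<Prod>j\<in>insert i J. g j (\<lambda>k\<in>insert i J. fst ((x(i := v)) k)) ((x(i := v)) j)) \<partial>?P \<partial>(\<Pi>\<^sub>M i\<in>J. ?P))"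
    using insert.hyps
    by (intro Ps.product_nn_integral_insert) (auto intro!: borel_measurable_times_ennreal borel_measurable_prod_ennreal gm measurable_restrict comp fstcomp)
  also have "\<dots> = (\<integral>\<^sup>+x. \<integral>\<^sup>+z. \<integral>\<^sup>+y. (\<Prod>j\<in>insert i J. g j (\<lambda>k\<in>insert i J. fst ((x(i := (z, y))) k)) ((x(i := (z, y))) j)) \<partial>\<kappa> z \<partial>\<mu> \<partial>(\<Pi>\<^sub>M i\<in>J. ?P))"
    using insert.hyps
    by (intro nn_integral_cong nn_integral_kernel_prod[OF \<mu>(2) \<kappa>'] borel_measurable_prod_ennreal gm)
       (auto intro!: measurable_restrict measurable_fun_upd[where J=J] simp: space_PiM PiE_iff measurable_component_singleton)
  \<comment> \<open>Only the factor with index \<open>i\<close> sees the outcome \<open>y\<close>;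
    the others see the new pair through \<open>z\<close> alone. So \<open>y\<close> is integrated
    out first, against \<open>\<kappa> z\<close>.\<close>
  also have "\<dots> \<le> (\<integral>\<^sup>+x. \<integral>\<^sup>+z. (\<Prod>j\<in>J. g j ((\<lambda>k\<in>J. fst (x k))(i := z)) (x j)) * b i \<partial>\<mu> \<partial>(\<Pi>\<^sub>M i\<in>J. ?P))"
  proof (intro nn_integral_mono)
    fix x :: "'i \<Rightarrow> 'a \<times> 'b" and z :: 'a
    let ?z = "(\<lambda>k\<in>J. fst (x k))(i := z)"
    have "(\<Prod>j\<in>J. g j ?z ((x(i := v)) j)) = (\<Prod>j\<in>J. g j ?z (x j))" for v
      using insert.hyps by (intro prod.cong) auto
    then have eq: "(\<Prod>j\<in>insert i J. g j (\<lambda>k\<in>insert i J. fst ((x(i := (z, y))) k)) ((x(i := (z, y))) j))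
       = (\<Prod>j\<in>J. g j ?z (x j)) * g i ?z (z, y)" for y
      unfolding upd prod.insert[OF insert.hyps] by (simp only: mult.commute fun_upd_same)
    have s: "sets (\<kappa> z) = sets borel"
      using sets_kernel[OF \<kappa>', of z] by simp
    have "(\<lambda>y. g i ?z (z, y)) \<in> borel_measurable (\<kappa> z)"
      unfolding measurable_cong_sets[OF s refl]
      by (intro gm measurable_const) (auto simp: space_PiM PiE_iff extensional_def simp flip: borel_prod)
    then have "(\<integral>\<^sup>+y. (\<Prod>j\<in>insert i J. g j (\<lambda>k\<in>insert i J. fst ((x(i := (z, y))) k)) ((x(i := (z, y))) j)) \<partial>\<kappa> z)
       = (\<Prod>j\<in>J. g j ?z (x j)) * (\<integral>\<^sup>+y. g i ?z (z, y) \<partial>\<kappa> z)"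
      unfolding eq by (rule nn_integral_cmult)
    also have "\<dots> \<le> (\<Prod>j\<in>J. g j ?z (x j)) * b i"
    proof (rule mult_left_mono)
      have "?z \<in> extensional (insert i J)" by (auto simp: extensional_def)
      from insert.prems(2)[OF insertI1 this]
      show "(\<integral>\<^sup>+y. g i ?z (z, y) \<partial>\<kappa> z) \<le> b i" by (simp only: fun_upd_same)
    qed simp
    finally show "(\<integral>\<^sup>+y. (\<Prod>j\<in>insert i J. g j (\<lambda>k\<in>insert i J. fst ((x(i := (z, y))) k)) ((x(i := (z, y))) j)) \<partial>\<kappa> z)
       \<le> (\<Prod>j\<in>J. g j ?z (x j)) * b i" .
  qed
  \<comment> \<open>The exchange keeps \<open>z\<close> fixed while the remaining pairs are
    integrated, since every \<open>g j\<close> still depends on \<open>z\<close> through the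
    covariate vector.\<close>
  also have "\<dots> = (\<integral>\<^sup>+z. \<integral>\<^sup>+x. (\<Prod>j\<in>J. g j ((\<lambda>k\<in>J. fst (x k))(i := z)) (x j)) * b i \<partial>(\<Pi>\<^sub>M i\<in>J. ?P) \<partial>\<mu>)"
    by (rule Fubini') (auto simp: case_prod_beta' intro!: borel_measurable_times_ennreal borel_measurable_prod_ennreal gm updm)
  also have "\<dots> = (\<integral>\<^sup>+z. (\<integral>\<^sup>+x. (\<Prod>j\<in>J. g j ((\<lambda>k\<in>J. fst (x k))(i := z)) (x j)) \<partial>(\<Pi>\<^sub>M i\<in>J. ?P)) * b i \<partial>\<mu>)"
    by (intro nn_integral_cong nn_integral_multc)
       (auto intro!: borel_measurable_prod_ennreal gm updm measurable_restrict comp fstcomp)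
  also have "\<dots> \<le> (\<integral>\<^sup>+z. (\<Prod>j\<in>J. b j) * b i \<partial>\<mu>)"
  proof (intro nn_integral_mono mult_right_mono)
    fix z :: 'a
    show "(\<integral>\<^sup>+x. (\<Prod>j\<in>J. g j ((\<lambda>k\<in>J. fst (x k))(i := z)) (x j)) \<partial>(\<Pi>\<^sub>M i\<in>J. ?P)) \<le> (\<Prod>j\<in>J. b j)"
    \<comment> \<open>With \<open>z\<close> frozen in slot \<open>i\<close>, the factors become
      functions of the covariates indexed by \<open>J\<close>. They are new factors, which is why
      \<open>g\<close> is arbitrary in the induction.\<close>
    proof (rule insert.IH)
      fix j assume j: "j \<in> J"
      show "(\<lambda>(z', x). g j (z'(i := z)) x) \<in> borel_measurable ((\<Pi>\<^sub>M i\<in>J. borel) \<Otimes>\<^sub>M borel)"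
        using j by (auto simp: case_prod_beta' intro!: gm updm)
      fix z' :: "'i \<Rightarrow> 'a" assume "z' \<in> extensional J"
      then have "z'(i := z) \<in> extensional (insert i J)" by (auto simp: extensional_def)
      moreover have "(z'(i := z)) j = z' j" using j insert.hyps by auto
      ultimately show "(\<integral>\<^sup>+y. g j (z'(i := z)) (z' j, y) \<partial>\<kappa> (z' j)) \<le> b j"
        using insert.prems(2)[of j "z'(i := z)"] j by (simp only: insert_iff simp_thms)
    qed
  qed auto
  also have "\<dots> = (\<Prod>j\<in>insert i J. b j)"
    using insert.hyps by (simp add: mult.commute \<mu>.emeasure_space_1)
  finally show ?case .
qed

text \<open>Pushing \<open>\<kappa> z\<close> forward to the product space moves the dependence on
  \<open>z\<close> from the integrand into the measure, and the integral of a fixed function is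
  measurable in the measure.\<close>

lemma measurable_kernel_integral:
  fixes \<kappa> :: "'a::second_countable_topology \<Rightarrow> 'b::second_countable_topology measure"
    and f :: "'a \<times> 'b \<Rightarrow> real"
  assumes \<kappa>[measurable]: "\<kappa> \<in> borel \<rightarrow>\<^sub>M subprob_algebra borel" and f: "f \<in> borel_measurable borel"
  shows "(\<lambda>z. \<integral>y. f (z, y) \<partial>\<kappa> z) \<in> borel_measurable borel"
proof -
  have f'[measurable]: "f \<in> borel_measurable (borel \<Otimes>\<^sub>M borel)"
    using f by (simp add: borel_prod)
  note measurable_distr2[measurable]
  have "(\<lambda>z. integral\<^sup>L (distr (\<kappa> z) (borel \<Otimes>\<^sub>M borel) (\<lambda>y. (z, y))) f) \<in> borel_measurable borel"
    by measurable
  then show ?thesis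
    by (rule measurable_cong[THEN iffD1, rotated])
       (auto intro!: integral_distr measurable_Pair1' simp: measurable_cong_sets[OF sets_kernel[OF \<kappa>] refl])
qed

text \<open>Adding the bound \<open>C\<close> makes the integrand nonnegative at both levels, which
  reduces the claim to the iterated nonnegative integral; the shift then cancels.\<close>

lemma integral_kernel_prod:
  fixes \<kappa> :: "'a::second_countable_topology \<Rightarrow> 'b::second_countable_topology measure"
    and f :: "'a \<times> 'b \<Rightarrow> real"
  assumes \<mu>: "prob_space \<mu>" "sets \<mu> = sets borel"
    and \<kappa>: "\<kappa> \<in> borel \<rightarrow>\<^sub>M prob_algebra borel"
    and f: "f \<in> borel_measurable borel" "\<And>x. \<bar>f x\<bar> \<le> C"
  shows "(\<integral>x. f x \<partial>kernel_prod \<mu> \<kappa>) = (\<integral>z. \<integral>y. f (z, y) \<partial>\<kappa> z \<partial>\<mu>)"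
proof -
  have \<kappa>': "\<kappa> \<in> borel \<rightarrow>\<^sub>M subprob_algebra borel"
    using \<kappa> by (rule measurable_prob_algebraD)
  interpret \<mu>: prob_space \<mu> by fact
  interpret P: prob_space "kernel_prod \<mu> \<kappa>" by (rule prob_space_kernel_prod[OF \<mu> \<kappa>])
  have C: "0 \<le> C" using f(2)[of undefined] by linarith
  have K: "prob_space (\<kappa> z)" for z
    using measurable_space[OF \<kappa>, of z] by (simp add: space_prob_algebra)
  have sK: "sets (\<kappa> z) = sets borel" for z
    using sets_kernel[OF \<kappa>', of z] by simp
  have fz: "(\<lambda>y. f (z, y)) \<in> borel_measurable (\<kappa> z)" for z
    unfolding measurable_cong_sets[OF sK refl]
    using f(1) by (intro measurable_compose[OF _ f(1)]) (simp add: measurable_Pair1' flip: borel_prod)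
  have fP: "f \<in> borel_measurable (kernel_prod \<mu> \<kappa>)"
    using f(1) unfolding measurable_cong_sets[OF sets_kernel_prod[OF \<mu>(2) \<kappa>'] refl] .
  have mm: "(\<lambda>z. \<integral>y. f (z, y) \<partial>\<kappa> z) \<in> borel_measurable \<mu>"
    using measurable_kernel_integral[OF \<kappa>' f(1)] unfolding measurable_cong_sets[OF \<mu>(2) refl] .
  have shift: "ennreal (C + (\<integral>x. f x \<partial>N)) = (\<integral>\<^sup>+x. ennreal (C + f x) \<partial>N)"
    if "prob_space N" "f \<in> borel_measurable N" "\<And>x. \<bar>f x\<bar> \<le> C" for N :: "'n measure" and f
  proof -
    interpret N: prob_space N by fact
    have "integrable N f" using that by (intro N.integrable_const_bound[of _ C]) auto
    moreover have "0 \<le> C + f x" for x using that(3)[of x] by linarith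
    ultimately have "(\<integral>\<^sup>+x. ennreal (C + f x) \<partial>N) = ennreal (\<integral>x. C + f x \<partial>N)"
      by (intro nn_integral_eq_integral) auto
    also have "(\<integral>x. C + f x \<partial>N) = C + (\<integral>x. f x \<partial>N)"
      using \<open>integrable N f\<close> by (simp add: N.prob_space)
    finally show ?thesis by simp
  qed
  have bnd: "\<bar>\<integral>x. f x \<partial>N\<bar> \<le> C"
    if "prob_space N" "f \<in> borel_measurable N" "\<And>x. \<bar>f x\<bar> \<le> C" for N :: "'n measure" and f
  proof -
    interpret N: prob_space N by fact
    have "integrable N f" using that by (intro N.integrable_const_bound[of _ C]) auto
    then have "\<bar>\<integral>x. f x \<partial>N\<bar> \<le> (\<integral>x. \<bar>f x\<bar> \<partial>N)" by (intro integral_abs_bound)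
    also have "\<dots> \<le> (\<integral>x. C \<partial>N)"
      using \<open>integrable N f\<close> that(3) by (intro integral_mono) auto
    finally show ?thesis by (simp add: N.prob_space)
  qed
  have "ennreal (C + (\<integral>x. f x \<partial>kernel_prod \<mu> \<kappa>)) = (\<integral>\<^sup>+x. ennreal (C + f x) \<partial>kernel_prod \<mu> \<kappa>)"
    by (rule shift[OF P.prob_space_axioms fP f(2)])
  also have "\<dots> = (\<integral>\<^sup>+z. \<integral>\<^sup>+y. ennreal (C + f (z, y)) \<partial>\<kappa> z \<partial>\<mu>)"
    using f(1) by (intro nn_integral_kernel_prod[OF \<mu>(2) \<kappa>']) auto
  also have "\<dots> = (\<integral>\<^sup>+z. ennreal (C + (\<integral>y. f (z, y) \<partial>\<kappa> z)) \<partial>\<mu>)"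
    by (intro nn_integral_cong shift[symmetric] K fz f(2))
  also have "\<dots> = ennreal (C + (\<integral>z. \<integral>y. f (z, y) \<partial>\<kappa> z \<partial>\<mu>))"
    by (intro shift[symmetric] \<mu>.prob_space_axioms mm bnd K fz f(2))
  finally have "ennreal (C + (\<integral>x. f x \<partial>kernel_prod \<mu> \<kappa>)) = ennreal (C + (\<integral>z. \<integral>y. f (z, y) \<partial>\<kappa> z \<partial>\<mu>))" .
  moreover have "\<bar>\<integral>x. f x \<partial>kernel_prod \<mu> \<kappa>\<bar> \<le> C"
    by (rule bnd[OF P.prob_space_axioms fP f(2)])
  moreover have "\<bar>\<integral>z. \<integral>y. f (z, y) \<partial>\<kappa> z \<partial>\<mu>\<bar> \<le> C"
    by (intro bnd \<mu>.prob_space_axioms mm K fz f(2))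
  ultimately show ?thesis
    by (subst (asm) ennreal_inj) auto
qed

section \<open>Almost sure limits of bounded sums\<close>

text \<open>Borel--Cantelli at each of the thresholds \<open>1 / (k + 1)\<close>; only countably
  many null sets are discarded.\<close>

lemma (in prob_space) AE_tendsto_0_of_summable_tails:
  fixes U :: "nat \<Rightarrow> 'a \<Rightarrow> real"
  assumes U[measurable]: "\<And>n. U n \<in> borel_measurable M"
    and sum: "\<And>\<epsilon>. 0 < \<epsilon> \<Longrightarrow> summable (\<lambda>n. prob {x \<in> space M. \<epsilon> \<le> \<bar>U n x\<bar>})"
  shows "AE x in M. (\<lambda>n. U n x) \<longlonglongrightarrow> 0"
proof -
  have "AE x in M. \<forall>k. \<forall>\<^sub>F n in sequentially. x \<in> space M - {x \<in> space M. inverse (real (Suc k)) \<le> \<bar>U n x\<bar>}"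
    unfolding AE_all_countable
    by (intro allI borel_cantelli_AE1) (auto simp: emeasure_eq_measure intro!: sum)
  then show ?thesis
  proof eventually_elim
    case (elim x)
    show ?case
    proof (rule tendstoI)
      fix e :: real assume "0 < e"
      then obtain k where k: "inverse (real (Suc k)) < e"
        using reals_Archimedean by blast
      show "\<forall>\<^sub>F n in sequentially. dist (U n x) 0 < e"
        using elim[rule_format, of k] by eventually_elim (use k in auto)
    qed
  qed
qed

lemma summable_exp_neg_of_nat:
  fixes c :: real
  assumes "0 < c"
  shows "summable (\<lambda>n. exp (- (c * real n)))"
proof -
  have "(\<lambda>n. exp (- (c * real n))) = (\<lambda>n. exp (- c) ^ n)"
    by (simp add: mult.commute flip: exp_of_nat_mult)
  then show ?thesis using assms by (simp add: summable_geometric)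
qed

text \<open>For bounded variables Hoeffding's inequality gives geometrically decaying tails of the
  averages, so the strong law follows from Borel--Cantelli.\<close>

lemma (in prob_space) bounded_slln:
  fixes V :: "nat \<Rightarrow> 'a \<Rightarrow> 'b" and u :: "'b \<Rightarrow> real"
  assumes indep: "indep_vars (\<lambda>_. N) V UNIV"
    and law: "\<And>i. distr M N (V i) = P"
    and u: "u \<in> borel_measurable N"
    and bound: "AE x in P. \<bar>u x\<bar> \<le> C"
  shows "AE \<omega> in M. (\<lambda>n. (\<Sum>i<n. u (V i \<omega>)) / real n) \<longlonglongrightarrow> (\<integral>x. u x \<partial>P)"
proof -
  have V[measurable]: "V i \<in> M \<rightarrow>\<^sub>M N" for i
    using indep by (simp add: indep_vars_def)
  note [measurable] = u
  \<comment> \<open>Positive even when \<open>C\<close> is zero, so that the interval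
    \<open>{-D..D}\<close> is nondegenerate and the Hoeffding exponent makes sense.\<close>
  define D where "D = \<bar>C\<bar> + 1"
  define U where "U n \<omega> = (\<Sum>i<n. u (V i \<omega>)) / real n - (\<integral>x. u x \<partial>P)" for n \<omega>
  have E: "expectation (\<lambda>\<omega>. u (V i \<omega>)) = (\<integral>x. u x \<partial>P)" for i
    by (subst law[of i, symmetric]) (simp add: integral_distr)
  have B: "AE \<omega> in M. u (V i \<omega>) \<in> {-D..D}" for i
  proof -
    have "AE x in distr M N (V i). \<bar>u x\<bar> \<le> C" unfolding law by (rule bound)
    then have "AE \<omega> in M. \<bar>u (V i \<omega>)\<bar> \<le> C" by (simp add: AE_distr_iff)
    then show ?thesis by eventually_elim (auto simp: D_def)
  qed
  have "AE \<omega> in M. (\<lambda>n. U n \<omega>) \<longlonglongrightarrow> 0"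
  proof (rule AE_tendsto_0_of_summable_tails)
    show "U n \<in> borel_measurable M" for n unfolding U_def by measurable
    fix \<epsilon> :: real assume \<epsilon>: "0 < \<epsilon>"
    have tail: "prob {x \<in> space M. \<epsilon> \<le> \<bar>U n x\<bar>} \<le> 2 * exp (- (\<epsilon>\<^sup>2 / (2 * D\<^sup>2) * real n))" if n: "0 < n" for n
    proof -
      interpret H: Hoeffding_ineq M "{..<n}" "\<lambda>i \<omega>. u (V i \<omega>)" "\<lambda>_. - D" "\<lambda>_. D" "\<Sum>i<n. expectation (\<lambda>\<omega>. u (V i \<omega>))"
      proof unfold_locales
        show "indep_vars (\<lambda>_. borel) (\<lambda>i \<omega>. u (V i \<omega>)) {..<n}"
          using indep_vars_compose2[OF indep_vars_subset[OF indep], of "{..<n}" "\<lambda>_. u" "\<lambda>_. borel"] by simp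
      qed (use B in auto)
      have D: "0 < D" by (simp add: D_def)
      have "{x \<in> space M. \<epsilon> \<le> \<bar>U n x\<bar>} = {x \<in> space M. \<epsilon> * real n \<le> \<bar>(\<Sum>i<n. u (V i x)) - (\<Sum>i<n. expectation (\<lambda>\<omega>. u (V i \<omega>)))\<bar>}"
      proof (intro Collect_cong conj_cong refl)
        fix x
        have "(\<Sum>i<n. u (V i x)) - (\<Sum>i<n. expectation (\<lambda>\<omega>. u (V i \<omega>))) = U n x * real n"
          using n unfolding E U_def by (simp add: field_simps)
        then show "\<epsilon> \<le> \<bar>U n x\<bar> \<longleftrightarrow> \<epsilon> * real n \<le> \<bar>(\<Sum>i<n. u (V i x)) - (\<Sum>i<n. expectation (\<lambda>\<omega>. u (V i \<omega>)))\<bar>"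
          using n by (simp add: abs_mult)
      qed
      then have "prob {x \<in> space M. \<epsilon> \<le> \<bar>U n x\<bar>} \<le> 2 * exp (- 2 * (\<epsilon> * real n)\<^sup>2 / (\<Sum>i<n. (D - - D)\<^sup>2))"
        using H.Hoeffding_ineq_abs_ge[of "\<epsilon> * real n"] \<epsilon> n D by simp
      also have "- 2 * (\<epsilon> * real n)\<^sup>2 / (\<Sum>i<n. (D - - D)\<^sup>2) = - (\<epsilon>\<^sup>2 / (2 * D\<^sup>2) * real n)"
        using n D by (simp add: field_simps power2_eq_square)
      finally show ?thesis .
    qed
    have c: "0 < \<epsilon>\<^sup>2 / (2 * D\<^sup>2)" using \<epsilon> by (simp add: D_def)
    show "summable (\<lambda>n. prob {x \<in> space M. \<epsilon> \<le> \<bar>U n x\<bar>})"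
      by (rule summable_comparison_test'[OF summable_mult[OF summable_exp_neg_of_nat[OF c]], of 1 _ 2])
         (use tail in auto)
  qed
  then show ?thesis
    by eventually_elim (simp add: U_def LIM_zero_iff)
qed

text \<open>Chernoff's method conditionally on the covariates. Given these, the weights are
  constants, each outcome term is centred with range of length \<open>2 * C\<close>, and Hoeffding's
  lemma with weight at most \<open>B / n\<close> bounds its exponential moment by
  \<open>exp (s\<^sup>2 * B\<^sup>2 * C\<^sup>2 / (2 * n\<^sup>2))\<close>. The product of the
  \<open>n\<close> factors costs only \<open>1 / n\<close> in the exponent.\<close>

lemma (in prob_space) weighted_noise_upper_tail:
  fixes V :: "nat \<Rightarrow> 'a \<Rightarrow> 'z::second_countable_topology \<times> 'y::second_countable_topology"
    and v :: "(nat \<Rightarrow> 'z) \<Rightarrow> nat \<Rightarrow> real" and f :: "'z \<times> 'y \<Rightarrow> real"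
  assumes indep: "indep_vars (\<lambda>_. borel) V UNIV"
    and law: "\<And>i. distr M borel (V i) = kernel_prod \<mu> \<kappa>"
    and \<mu>: "prob_space \<mu>" "sets \<mu> = sets borel"
    and \<kappa>: "\<kappa> \<in> borel \<rightarrow>\<^sub>M prob_algebra borel"
    and v: "\<And>i. i < n \<Longrightarrow> (\<lambda>z. v z i) \<in> borel_measurable (\<Pi>\<^sub>M j\<in>{..<n}. borel)"
    and v_bound: "\<And>z i. 0 \<le> v z i \<and> v z i \<le> B / real n"
    and f: "f \<in> borel_measurable borel" "\<And>x. \<bar>f x\<bar> \<le> C"
    and pos: "0 < n" "0 < B" "0 < C" "0 < \<epsilon>"
  shows "prob {\<omega> \<in> space M. \<epsilon> \<le> (\<Sum>i<n. v (\<lambda>j\<in>{..<n}. fst (V j \<omega>)) i *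
            (f (V i \<omega>) - (\<integral>y. f (fst (V i \<omega>), y) \<partial>\<kappa> (fst (V i \<omega>)))))}
         \<le> exp (- (\<epsilon>\<^sup>2 / (2 * B\<^sup>2 * C\<^sup>2) * real n))"
proof -
  define m where "m z = (\<integral>y. f (z, y) \<partial>\<kappa> z)" for z
  define I where "I = {..<n}"
  \<comment> \<open>The minimiser of the Chernoff exponent \<open>- s * \<epsilon> + s\<^sup>2 *
    B\<^sup>2 * C\<^sup>2 / (2 * n)\<close>.\<close>
  define s where "s = \<epsilon> / (B\<^sup>2 * C\<^sup>2) * real n"
  have s: "0 < s" using pos by (simp add: s_def)
  have I: "finite I" "I \<noteq> {}" using pos by (auto simp: I_def)
  have \<kappa>': "\<kappa> \<in> borel \<rightarrow>\<^sub>M subprob_algebra borel"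
    using \<kappa> by (rule measurable_prob_algebraD)
  have V: "V i \<in> M \<rightarrow>\<^sub>M borel" for i
    using indep by (simp add: indep_vars_def)
  have fst_meas: "fst \<in> borel_measurable (borel :: ('z \<times> 'y) measure)"
    by (auto intro!: borel_measurable_continuous_onI continuous_intros)
  have fp: "case_prod (\<lambda>z y. f (z, y)) \<in> borel_measurable (borel \<Otimes>\<^sub>M borel)"
    using f(1) by (simp add: borel_prod)
  have m: "m \<in> borel_measurable borel"
    unfolding m_def by (rule measurable_kernel_integral[OF \<kappa>' f(1)])
  define g where "g j z x = ennreal (exp (s * (v z j * (f x - m (fst x)))))" for j z x
  have mf: "(\<lambda>x :: 'z \<times> 'y. m (fst x)) \<in> borel_measurable borel"
    by (rule measurable_compose[OF fst_meas m])
  have v': "(\<lambda>z. v z j) \<in> borel_measurable (\<Pi>\<^sub>M j\<in>I. borel)" if "j \<in> I" for j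
    using v that by (simp add: I_def)
  have g: "(\<lambda>(z, x). g j z x) \<in> borel_measurable ((\<Pi>\<^sub>M i\<in>I. borel) \<Otimes>\<^sub>M borel)" if "j \<in> I" for j
  proof -
    note [measurable] = v'[OF that] f(1) mf
    have [measurable]: "(\<lambda>x. m (fst (snd x))) \<in> borel_measurable ((\<Pi>\<^sub>M i\<in>I. borel) \<Otimes>\<^sub>M (borel :: ('z \<times> 'y) measure))"
      using measurable_compose[OF measurable_snd mf] by simp
    show ?thesis unfolding g_def case_prod_beta' by measurable
  qed
  have bnd: "(\<integral>\<^sup>+y. g j z (z j, y) \<partial>\<kappa> (z j)) \<le> ennreal (exp (s\<^sup>2 * B\<^sup>2 * C\<^sup>2 / (2 * (real n)\<^sup>2)))"
    if j: "j \<in> I" for j z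
  proof -
    interpret K: prob_space "\<kappa> (z j)"
      using measurable_space[OF \<kappa>, of "z j"] by (simp add: space_prob_algebra)
    have sk: "sets (\<kappa> (z j)) = sets borel"
      using sets_kernel[OF \<kappa>', of "z j"] by simp
    define h where "h = (\<lambda>y. f (z j, y))"
    have hm: "h \<in> borel_measurable (\<kappa> (z j))"
      unfolding h_def measurable_cong_sets[OF sk refl]
      using measurable_Pair2[OF fp, of "z j"] by simp
    interpret K: interval_bounded_random_variable "\<kappa> (z j)" h "- C" C
    proof
      show "AE x in \<kappa> (z j). h x \<in> {- C..C}"
        using f(2) by (intro AE_I2) (auto simp: h_def abs_le_iff minus_le_iff)
    qed (rule hm)
    show ?thesis
    \<comment> \<open>Hoeffding's lemma wants a positive parameter; a zero weight makes the factor
      equal to \<open>1\<close>.\<close>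
    proof (cases "v z j = 0")
      case True
      then show ?thesis
        by (simp add: g_def K.emeasure_space_1)
    next
      case False
      then have l: "0 < s * v z j" using s v_bound[of z j] by simp
      have "(\<integral>\<^sup>+y. g j z (z j, y) \<partial>\<kappa> (z j)) = (\<integral>\<^sup>+y. ennreal (exp (s * v z j * (h y - K.expectation h))) \<partial>\<kappa> (z j))"
        by (simp add: g_def h_def m_def mult.assoc)
      also have "\<dots> \<le> ennreal (exp ((s * v z j)\<^sup>2 * (C - - C)\<^sup>2 / 8))"
        by (rule K.Hoeffdings_lemma_nn_integral[OF l])
      also have "\<dots> \<le> ennreal (exp (s\<^sup>2 * B\<^sup>2 * C\<^sup>2 / (2 * (real n)\<^sup>2)))"
      proof (intro ennreal_leI, simp only: exp_le_cancel_iff)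
        have "(s * v z j)\<^sup>2 * (C - - C)\<^sup>2 / 8 = s\<^sup>2 * C\<^sup>2 / 2 * (v z j)\<^sup>2"
          by (simp add: power2_eq_square field_simps)
        also have "\<dots> \<le> s\<^sup>2 * C\<^sup>2 / 2 * (B / real n)\<^sup>2"
          using v_bound[of z j] by (intro mult_left_mono power_mono) auto
        also have "\<dots> = s\<^sup>2 * B\<^sup>2 * C\<^sup>2 / (2 * (real n)\<^sup>2)"
          by (simp add: field_simps power_divide)
        finally show "(s * v z j)\<^sup>2 * (C - - C)\<^sup>2 / 8 \<le> s\<^sup>2 * B\<^sup>2 * C\<^sup>2 / (2 * (real n)\<^sup>2)" .
      qed
      finally show ?thesis .
    qed
  qed
  \<comment> \<open>The exponential moment as a function of the sample vector, in the shape of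
    \<open>nn_integral_PiM_kernel_prod_le\<close>: by independence its expectation is an integral
    over a power of \<open>kernel_prod \<mu> \<kappa>\<close>.\<close>
  define G where "G x = (\<Prod>j\<in>I. g j (\<lambda>i\<in>I. fst (x i)) (x j))" for x
  have G: "G \<in> borel_measurable (\<Pi>\<^sub>M i\<in>I. borel)"
  proof -
    have c: "(\<lambda>x. x k) \<in> (\<Pi>\<^sub>M i\<in>I. borel :: ('z \<times> 'y) measure) \<rightarrow>\<^sub>M borel" if "k \<in> I" for k
      using measurable_component_singleton[OF that, of "\<lambda>_. borel"] .
    show ?thesis
      unfolding G_def
    proof (rule borel_measurable_prod_ennreal)
      fix j assume j: "j \<in> I"
      have "(\<lambda>x. (\<lambda>i\<in>I. fst (x i), x j)) \<in> (\<Pi>\<^sub>M i\<in>I. borel) \<rightarrow>\<^sub>M (\<Pi>\<^sub>M i\<in>I. borel :: 'z measure) \<Otimes>\<^sub>M (borel :: ('z \<times> 'y) measure)"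
        by (intro measurable_Pair measurable_restrict c[OF j] measurable_compose[OF c fst_meas])
      from measurable_compose[OF this g[OF j]]
      show "(\<lambda>x. g j (\<lambda>i\<in>I. fst (x i)) (x j)) \<in> borel_measurable (\<Pi>\<^sub>M i\<in>I. borel)" by simp
    qed
  qed
  define S where "S \<omega> = (\<Sum>i<n. v (\<lambda>j\<in>{..<n}. fst (V j \<omega>)) i * (f (V i \<omega>) - m (fst (V i \<omega>))))" for \<omega>
  have S: "S \<in> borel_measurable M"
    unfolding S_def
  proof (intro borel_measurable_sum borel_measurable_times borel_measurable_diff)
    fix i assume "i \<in> {..<n}"
    have "(\<lambda>\<omega>. \<lambda>j\<in>I. fst (V j \<omega>)) \<in> M \<rightarrow>\<^sub>M (\<Pi>\<^sub>M i\<in>I. borel :: 'z measure)"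
      by (intro measurable_restrict measurable_compose[OF V fst_meas])
    from measurable_compose[OF this v'[of i]] \<open>i \<in> {..<n}\<close>
    show "(\<lambda>\<omega>. v (\<lambda>j\<in>{..<n}. fst (V j \<omega>)) i) \<in> borel_measurable M" by (simp add: I_def)
    show "(\<lambda>\<omega>. f (V i \<omega>)) \<in> borel_measurable M" by (rule measurable_compose[OF V f(1)])
    show "(\<lambda>\<omega>. m (fst (V i \<omega>))) \<in> borel_measurable M" by (rule measurable_compose[OF V mf])
  qed
  have "(\<integral>\<^sup>+\<omega>. ennreal (exp (s * S \<omega>)) * indicator (space M) \<omega> \<partial>M) = (\<integral>\<^sup>+\<omega>. G (\<lambda>i\<in>I. V i \<omega>) \<partial>M)"
  proof (rule nn_integral_cong)
    fix \<omega> assume "\<omega> \<in> space M"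
    moreover have "(\<lambda>i\<in>I. fst ((\<lambda>i\<in>I. V i \<omega>) i)) = (\<lambda>i\<in>I. fst (V i \<omega>))" by (auto simp: restrict_def)
    ultimately show "ennreal (exp (s * S \<omega>)) * indicator (space M) \<omega> = G (\<lambda>i\<in>I. V i \<omega>)"
      by (simp add: G_def S_def g_def I_def sum_distrib_left exp_sum prod_ennreal)
  qed
  also have "\<dots> = (\<integral>\<^sup>+x. G x \<partial>distr M (\<Pi>\<^sub>M i\<in>I. borel) (\<lambda>\<omega>. \<lambda>i\<in>I. V i \<omega>))"
    by (intro nn_integral_distr[symmetric] measurable_restrict V) (use G in simp)
  also have "distr M (\<Pi>\<^sub>M i\<in>I. borel) (\<lambda>\<omega>. \<lambda>i\<in>I. V i \<omega>) = (\<Pi>\<^sub>M i\<in>I. kernel_prod \<mu> \<kappa>)"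
    using indep_vars_iff_distr_eq_PiM[OF I(2), where M'="\<lambda>_. borel" and X=V] indep_vars_subset[OF indep, of I] V law by simp
  also have "(\<integral>\<^sup>+x. G x \<partial>(\<Pi>\<^sub>M i\<in>I. kernel_prod \<mu> \<kappa>)) \<le> (\<Prod>j\<in>I. ennreal (exp (s\<^sup>2 * B\<^sup>2 * C\<^sup>2 / (2 * (real n)\<^sup>2))))"
    unfolding G_def by (rule nn_integral_PiM_kernel_prod_le[OF \<mu> \<kappa> I(1) g bnd])
  also have "\<dots> = ennreal (exp (s\<^sup>2 * B\<^sup>2 * C\<^sup>2 / (2 * real n)))"
    using pos by (simp add: I_def ennreal_power power2_eq_square flip: exp_of_nat_mult)
  finally have E: "(\<integral>\<^sup>+\<omega>. ennreal (exp (s * S \<omega>)) * indicator (space M) \<omega> \<partial>M) \<le> ennreal (exp (s\<^sup>2 * B\<^sup>2 * C\<^sup>2 / (2 * real n)))" .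
  have "emeasure M {\<omega> \<in> space M. \<epsilon> \<le> S \<omega>} \<le> ennreal (exp (- s * \<epsilon>)) * (\<integral>\<^sup>+\<omega>. ennreal (exp (s * S \<omega>)) * indicator (space M) \<omega> \<partial>M)"
    using S by (intro Chernoff_ineq_nn_integral_ge s) auto
  also have "\<dots> \<le> ennreal (exp (- s * \<epsilon>)) * ennreal (exp (s\<^sup>2 * B\<^sup>2 * C\<^sup>2 / (2 * real n)))"
    by (rule mult_left_mono[OF E]) simp
  also have "ennreal (exp (- s * \<epsilon>)) * ennreal (exp (s\<^sup>2 * B\<^sup>2 * C\<^sup>2 / (2 * real n)))
     = ennreal (exp (- s * \<epsilon> + s\<^sup>2 * B\<^sup>2 * C\<^sup>2 / (2 * real n)))"
    unfolding exp_add by (simp add: ennreal_mult)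
  also have "- s * \<epsilon> + s\<^sup>2 * B\<^sup>2 * C\<^sup>2 / (2 * real n) = - (\<epsilon>\<^sup>2 / (2 * B\<^sup>2 * C\<^sup>2) * real n)"
    using pos by (simp add: s_def field_simps power2_eq_square)
  finally show ?thesis
    by (simp add: S_def m_def emeasure_eq_measure)
qed

text \<open>The upper tail for \<open>f\<close> and for \<open>- f\<close> gives both tails, and
  their rate is summable. No link between \<open>v n\<close> for different \<open>n\<close> enters,
  as suits weights that are recomputed for every sample size.\<close>

lemma (in prob_space) weighted_noise_tendsto_0:
  fixes V :: "nat \<Rightarrow> 'a \<Rightarrow> 'z::second_countable_topology \<times> 'y::second_countable_topology"
    and v :: "nat \<Rightarrow> (nat \<Rightarrow> 'z) \<Rightarrow> nat \<Rightarrow> real" and f :: "'z \<times> 'y \<Rightarrow> real"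
  assumes indep: "indep_vars (\<lambda>_. borel) V UNIV"
    and law: "\<And>i. distr M borel (V i) = kernel_prod \<mu> \<kappa>"
    and \<mu>: "prob_space \<mu>" "sets \<mu> = sets borel"
    and \<kappa>: "\<kappa> \<in> borel \<rightarrow>\<^sub>M prob_algebra borel"
    and v: "\<And>n i. i < n \<Longrightarrow> (\<lambda>z. v n z i) \<in> borel_measurable (\<Pi>\<^sub>M j\<in>{..<n}. borel)"
    and v_bound: "\<And>n z i. 0 \<le> v n z i \<and> v n z i \<le> B / real n"
    and f: "f \<in> borel_measurable borel" "\<And>x. \<bar>f x\<bar> \<le> C"
    and pos: "0 < B" "0 < C"
  shows "AE \<omega> in M. (\<lambda>n. \<Sum>i<n. v n (\<lambda>j\<in>{..<n}. fst (V j \<omega>)) i *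
            (f (V i \<omega>) - (\<integral>y. f (fst (V i \<omega>), y) \<partial>\<kappa> (fst (V i \<omega>))))) \<longlonglongrightarrow> 0"
proof -
  define m where "m z = (\<integral>y. f (z, y) \<partial>\<kappa> z)" for z
  define U where "U n \<omega> = (\<Sum>i<n. v n (\<lambda>j\<in>{..<n}. fst (V j \<omega>)) i * (f (V i \<omega>) - m (fst (V i \<omega>))))" for n \<omega>
  have \<kappa>': "\<kappa> \<in> borel \<rightarrow>\<^sub>M subprob_algebra borel"
    using \<kappa> by (rule measurable_prob_algebraD)
  have V: "V i \<in> M \<rightarrow>\<^sub>M borel" for i
    using indep by (simp add: indep_vars_def)
  have fst_meas: "fst \<in> borel_measurable (borel :: ('z \<times> 'y) measure)"
    by (auto intro!: borel_measurable_continuous_onI continuous_intros)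
  have m: "m \<in> borel_measurable borel"
    unfolding m_def by (rule measurable_kernel_integral[OF \<kappa>' f(1)])
  have U[measurable]: "U n \<in> borel_measurable M" for n
    unfolding U_def
  proof (intro borel_measurable_sum borel_measurable_times borel_measurable_diff)
    fix i assume i: "i \<in> {..<n}"
    have "(\<lambda>\<omega>. \<lambda>j\<in>{..<n}. fst (V j \<omega>)) \<in> M \<rightarrow>\<^sub>M (\<Pi>\<^sub>M i\<in>{..<n}. borel :: 'z measure)"
      by (intro measurable_restrict measurable_compose[OF V fst_meas])
    from measurable_compose[OF this v[of i]] i
    show "(\<lambda>\<omega>. v n (\<lambda>j\<in>{..<n}. fst (V j \<omega>)) i) \<in> borel_measurable M" by simp
    show "(\<lambda>\<omega>. f (V i \<omega>)) \<in> borel_measurable M" by (rule measurable_compose[OF V f(1)])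
    show "(\<lambda>\<omega>. m (fst (V i \<omega>))) \<in> borel_measurable M"
      by (rule measurable_compose[OF V measurable_compose[OF fst_meas m]])
  qed
  have "AE \<omega> in M. (\<lambda>n. U n \<omega>) \<longlonglongrightarrow> 0"
  proof (rule AE_tendsto_0_of_summable_tails[OF U])
    fix \<epsilon> :: real assume \<epsilon>: "0 < \<epsilon>"
    let ?c = "\<epsilon>\<^sup>2 / (2 * B\<^sup>2 * C\<^sup>2)"
    have tail: "prob {\<omega> \<in> space M. \<epsilon> \<le> \<bar>U n \<omega>\<bar>} \<le> 2 * exp (- (?c * real n))" if n: "0 < n" for n
    proof -
      have neg: "prob {\<omega> \<in> space M. \<epsilon> \<le> - U n \<omega>} \<le> exp (- (?c * real n))"
      proof -
        have "prob {\<omega> \<in> space M. \<epsilon> \<le> (\<Sum>i<n. v n (\<lambda>j\<in>{..<n}. fst (V j \<omega>)) i *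
            (- f (V i \<omega>) - (\<integral>y. - f (fst (V i \<omega>), y) \<partial>\<kappa> (fst (V i \<omega>)))))} \<le> exp (- (?c * real n))"
          by (rule weighted_noise_upper_tail[OF indep law \<mu> \<kappa> v v_bound _ _ n pos \<epsilon>]) (use f in auto)
        then show ?thesis
          by (simp add: U_def m_def sum_negf[symmetric] algebra_simps)
      qed
      have "prob {\<omega> \<in> space M. \<epsilon> \<le> \<bar>U n \<omega>\<bar>} \<le> prob ({\<omega> \<in> space M. \<epsilon> \<le> U n \<omega>} \<union> {\<omega> \<in> space M. \<epsilon> \<le> - U n \<omega>})"
        by (intro finite_measure_mono) auto
      also have "\<dots> \<le> prob {\<omega> \<in> space M. \<epsilon> \<le> U n \<omega>} + prob {\<omega> \<in> space M. \<epsilon> \<le> - U n \<omega>}"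
        by (intro measure_Un_le) auto
      also have "prob {\<omega> \<in> space M. \<epsilon> \<le> U n \<omega>} \<le> exp (- (?c * real n))"
        unfolding U_def m_def
        by (rule weighted_noise_upper_tail[OF indep law \<mu> \<kappa> v v_bound f n pos \<epsilon>])
      finally show ?thesis using neg by simp
    qed
    have c: "0 < ?c" using \<epsilon> pos by simp
    show "summable (\<lambda>n. prob {x \<in> space M. \<epsilon> \<le> \<bar>U n x\<bar>})"
      by (rule summable_comparison_test'[OF summable_mult[OF summable_exp_neg_of_nat[OF c]], of 1 _ 2])
         (use tail in auto)
  qed
  then show ?thesis by (simp add: U_def m_def)
qed

section \<open>Supports, roundings and Lipschitz approximation\<close>

text \<open>Each point outside the support has a null neighbourhood, which can be shrunk to a member
  of a countable basis; so the complement lies in a countable union of null sets.\<close>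

lemma AE_msupport:
  fixes \<mu> :: "'a::second_countable_topology measure"
  assumes \<mu>: "sets \<mu> = sets borel"
  shows "AE x in \<mu>. x \<in> msupport \<mu>"
proof -
  obtain \<B> :: "'a set set" where \<B>: "countable \<B>" "topological_basis \<B>"
    using ex_countable_basis by blast
  have "(\<Union>B\<in>{B \<in> \<B>. emeasure \<mu> B = 0}. B) \<in> null_sets \<mu>"
    using \<B> topological_basis_open[OF \<B>(2)] \<mu>
    by (intro null_sets_UN') (auto intro: countable_Collect simp: null_sets_def)
  then show ?thesis
  proof (rule AE_I', intro subsetI)
    fix x assume "x \<in> {x \<in> space \<mu>. x \<notin> msupport \<mu>}"
    then obtain U where U: "open U" "x \<in> U" "\<not> 0 < emeasure \<mu> U"
      by (auto simp: msupport_def)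
    obtain B where B: "B \<in> \<B>" "x \<in> B" "B \<subseteq> U"
      using topological_basisE[OF \<B>(2) U(1,2)] by blast
    have "emeasure \<mu> B \<le> emeasure \<mu> U"
      using B U \<mu> by (intro emeasure_mono) auto
    then have "emeasure \<mu> B = 0" using U(3) by simp
    with B show "x \<in> (\<Union>B\<in>{B \<in> \<B>. emeasure \<mu> B = 0}. B)" by auto
  qed
qed

text \<open>A box around \<open>(a, b')\<close> has positive mass under the product of the
  marginals, because the two strips containing it meet the support at \<open>(a, b)\<close> and
  \<open>(a', b')\<close>. Overlap forbids such a box from being \<open>\<mu>\<close>-null. This
  keeps recombined pairs of treatment and covariates inside the support.\<close>

lemma msupport_rectangle:
  fixes \<mu> :: "('a::second_countable_topology \<times> 'b::second_countable_topology) measure"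
  assumes \<mu>: "prob_space \<mu>" "sets \<mu> = sets borel"
    and ac: "absolutely_continuous \<mu> (marginal_prod \<mu>)"
    and mem: "(a, b) \<in> msupport \<mu>" "(a', b') \<in> msupport \<mu>"
  shows "(a, b') \<in> msupport \<mu>"
  unfolding msupport_def
proof (intro CollectI allI impI; elim conjE)
  interpret \<mu>: prob_space \<mu> by fact
  have fst: "fst \<in> \<mu> \<rightarrow>\<^sub>M borel" and snd: "snd \<in> \<mu> \<rightarrow>\<^sub>M borel"
    unfolding measurable_cong_sets[OF \<mu>(2) refl]
    by (auto intro!: borel_measurable_continuous_onI continuous_intros)
  interpret D: prob_space "distr \<mu> borel snd" by (rule \<mu>.prob_space_distr[OF snd])
  have sp: "space \<mu> = UNIV" using sets_eq_imp_space_eq[OF \<mu>(2)] by simp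
  fix U assume U: "open U" "(a, b') \<in> U"
  then obtain A B where AB: "open A" "open B" "a \<in> A" "b' \<in> B" "A \<times> B \<subseteq> U"
    by (auto elim: open_prod_elim)
  have "emeasure (marginal_prod \<mu>) (A \<times> B) = emeasure (distr \<mu> borel fst) A * emeasure (distr \<mu> borel snd) B"
    unfolding marginal_prod_def using AB by (intro D.emeasure_pair_measure_Times) auto
  also have "\<dots> = emeasure \<mu> (A \<times> UNIV) * emeasure \<mu> (UNIV \<times> B)"
  proof -
    have "fst -` A \<inter> space \<mu> = A \<times> UNIV" "snd -` B \<inter> space \<mu> = UNIV \<times> B"
      by (auto simp: sp)
    then show ?thesis using AB by (simp add: emeasure_distr fst snd)
  qed
  also have "\<dots> > 0"
  proof -
    have "open (A \<times> (UNIV :: 'b set))" "open ((UNIV :: 'a set) \<times> B)"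
      using AB by (auto intro: open_Times)
    moreover have "(a, b) \<in> A \<times> UNIV" "(a', b') \<in> UNIV \<times> B" using AB by auto
    ultimately have "emeasure \<mu> (A \<times> UNIV) > 0" "emeasure \<mu> (UNIV \<times> B) > 0"
      using mem unfolding msupport_def by blast+
    then show ?thesis by (simp add: ennreal_zero_less_mult_iff)
  qed
  finally have pos: "emeasure (marginal_prod \<mu>) (A \<times> B) > 0" .
  have ABm: "A \<times> B \<in> sets \<mu>" using AB \<mu> by (auto intro: borel_open open_Times)
  have "emeasure \<mu> (A \<times> B) \<noteq> 0"
  proof
    assume "emeasure \<mu> (A \<times> B) = 0"
    then have "A \<times> B \<in> null_sets (marginal_prod \<mu>)"
      using ac ABm unfolding absolutely_continuous_def by (auto simp: null_sets_def)
    then show False using pos by (auto simp: null_sets_def)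
  qed
  moreover have "emeasure \<mu> (A \<times> B) \<le> emeasure \<mu> U"
    using AB U \<mu> by (intro emeasure_mono) auto
  ultimately show "0 < emeasure \<mu> U"
    by (metis le_zero_eq not_gr_zero)
qed

text \<open>A finite partition of \<open>K\<close> into small Borel cells, encoded by a map to the
  cell centres: the cells are its fibres. In the induction over the centres of a ball cover, the
  ball added last overrides the others, which makes the cells disjoint. Points off \<open>K\<close>
  are also sent to centres, so \<open>r\<close> is total.\<close>

lemma finite_rounding:
  fixes K :: "'a::metric_space set"
  assumes K: "compact K" "K \<noteq> {}" and \<delta>: "0 < \<delta>"
  shows "\<exists>r \<in> borel \<rightarrow>\<^sub>M borel. finite (range r) \<and> range r \<subseteq> K \<and> (\<forall>x\<in>K. dist x (r x) < \<delta>)"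
proof -
  obtain k where k: "finite k" "k \<subseteq> K" "K \<subseteq> (\<Union>c\<in>k. ball c \<delta>)"
  proof (rule compactE_image[OF K(1), of K "\<lambda>c. ball c \<delta>"])
    show "K \<subseteq> (\<Union>c\<in>K. ball c \<delta>)" using \<delta> by auto
  qed auto
  with K have "k \<noteq> {}" by auto
  from k(1) this
  have "\<exists>r \<in> borel \<rightarrow>\<^sub>M borel. range r \<subseteq> k \<and> (\<forall>x\<in>(\<Union>c\<in>k. ball c \<delta>). dist x (r x) < \<delta>)"
  proof (induction k rule: finite_ne_induct)
    case (singleton c)
    show ?case by (rule bexI[of _ "\<lambda>_. c"]) (auto simp: dist_commute)
  next
    case (insert c k)
    then obtain r where r: "r \<in> borel \<rightarrow>\<^sub>M borel" "range r \<subseteq> k" "\<forall>x\<in>(\<Union>c\<in>k. ball c \<delta>). dist x (r x) < \<delta>"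
      by blast
    show ?case
    proof (rule bexI[of _ "\<lambda>x. if x \<in> ball c \<delta> then c else r x"])
      show "(\<lambda>x. if x \<in> ball c \<delta> then c else r x) \<in> borel \<rightarrow>\<^sub>M borel"
        using r(1) by (intro measurable_If_set) auto
    qed (use r in \<open>auto simp: dist_commute\<close>)
  qed
  then obtain r where "r \<in> borel \<rightarrow>\<^sub>M borel" "range r \<subseteq> k" "\<forall>x\<in>(\<Union>c\<in>k. ball c \<delta>). dist x (r x) < \<delta>"
    by blast
  then show ?thesis using k by (intro bexI[of _ r]) (auto intro: finite_subset)
qed

lemma dist_Pair_le: "dist (a, b) (c, d) \<le> dist a c + dist b d"
  unfolding dist_Pair_Pair by (rule sqrt_sum_squares_le_sum) auto

lemma finite_rounding_sequence:
  fixes K :: "'a::metric_space set"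
  assumes "compact K" "K \<noteq> {}" "0 < a"
  shows "\<exists>r :: nat \<Rightarrow> 'a \<Rightarrow> 'a. \<forall>k. r k \<in> borel \<rightarrow>\<^sub>M borel \<and> finite (range (r k)) \<and> range (r k) \<subseteq> K \<and>
    (\<forall>x\<in>K. dist x (r k x) < a * inverse (real (Suc k)))"
proof (rule choice, rule allI)
  fix k
  have "0 < a * inverse (real (Suc k))" using assms(3) by simp
  from finite_rounding[OF assms(1,2) this]
  show "\<exists>r. r \<in> borel \<rightarrow>\<^sub>M borel \<and> finite (range r) \<and> range r \<subseteq> K \<and> (\<forall>x\<in>K. dist x (r x) < a * inverse (real (Suc k)))"
    by blast
qed

lemma of_bool_eq_measurable:
  assumes "r \<in> M \<rightarrow>\<^sub>M (borel :: 'b::t1_space measure)"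
  shows "(\<lambda>y. of_bool (r y = c) :: real) \<in> borel_measurable M"
proof -
  have "(\<lambda>x. of_bool (x = c) :: real) = indicator {c}" by (auto simp: indicator_def)
  then have "(\<lambda>x. of_bool (x = c) :: real) \<in> borel_measurable borel" by simp
  from measurable_compose[OF assms this] show ?thesis .
qed

text \<open>Inner regularity replaces \<open>A\<close> by a compact subset \<open>K\<close>, whose
  indicator is the pointwise limit of Lipschitz bumps that decay with slope \<open>n\<close> away
  from \<open>K\<close>.\<close>

lemma lipschitz_approx_indicator:
  fixes \<mu> :: "'a::polish_space measure"
  assumes \<mu>: "finite_measure \<mu>" "sets \<mu> = sets borel" and A: "A \<in> sets \<mu>" and \<epsilon>: "0 < \<epsilon>"
  shows "\<exists>h L. L-lipschitz_on UNIV h \<and> (\<forall>x. \<bar>h x\<bar> \<le> 1) \<and> (\<integral>x. \<bar>indicator A x - h x :: real\<bar> \<partial>\<mu>) < \<epsilon>"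
proof -
  interpret finite_measure \<mu> by fact
  have Ab: "A \<in> sets borel" using A \<mu> by simp
  have "\<exists>K. K \<subseteq> A \<and> compact K \<and> measure \<mu> A - measure \<mu> K < \<epsilon> / 2"
  \<comment> \<open>If \<open>A\<close> is small, the empty set will do; otherwise
    \<open>measure \<mu> A - \<epsilon> / 2\<close> is nonnegative and survives the passage to
    \<open>ennreal\<close>.\<close>
  proof (cases "measure \<mu> A < \<epsilon> / 2")
    case True
    then show ?thesis by (intro exI[of _ "{}"]) auto
  next
    case False
    have "emeasure \<mu> A = (SUP K \<in> {K. K \<subseteq> A \<and> compact K}. emeasure \<mu> K)"
      by (rule inner_regular[OF \<mu>(2) _ Ab]) simp
    moreover have "ennreal (measure \<mu> A - \<epsilon> / 2) < emeasure \<mu> A"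
      using False \<epsilon> by (simp add: emeasure_eq_measure ennreal_less_iff)
    ultimately obtain K where K: "K \<subseteq> A" "compact K" "ennreal (measure \<mu> A - \<epsilon> / 2) < emeasure \<mu> K"
      by (auto simp: less_SUP_iff)
    then have "measure \<mu> A - \<epsilon> / 2 < measure \<mu> K"
      using False by (simp add: emeasure_eq_measure ennreal_less_iff)
    with K show ?thesis by (intro exI[of _ K]) auto
  qed
  then obtain K where K: "K \<subseteq> A" "compact K" "measure \<mu> A - measure \<mu> K < \<epsilon> / 2" by blast
  have Kc: "closed K" and Ks: "K \<in> sets \<mu>"
    using K(2) \<mu> by (auto intro: compact_imp_closed borel_closed)
  have meas: "f \<in> borel_measurable \<mu>" if "f \<in> borel_measurable borel" for f :: "'a \<Rightarrow> real"
    using that unfolding measurable_cong_sets[OF \<mu>(2) refl] .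
  have intAK: "(\<integral>x. \<bar>indicator A x - indicator K x :: real\<bar> \<partial>\<mu>) < \<epsilon> / 2"
  proof -
    have "(\<integral>x. \<bar>indicator A x - indicator K x :: real\<bar> \<partial>\<mu>) = (\<integral>x. indicator (A - K) x \<partial>\<mu>)"
      using K(1) by (intro Bochner_Integration.integral_cong) (auto split: split_indicator)
    also have "\<dots> = measure \<mu> A - measure \<mu> K"
      using A Ks K(1) by (simp add: finite_measure_Diff)
    finally show ?thesis using K(3) by simp
  qed
  \<comment> \<open>\<open>infdist x {}\<close> is \<open>0\<close>, so for an empty
    \<open>K\<close> the bump formula would give \<open>1\<close> instead of
    \<open>0\<close>.\<close>
  define h where "h n x = (if K = {} then 0 else max 0 (1 - real n * infdist x K))" for n and x :: 'a
  have lip: "(real n)-lipschitz_on UNIV (h n)" for n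
  proof (rule lipschitz_onI)
    fix x y :: 'a
    have "\<bar>infdist x K - infdist y K\<bar> \<le> dist x y" by (rule infdist_triangle_abs)
    then have "real n * \<bar>infdist x K - infdist y K\<bar> \<le> real n * dist x y"
      by (rule mult_left_mono) simp
    then have "\<bar>real n * infdist x K - real n * infdist y K\<bar> \<le> real n * dist x y"
      by (simp add: abs_mult flip: right_diff_distrib)
    moreover have "0 \<le> real n * dist x y" by simp
    ultimately show "dist (h n x) (h n y) \<le> real n * dist x y"
      unfolding h_def dist_real_def by (simp split: if_splits) linarith
  qed simp
  have hb: "\<bar>h n x\<bar> \<le> 1" for n x
    using infdist_nonneg[of x K] by (auto simp: h_def)
  have hm: "h n \<in> borel_measurable \<mu>" for n
    by (rule meas, rule borel_measurable_continuous_onI, rule lipschitz_on_continuous_on[OF lip])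
  have lim: "(\<lambda>n. h n x) \<longlonglongrightarrow> indicator K x" for x
  proof (cases "x \<in> K")
    case True
    then have "h n x = 1" for n by (auto simp: h_def)
    then show ?thesis using True by simp
  next
    case False
    show ?thesis
    proof (cases "K = {}")
      case True
      then show ?thesis by (simp add: h_def)
    next
      case ne: False
      have d: "0 < infdist x K" using False Kc ne infdist_pos_not_in_closed by blast
      obtain N where N: "1 / infdist x K < real N" using reals_Archimedean2 by blast
      have "h n x = 0" if "N \<le> n" for n
      proof -
        have "1 / infdist x K < real n" using N that by simp
        then show ?thesis using d ne by (simp add: h_def field_simps)
      qed
      then have "\<forall>\<^sub>F n in sequentially. h n x = indicator K x"
        using False by (auto simp: eventually_sequentially intro!: exI[of _ N])
      then show ?thesis by (rule tendsto_eventually)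
    qed
  qed
  have "(\<lambda>n. \<integral>x. \<bar>indicator K x - h n x\<bar> \<partial>\<mu>) \<longlonglongrightarrow> (\<integral>x. 0 \<partial>\<mu>)"
  proof (rule integral_dominated_convergence[where w="\<lambda>_. 2"])
    show "AE x in \<mu>. (\<lambda>n. \<bar>indicator K x - h n x\<bar>) \<longlonglongrightarrow> 0"
    proof (rule AE_I2)
      fix x
      have "(\<lambda>n. \<bar>indicator K x - h n x\<bar>) \<longlonglongrightarrow> \<bar>indicator K x - indicator K x\<bar>"
        by (intro tendsto_intros lim)
      then show "(\<lambda>n. \<bar>indicator K x - h n x\<bar>) \<longlonglongrightarrow> 0" by simp
    qed
    show "AE x in \<mu>. norm \<bar>indicator K x - h n x\<bar> \<le> 2" for n
    proof (rule AE_I2)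
      fix x
      show "norm \<bar>indicator K x - h n x\<bar> \<le> 2"
        using hb[of n x] by (auto split: split_indicator)
    qed
  qed (use hm Ks in auto)
  then have "\<forall>\<^sub>F n in sequentially. (\<integral>x. \<bar>indicator K x - h n x\<bar> \<partial>\<mu>) < \<epsilon> / 2"
    using \<epsilon> by (intro order_tendstoD) auto
  then obtain n where n: "(\<integral>x. \<bar>indicator K x - h n x\<bar> \<partial>\<mu>) < \<epsilon> / 2"
    by (auto simp: eventually_sequentially)
  have i1: "integrable \<mu> (\<lambda>x. \<bar>indicator A x - indicator K x :: real\<bar>)"
    using A Ks by (intro integrable_const_bound[of _ 2]) (auto split: split_indicator)
  have i2: "integrable \<mu> (\<lambda>x. \<bar>indicator K x - h n x\<bar>)"
  proof (rule integrable_const_bound[of _ 2])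
    show "AE x in \<mu>. norm \<bar>indicator K x - h n x\<bar> \<le> 2"
    proof (rule AE_I2)
      fix x
      show "norm \<bar>indicator K x - h n x\<bar> \<le> 2"
        using hb[of n x] by (auto split: split_indicator)
    qed
  qed (use hm Ks in auto)
  have "(\<integral>x. \<bar>indicator A x - h n x\<bar> \<partial>\<mu>) \<le> (\<integral>x. \<bar>indicator A x - indicator K x\<bar> + \<bar>indicator K x - h n x\<bar> \<partial>\<mu>)"
    using i1 i2 by (intro integral_mono') auto
  also have "\<dots> < \<epsilon>" using i1 i2 intAK n by simp
  finally show ?thesis using lip hb by blast
qed

text \<open>Induction over integrable functions: indicators, sums, dominated limits. The bound
  \<open>C\<close> is carried along so that the approximants themselves are integrable.\<close>

lemma lipschitz_dense_L1:
  fixes \<mu> :: "'a::polish_space measure" and m :: "'a \<Rightarrow> real"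
  assumes \<mu>: "finite_measure \<mu>" "sets \<mu> = sets borel" and m: "integrable \<mu> m" and \<epsilon>: "0 < \<epsilon>"
  shows "\<exists>h L C. L-lipschitz_on UNIV h \<and> (\<forall>x. \<bar>h x\<bar> \<le> C) \<and> (\<integral>x. \<bar>m x - h x\<bar> \<partial>\<mu>) < \<epsilon>"
  using m \<epsilon>
proof (induction arbitrary: \<epsilon> rule: integrable_induct)
  interpret finite_measure \<mu> by fact
  have lipint: "integrable \<mu> h" if "L-lipschitz_on UNIV h" "\<forall>x. \<bar>h x\<bar> \<le> C" for h :: "'a \<Rightarrow> real" and L C
  proof (rule integrable_const_bound[of _ C])
    show "h \<in> borel_measurable \<mu>"
      unfolding measurable_cong_sets[OF \<mu>(2) refl]
      by (rule borel_measurable_continuous_onI, rule lipschitz_on_continuous_on[OF that(1)])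
  qed (use that(2) in auto)
  {
    case (base A c)
    \<comment> \<open>The added \<open>1\<close> covers \<open>c = 0\<close> and makes the final
      inequality strict.\<close>
    have "0 < \<epsilon> / (\<bar>c\<bar> + 1)" using base by simp
    from lipschitz_approx_indicator[OF \<mu> base(1) this] obtain h L where
      h: "L-lipschitz_on UNIV h" "\<forall>x. \<bar>h x\<bar> \<le> 1" "(\<integral>x. \<bar>indicator A x - h x\<bar> \<partial>\<mu>) < \<epsilon> / (\<bar>c\<bar> + 1)"
      by blast
    have "\<bar>c\<bar> * (\<integral>x. \<bar>indicator A x - h x\<bar> \<partial>\<mu>) \<le> \<bar>c\<bar> * (\<epsilon> / (\<bar>c\<bar> + 1))"
      using h(3) by (intro mult_left_mono) auto
    also have "\<dots> < \<epsilon>" using base(3) by (simp add: field_simps)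
    finally have "\<bar>c\<bar> * (\<integral>x. \<bar>indicator A x - h x\<bar> \<partial>\<mu>) < \<epsilon>" .
    moreover have "\<bar>c\<bar> * (\<integral>x. \<bar>indicator A x - h x\<bar> \<partial>\<mu>) = (\<integral>x. \<bar>indicator A x *\<^sub>R c - c * h x\<bar> \<partial>\<mu>)"
    proof -
      have "\<bar>indicator A x *\<^sub>R c - c * h x\<bar> = \<bar>c\<bar> * \<bar>indicator A x - h x\<bar>" for x
        by (simp add: right_diff_distrib mult.commute flip: abs_mult)
      then show ?thesis by simp
    qed
    moreover have "(\<bar>c\<bar> * L)-lipschitz_on UNIV (\<lambda>x. c * h x)"
      using h(1) by (rule lipschitz_on_cmult_real)
    moreover have "\<forall>x. \<bar>c * h x\<bar> \<le> \<bar>c\<bar>"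
      using h(2) by (simp add: abs_mult mult_left_le)
    ultimately show ?case
      by (intro exI[of _ "\<lambda>x. c * h x"] exI[of _ "\<bar>c\<bar> * L"] exI[of _ "\<bar>c\<bar>"]) simp
  next
    case (add f g)
    have e2: "0 < \<epsilon> / 2" using add(5) by simp
    from add(3)[OF e2] add(4)[OF e2] obtain h L C h' L' C' where
      h: "L-lipschitz_on UNIV h" "\<forall>x. \<bar>h x\<bar> \<le> C" "(\<integral>x. \<bar>f x - h x\<bar> \<partial>\<mu>) < \<epsilon> / 2" and
      h': "L'-lipschitz_on UNIV h'" "\<forall>x. \<bar>h' x\<bar> \<le> C'" "(\<integral>x. \<bar>g x - h' x\<bar> \<partial>\<mu>) < \<epsilon> / 2"
      by blast
    have i: "integrable \<mu> (\<lambda>x. \<bar>f x - h x\<bar>)" "integrable \<mu> (\<lambda>x. \<bar>g x - h' x\<bar>)"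
      using add lipint[OF h(1,2)] lipint[OF h'(1,2)] by auto
    have "(\<integral>x. \<bar>(f x + g x) - (h x + h' x)\<bar> \<partial>\<mu>) \<le> (\<integral>x. \<bar>f x - h x\<bar> + \<bar>g x - h' x\<bar> \<partial>\<mu>)"
      using i by (intro integral_mono') auto
    also have "\<dots> < \<epsilon>" using i h h' by simp
    finally show ?case
      using lipschitz_on_add[OF h(1) h'(1)] h(2) h'(2)
      by (intro exI[of _ "\<lambda>x. h x + h' x"] exI[of _ "L + L'"] exI[of _ "C + C'"])
         (auto intro: order_trans[OF abs_triangle_ineq add_mono])
  next
    case (lim f s)
    have "(\<lambda>i. \<integral>x. \<bar>f x - s i x\<bar> \<partial>\<mu>) \<longlonglongrightarrow> (\<integral>x. 0 \<partial>\<mu>)"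
    \<comment> \<open>The induction rule supplies
      \<open>\<bar>s i x\<bar> \<le> 2 * \<bar>f x\<bar>\<close>, whence the factor \<open>3\<close>
      for the difference.\<close>
    proof (rule integral_dominated_convergence[where w="\<lambda>x. 3 * \<bar>f x\<bar>"])
      show "AE x in \<mu>. (\<lambda>i. \<bar>f x - s i x\<bar>) \<longlonglongrightarrow> 0"
      proof (rule AE_I2)
        fix x assume "x \<in> space \<mu>"
        then have "(\<lambda>i. \<bar>f x - s i x\<bar>) \<longlonglongrightarrow> \<bar>f x - f x\<bar>"
          by (intro tendsto_intros lim)
        then show "(\<lambda>i. \<bar>f x - s i x\<bar>) \<longlonglongrightarrow> 0" by simp
      qed
      show "AE x in \<mu>. norm \<bar>f x - s i x\<bar> \<le> 3 * \<bar>f x\<bar>" for i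
      proof (rule AE_I2)
        fix x assume "x \<in> space \<mu>"
        then have "norm (s i x) \<le> 2 * norm (f x)" using lim.hyps by blast
        then show "norm \<bar>f x - s i x\<bar> \<le> 3 * \<bar>f x\<bar>" by auto
      qed
    qed (use lim in auto)
    then have "\<forall>\<^sub>F i in sequentially. (\<integral>x. \<bar>f x - s i x\<bar> \<partial>\<mu>) < \<epsilon> / 2"
      using lim by (intro order_tendstoD) auto
    then obtain i where i: "(\<integral>x. \<bar>f x - s i x\<bar> \<partial>\<mu>) < \<epsilon> / 2"
      by (auto simp: eventually_sequentially)
    have e2: "0 < \<epsilon> / 2" using lim(6) by simp
    from lim.IH[OF e2, of i] obtain h L C where
      h: "L-lipschitz_on UNIV h" "\<forall>x. \<bar>h x\<bar> \<le> C" "(\<integral>x. \<bar>s i x - h x\<bar> \<partial>\<mu>) < \<epsilon> / 2"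
      by blast
    have ii: "integrable \<mu> (\<lambda>x. \<bar>f x - s i x\<bar>)" "integrable \<mu> (\<lambda>x. \<bar>s i x - h x\<bar>)"
      using lim lipint[OF h(1,2)] by auto
    have "(\<integral>x. \<bar>f x - h x\<bar> \<partial>\<mu>) \<le> (\<integral>x. \<bar>f x - s i x\<bar> + \<bar>s i x - h x\<bar> \<partial>\<mu>)"
      using ii by (intro integral_mono') auto
    also have "\<dots> < \<epsilon>" using ii i h by simp
    finally show ?case using h by blast
  }
qed

section \<open>Integrals against empirical measures as finite sums\<close>

lemma integral_weighted_empirical:
  fixes f :: "'a::topological_space \<Rightarrow> real"
  assumes f: "f \<in> borel_measurable borel" and w: "\<And>i. i < n \<Longrightarrow> 0 \<le> w i"
  shows "integrable (weighted_empirical n w z) f"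
    and "integral\<^sup>L (weighted_empirical n w z) f = (\<Sum>i<n. w i * f (z i))"
proof -
  have z: "z \<in> point_measure {..<n} (\<lambda>i. ennreal (w i)) \<rightarrow>\<^sub>M borel"
    by simp
  show "integrable (weighted_empirical n w z) f"
    unfolding weighted_empirical_def
    by (subst integrable_distr_eq[OF z f]) (simp add: integrable_point_measure_finite)
  show "integral\<^sup>L (weighted_empirical n w z) f = (\<Sum>i<n. w i * f (z i))"
    unfolding weighted_empirical_def using w
    by (subst integral_distr[OF z f], subst lebesgue_integral_point_measure_finite) auto
qed

lemma integral_empirical_prod:
  fixes f :: "'a::second_countable_topology \<times> 'b::second_countable_topology \<Rightarrow> real"
  assumes f: "f \<in> borel_measurable borel"
  shows "integral\<^sup>L (empirical n a \<Otimes>\<^sub>M empirical n b) f = (\<Sum>i<n. \<Sum>j<n. f (a i, b j)) / (real n)\<^sup>2"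
proof -
  have fin: "finite_measure (empirical n c)" for c :: "nat \<Rightarrow> 'c::topological_space"
    unfolding empirical_def weighted_empirical_def
    by (intro finite_measure.finite_measure_distr finite_measureI) (auto simp: emeasure_point_measure_finite space_point_measure ennreal_mult_eq_top_iff)
  interpret A: finite_measure "empirical n a" by (rule fin)
  interpret B: finite_measure "empirical n b" by (rule fin)
  interpret pair_sigma_finite "empirical n a" "empirical n b" by standard
  have sets_eq: "sets (empirical n a \<Otimes>\<^sub>M empirical n b) = sets borel"
    unfolding borel_prod[symmetric] by (intro sets_pair_measure_cong) (simp_all add: empirical_def weighted_empirical_def)
  have f': "f \<in> borel_measurable (empirical n a \<Otimes>\<^sub>M empirical n b)"
    using f unfolding measurable_cong_sets[OF sets_eq refl] .
  have sec: "(\<lambda>y. f (x, y)) \<in> borel_measurable borel" for x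
    using f by (intro measurable_compose[OF _ f]) (simp add: measurable_Pair1' flip: borel_prod)
  have int1: "integral\<^sup>L (empirical n c) h = (\<Sum>i<n. h (c i)) / real n"
    and intb: "integrable (empirical n c) h"
    if "h \<in> borel_measurable borel" for h :: "'c::topological_space \<Rightarrow> real" and c
    using integral_weighted_empirical[OF that, of n "\<lambda>_. 1 / real n" c]
    by (simp_all add: empirical_def sum_divide_distrib)
  have nn: "integrable (empirical n a \<Otimes>\<^sub>M empirical n b) f"
  proof (rule Fubini_integrable[OF f'])
    have "(\<lambda>x. \<integral>y. norm (f (x, y)) \<partial>empirical n b) = (\<lambda>x. (\<Sum>j<n. norm (f (x, b j))) / real n)"
      using sec by (intro ext int1) auto
    moreover have "(\<lambda>x. (\<Sum>j<n. norm (f (x, b j))) / real n) \<in> borel_measurable borel"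
      using f by (intro borel_measurable_divide borel_measurable_sum borel_measurable_norm measurable_compose[OF _ f] measurable_const)
        (simp_all add: measurable_Pair2' flip: borel_prod)
    ultimately show "integrable (empirical n a) (\<lambda>x. \<integral>y. norm (f (x, y)) \<partial>empirical n b)"
      by (simp add: intb)
    show "AE x in empirical n a. integrable (empirical n b) (\<lambda>y. f (x, y))"
      using sec intb by auto
  qed
  have "integral\<^sup>L (empirical n a \<Otimes>\<^sub>M empirical n b) f = (\<integral>x. \<integral>y. f (x, y) \<partial>empirical n b \<partial>empirical n a)"
    by (rule integral_fst'[OF nn, symmetric])
  also have "\<dots> = (\<integral>x. (\<Sum>j<n. f (x, b j)) / real n \<partial>empirical n a)"
    using sec by (intro Bochner_Integration.integral_cong int1) auto
  also have "\<dots> = (\<Sum>i<n. (\<Sum>j<n. f (a i, b j)) / real n) / real n"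
    using f by (intro int1 borel_measurable_divide borel_measurable_sum measurable_compose[OF _ f] measurable_const)
      (simp_all add: measurable_Pair2' flip: borel_prod)
  also have "\<dots> = (\<Sum>i<n. \<Sum>j<n. f (a i, b j)) / (real n)\<^sup>2"
    by (simp add: power2_eq_square flip: sum_divide_distrib)
  finally show ?thesis .
qed

section \<open>Test classes\<close>

text \<open>What the Lipschitz class and the unit ball of a universal kernel have in common.
  Oscillation on \<open>S\<close> is bounded instead of size, because Lipschitz functions may be
  shifted by any constant. The approximant is a single multiple \<open>c * f\<close>, as
  \<open>F\<close> is not a linear space but limits along \<open>f\<close> scale by
  \<open>c\<close>. Lipschitz targets suffice because they are dense in
  \<open>L\<^sup>1\<close>.\<close>

definition uniform_test_class :: "'a::metric_space set \<Rightarrow> ('a \<Rightarrow> real) set \<Rightarrow> bool" where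
  "uniform_test_class S F \<longleftrightarrow>
     F \<subseteq> borel_measurable borel \<and>
     (\<exists>C. \<forall>f\<in>F. \<forall>x\<in>S. \<forall>y\<in>S. \<bar>f x - f y\<bar> \<le> C) \<and>
     (\<forall>\<epsilon>>0. \<exists>\<delta>>0. \<forall>f\<in>F. \<forall>x\<in>S. \<forall>y\<in>S. dist x y < \<delta> \<longrightarrow> \<bar>f x - f y\<bar> \<le> \<epsilon>) \<and>
     (\<forall>h L \<epsilon>. L-lipschitz_on UNIV h \<longrightarrow> 0 < \<epsilon> \<longrightarrow> (\<exists>f\<in>F. \<exists>c. \<forall>x\<in>S. \<bar>h x - c * f x\<bar> < \<epsilon>))"

lemma uniform_test_classD:
  assumes "uniform_test_class S F"
  shows "F \<subseteq> borel_measurable borel"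
    and "\<exists>C. \<forall>f\<in>F. \<forall>x\<in>S. \<forall>y\<in>S. \<bar>f x - f y\<bar> \<le> C"
    and "0 < \<epsilon> \<Longrightarrow> \<exists>\<delta>>0. \<forall>f\<in>F. \<forall>x\<in>S. \<forall>y\<in>S. dist x y < \<delta> \<longrightarrow> \<bar>f x - f y\<bar> \<le> \<epsilon>"
    and "L-lipschitz_on UNIV h \<Longrightarrow> 0 < \<epsilon> \<Longrightarrow> \<exists>f\<in>F. \<exists>c. \<forall>x\<in>S. \<bar>h x - c * f x\<bar> < \<epsilon>"
  using assms unfolding uniform_test_class_def by auto

lemma uniform_test_class_lipschitz:
  fixes S :: "'a::metric_space set"
  assumes S: "compact S"
  shows "uniform_test_class S lipschitz_class"
  unfolding uniform_test_class_def
proof (intro conjI allI impI)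
  have lip: "\<bar>f x - f y\<bar> \<le> dist x y" if "f \<in> lipschitz_class" for f :: "'a \<Rightarrow> real" and x y
    using lipschitz_onD[of 1 UNIV f x y] that by (simp add: lipschitz_class_def dist_real_def)
  show "lipschitz_class \<subseteq> borel_measurable borel"
    by (auto simp: lipschitz_class_def intro!: borel_measurable_continuous_onI lipschitz_on_continuous_on)
  obtain C where "\<And>x y. x \<in> S \<Longrightarrow> y \<in> S \<Longrightarrow> dist x y \<le> C"
    using compact_imp_bounded[OF S] unfolding bounded_two_points by blast
  with lip show "\<exists>C. \<forall>f\<in>lipschitz_class. \<forall>x\<in>S. \<forall>y\<in>S. \<bar>f x - f y\<bar> \<le> C"
    by (meson order_trans)
  show "\<exists>\<delta>>0. \<forall>f\<in>lipschitz_class. \<forall>x\<in>S. \<forall>y\<in>S. dist x y < \<delta> \<longrightarrow> \<bar>f x - f y\<bar> \<le> \<epsilon>" if "0 < \<epsilon>" for \<epsilon>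
    using that lip by (intro exI[of _ \<epsilon>]) (meson less_imp_le order_trans)
  fix h :: "'a \<Rightarrow> real" and L \<epsilon> :: real assume h: "L-lipschitz_on UNIV h" and \<epsilon>: "0 < \<epsilon>"
  have L: "0 \<le> L" using h by (rule lipschitz_on_nonneg)
  \<comment> \<open>Dividing by \<open>L + 1\<close> instead of \<open>L\<close> covers constant
    functions with \<open>L = 0\<close>; the approximation by \<open>c * f\<close> with
    \<open>c = L + 1\<close> is then exact.\<close>
  have "(\<bar>1 / (L + 1)\<bar> * L)-lipschitz_on UNIV (\<lambda>x. 1 / (L + 1) * h x)"
    by (rule lipschitz_on_cmult_real[OF h])
  then have "1-lipschitz_on UNIV (\<lambda>x. 1 / (L + 1) * h x)"
    by (rule lipschitz_on_le) (use L in simp)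
  then show "\<exists>f\<in>lipschitz_class. \<exists>c. \<forall>x\<in>S. \<bar>h x - c * f x\<bar> < \<epsilon>"
    using L \<epsilon> by (intro bexI[of _ "\<lambda>x. 1 / (L + 1) * h x"] exI[of _ "L + 1"]) (auto simp: lipschitz_class_def)
qed

text \<open>The quadratic \<open>ip (f + c g) (f + c g)\<close> in \<open>c\<close> is nonnegative;
  evaluating it at its minimiser \<open>- ip f g / ip g g\<close> gives the claim. Membership in
  \<open>H\<close> is tracked throughout because \<open>ip\<close> is constrained only
  there.\<close>

lemma hilbert_function_space_Cauchy_Schwarz:
  assumes H: "hilbert_function_space S H ip" and f: "f \<in> H" and g: "g \<in> H"
  shows "\<bar>ip f g\<bar> \<le> sqrt (ip f f) * sqrt (ip g g)"
proof -
  have add: "(\<lambda>x. a x + b x) \<in> H" if "a \<in> H" "b \<in> H" for a b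
    using H that unfolding hilbert_function_space_def by blast
  have scale: "(\<lambda>x. c * a x) \<in> H" if "a \<in> H" for a c
    using H that unfolding hilbert_function_space_def by blast
  have sym: "ip a b = ip b a" if "a \<in> H" "b \<in> H" for a b
    using H that unfolding hilbert_function_space_def by blast
  have ip_add: "ip (\<lambda>x. a x + b x) h = ip a h + ip b h" if "a \<in> H" "b \<in> H" "h \<in> H" for a b h
    using H that unfolding hilbert_function_space_def by blast
  have ip_scale: "ip (\<lambda>x. c * a x) h = c * ip a h" if "a \<in> H" "h \<in> H" for a h c
    using H that unfolding hilbert_function_space_def by blast
  have nonneg: "0 \<le> ip a a" if "a \<in> H" for a
    using H that unfolding hilbert_function_space_def by blast
  have definite: "a = (\<lambda>_. 0)" if "a \<in> H" "ip a a = 0" for a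
    using H that unfolding hilbert_function_space_def by blast
  have quad: "0 \<le> ip f f + 2 * c * ip f g + c\<^sup>2 * ip g g" for c
  proof -
    let ?h = "\<lambda>x. f x + c * g x"
    have cg: "(\<lambda>x. c * g x) \<in> H" by (rule scale[OF g])
    have h: "?h \<in> H" by (rule add[OF f cg])
    have "ip ?h ?h = ip f ?h + c * ip g ?h"
      using ip_add[OF f cg h] ip_scale[OF g h] by simp
    also have "ip f ?h = ip f f + c * ip f g"
      using sym[OF f h] ip_add[OF f cg f] ip_scale[OF g f] sym[OF g f] by simp
    also have "ip g ?h = ip f g + c * ip g g"
      using sym[OF g h] ip_add[OF f cg g] ip_scale[OF g g] by simp
    finally show ?thesis using nonneg[OF h] by (simp add: algebra_simps power2_eq_square)
  qed
  show ?thesis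
  proof (cases "ip g g = 0")
    case True
    then have "g = (\<lambda>x. 0 * g x)" using definite[OF g] by simp
    then have "ip g f = 0" using ip_scale[OF g f, of 0] by simp
    then show ?thesis using sym[OF f g] nonneg[OF f] by (simp add: True)
  next
    case False
    then have pos: "0 < ip g g" using nonneg[OF g] by simp
    have "0 \<le> ip f f - (ip f g)\<^sup>2 / ip g g"
      using quad[of "- ip f g / ip g g"] pos by (simp add: power2_eq_square field_simps)
    then have "(ip f g)\<^sup>2 \<le> ip f f * ip g g" using pos by (simp add: field_simps)
    then have "sqrt ((ip f g)\<^sup>2) \<le> sqrt (ip f f * ip g g)" by (rule real_sqrt_le_mono)
    then show ?thesis by (simp add: real_sqrt_mult)
  qed
qed

text \<open>By the reproducing property and Cauchy--Schwarz, every \<open>f\<close> in the unit ball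
  satisfies \<open>\<bar>f x - f y\<bar> \<le> sqrt (d (x, y))\<close>, with one continuous
  \<open>d\<close> for the whole ball. Compactness of \<open>S\<close> turns this into bounded
  oscillation and equicontinuity; universality gives the approximation.\<close>

lemma uniform_test_class_rkhs:
  fixes S :: "'a::metric_space set"
  assumes S: "compact S" and rkhs: "is_rkhs S K H ip" and univ: "universal_kernel S K H"
  shows "uniform_test_class S (rkhs_unit_ball H ip)"
proof -
  define k where "k x = (\<lambda>y. if y \<in> S then K x y else 0)" for x
  \<comment> \<open>On \<open>S\<close> this is the squared norm of \<open>k x - k y\<close>, the
    distance between two kernel sections.\<close>
  define d where "d = (\<lambda>(x, y). K x x - K x y - K y x + K y y)"
  have HS: "hilbert_function_space S H ip" using rkhs by (simp add: is_rkhs_def)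
  have k: "k x \<in> H" if "x \<in> S" for x using rkhs that by (simp add: is_rkhs_def k_def)
  have repr: "f x = ip f (k x)" if "f \<in> H" "x \<in> S" for f x
    using rkhs that by (simp add: is_rkhs_def k_def)
  have zero: "f x = 0" if "f \<in> H" "x \<notin> S" for f x
    using HS that unfolding hilbert_function_space_def by blast
  have add: "(\<lambda>x. a x + b x) \<in> H" if "a \<in> H" "b \<in> H" for a b
    using HS that unfolding hilbert_function_space_def by blast
  have scale: "(\<lambda>x. c * a x) \<in> H" if "a \<in> H" for a c
    using HS that unfolding hilbert_function_space_def by blast
  have sym: "ip a b = ip b a" if "a \<in> H" "b \<in> H" for a b
    using HS that unfolding hilbert_function_space_def by blast
  have ip_add: "ip (\<lambda>x. a x + b x) h = ip a h + ip b h" if "a \<in> H" "b \<in> H" "h \<in> H" for a b h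
    using HS that unfolding hilbert_function_space_def by blast
  have ip_scale: "ip (\<lambda>x. c * a x) h = c * ip a h" if "a \<in> H" "h \<in> H" for a h c
    using HS that unfolding hilbert_function_space_def by blast
  have nonneg: "0 \<le> ip a a" if "a \<in> H" for a
    using HS that unfolding hilbert_function_space_def by blast
  have diff: "\<bar>f x - f y\<bar> \<le> sqrt (d (x, y))" if f: "f \<in> rkhs_unit_ball H ip" and x: "x \<in> S" and y: "y \<in> S" for f x y
  proof -
    have fH: "f \<in> H" and f1: "sqrt (ip f f) \<le> 1" using f by (auto simp: rkhs_unit_ball_def)
    have ky: "(\<lambda>z. - 1 * k y z) \<in> H" by (rule scale[OF k[OF y]])
    define h where "h = (\<lambda>z. k x z + - 1 * k y z)"
    have h: "h \<in> H" unfolding h_def by (rule add[OF k[OF x] ky])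
    have ip_h: "ip h a = a x - a y" if a: "a \<in> H" for a
    proof -
      have "ip h a = ip (k x) a + - 1 * ip (k y) a"
        unfolding h_def ip_add[OF k[OF x] ky a] ip_scale[OF k[OF y] a] ..
      then show ?thesis using repr[OF a x] repr[OF a y] sym[OF a k[OF x]] sym[OF a k[OF y]] by simp
    qed
    have "f x - f y = ip f h" using ip_h[OF fH] sym[OF fH h] by simp
    also have "\<bar>\<dots>\<bar> \<le> sqrt (ip f f) * sqrt (ip h h)"
      by (rule hilbert_function_space_Cauchy_Schwarz[OF HS fH h])
    also have "\<dots> \<le> 1 * sqrt (ip h h)"
      by (intro mult_right_mono f1) (simp add: nonneg[OF h])
    also have "ip h h = d (x, y)"
      using ip_h[OF h] x y by (simp add: h_def k_def d_def)
    finally show ?thesis by simp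
  qed
  have Kc: "continuous_on (S \<times> S) (\<lambda>(x, y). K x y)" using univ by (simp add: universal_kernel_def)
  have sub: "continuous_on (S \<times> S) (\<lambda>p. K (g p) (h p))"
    if "continuous_on (S \<times> S) g" "continuous_on (S \<times> S) h"
      "g ` (S \<times> S) \<subseteq> S" "h ` (S \<times> S) \<subseteq> S" for g h :: "'a \<times> 'a \<Rightarrow> 'a"
    using continuous_on_compose2[OF Kc, of "S \<times> S" "\<lambda>p. (g p, h p)"] that
    by (auto intro!: continuous_intros)
  have dc: "continuous_on (S \<times> S) d"
    unfolding d_def case_prod_beta'
    by (intro continuous_intros sub) auto
  have SS: "compact (S \<times> S)" using S by (intro compact_Times)
  have equi: "\<exists>\<delta>>0. \<forall>f\<in>rkhs_unit_ball H ip. \<forall>x\<in>S. \<forall>y\<in>S. dist x y < \<delta> \<longrightarrow> \<bar>f x - f y\<bar> \<le> \<epsilon>" if \<epsilon>: "0 < \<epsilon>" for \<epsilon>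
  proof -
    have "uniformly_continuous_on (S \<times> S) d" by (rule compact_uniformly_continuous[OF dc SS])
    then obtain \<delta> where \<delta>: "0 < \<delta>" "\<And>p q. p \<in> S \<times> S \<Longrightarrow> q \<in> S \<times> S \<Longrightarrow> dist q p < \<delta> \<Longrightarrow> dist (d q) (d p) < \<epsilon>\<^sup>2"
      unfolding uniformly_continuous_on_def using \<epsilon> zero_less_power[of \<epsilon> 2] by metis
    show ?thesis
    proof (intro exI[of _ \<delta>] conjI \<delta>(1) ballI impI)
      fix f x y assume f: "f \<in> rkhs_unit_ball H ip" and xy: "x \<in> S" "y \<in> S" "dist x y < \<delta>"
      \<comment> \<open>The comparison point is on the diagonal, where \<open>d\<close>
        vanishes.\<close>
      have "dist (x, y) (x, x) = dist x y" by (simp add: dist_Pair_Pair dist_commute)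
      then have "dist (d (x, y)) (d (x, x)) < \<epsilon>\<^sup>2" using xy by (intro \<delta>(2)) auto
      then have "d (x, y) \<le> \<epsilon>\<^sup>2" by (simp add: d_def dist_real_def)
      then have "sqrt (d (x, y)) \<le> \<epsilon>" using \<epsilon> by (simp add: real_le_lsqrt)
      then show "\<bar>f x - f y\<bar> \<le> \<epsilon>" using diff[OF f xy(1,2)] by linarith
    qed
  qed
  show ?thesis
    unfolding uniform_test_class_def
  proof (intro conjI allI impI equi)
    show "rkhs_unit_ball H ip \<subseteq> borel_measurable borel"
    proof
      fix f assume f: "f \<in> rkhs_unit_ball H ip"
      have "continuous_on S f"
        unfolding continuous_on_iff
      proof (intro ballI allI impI)
        fix x and e :: real assume x: "x \<in> S" and e: "0 < e"
        then obtain \<delta> where "0 < \<delta>" "\<forall>f\<in>rkhs_unit_ball H ip. \<forall>x\<in>S. \<forall>y\<in>S. dist x y < \<delta> \<longrightarrow> \<bar>f x - f y\<bar> \<le> e / 2"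
          using equi[of "e / 2"] by auto
        then show "\<exists>\<delta>>0. \<forall>x'\<in>S. dist x' x < \<delta> \<longrightarrow> dist (f x') (f x) < e"
          using f x e by (intro exI[of _ \<delta>]) (fastforce simp: dist_real_def)
      qed
      \<comment> \<open>Elements of \<open>H\<close> vanish off the closed set \<open>S\<close>, so
        continuity on \<open>S\<close> yields Borel measurability on the whole space.\<close>
      then have "(\<lambda>x. indicator S x *\<^sub>R f x) \<in> borel_measurable borel"
        using compact_imp_closed[OF S] by (intro borel_measurable_continuous_on_indicator) auto
      also have "(\<lambda>x. indicator S x *\<^sub>R f x) = f"
        using zero f by (auto simp: fun_eq_iff rkhs_unit_ball_def split: split_indicator)
      finally show "f \<in> borel_measurable borel" .
    qed
    obtain C where "\<And>p. p \<in> S \<times> S \<Longrightarrow> \<bar>d p\<bar> \<le> C"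
      using compact_imp_bounded[OF compact_continuous_image[OF dc SS]] by (auto simp: bounded_iff)
    then have "d (x, y) \<le> C" if "x \<in> S" "y \<in> S" for x y
      using that by (auto dest: abs_le_D1)
    then have "\<bar>f x - f y\<bar> \<le> sqrt C" if "f \<in> rkhs_unit_ball H ip" "x \<in> S" "y \<in> S" for f x y
      using diff[OF that] real_sqrt_le_mono that(2,3) order_trans by blast
    then show "\<exists>C. \<forall>f\<in>rkhs_unit_ball H ip. \<forall>x\<in>S. \<forall>y\<in>S. \<bar>f x - f y\<bar> \<le> C" by blast
    fix h :: "'a \<Rightarrow> real" and L \<epsilon> :: real assume h: "L-lipschitz_on UNIV h" and \<epsilon>: "0 < \<epsilon>"
    have "continuous_on S h"
      using continuous_on_subset[OF lipschitz_on_continuous_on[OF h]] by blast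
    then obtain f where f: "f \<in> H" "\<forall>x\<in>S. \<bar>f x - h x\<bar> < \<epsilon>"
      using univ \<epsilon> unfolding universal_kernel_def by blast
    \<comment> \<open>Exceeds the norm of \<open>f\<close> and is positive even for
      \<open>f = 0\<close>, so \<open>f / c\<close> lies in the unit ball.\<close>
    define c where "c = sqrt (ip f f) + 1"
    have c: "0 < c" using nonneg[OF f(1)] by (simp add: c_def add_nonneg_pos)
    let ?f = "\<lambda>x. 1 / c * f x"
    have fH: "?f \<in> H" by (rule scale[OF f(1)])
    have "ip ?f ?f = 1 / c * ip f ?f" by (rule ip_scale[OF f(1) fH])
    also have "ip f ?f = ip ?f f" by (rule sym[OF f(1) fH])
    also have "ip ?f f = 1 / c * ip f f" by (rule ip_scale[OF f(1) f(1)])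
    finally have "sqrt (ip ?f ?f) = sqrt (ip f f) / c"
      using c by (simp add: real_sqrt_divide real_sqrt_mult)
    also have "\<dots> \<le> 1" using c by (simp add: c_def)
    finally have "?f \<in> rkhs_unit_ball H ip" using fH by (simp add: rkhs_unit_ball_def)
    then show "\<exists>f\<in>rkhs_unit_ball H ip. \<exists>c. \<forall>x\<in>S. \<bar>h x - c * f x\<bar> < \<epsilon>"
      using f(2) c by (intro bexI[of _ ?f] exI[of _ c]) (auto simp: abs_minus_commute)
  qed
qed

section \<open>Convergence by rounding and near-optimality\<close>

text \<open>A function of the rounded point is constant on cells, so its weighted sum is a finite
  combination of cell masses with coefficients free of the sample.\<close>

lemma sum_rounding:
  fixes f :: "'b \<Rightarrow> real"
  assumes "finite (range r)" "finite I"
  shows "(\<Sum>i\<in>I. u i * f (r (p i))) = (\<Sum>c\<in>range r. f c * (\<Sum>i\<in>I. u i * of_bool (r (p i) = c)))"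
proof -
  have "(\<Sum>c\<in>range r. f c * (\<Sum>i\<in>I. u i * of_bool (r (p i) = c)))
      = (\<Sum>i\<in>I. \<Sum>c\<in>range r. if c = r (p i) then u i * f c else 0)"
    unfolding sum_distrib_left by (subst sum.swap) (auto intro!: sum.cong)
  also have "\<dots> = (\<Sum>i\<in>I. u i * f (r (p i)))"
    by (rule sum.cong[OF refl]) (simp add: assms(1))
  finally show ?thesis ..
qed

lemma abs_weighted_sum_diff_le:
  fixes a b u :: "'i \<Rightarrow> real"
  assumes "\<And>i. i \<in> I \<Longrightarrow> 0 \<le> u i" "sum u I = 1" "\<And>i. i \<in> I \<Longrightarrow> \<bar>a i - b i\<bar> \<le> \<epsilon>"
  shows "\<bar>(\<Sum>i\<in>I. u i * a i) - (\<Sum>i\<in>I. u i * b i)\<bar> \<le> \<epsilon>"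
proof -
  have "\<bar>(\<Sum>i\<in>I. u i * a i) - (\<Sum>i\<in>I. u i * b i)\<bar> = \<bar>\<Sum>i\<in>I. u i * (a i - b i)\<bar>"
    by (simp add: right_diff_distrib sum_subtractf)
  also have "\<dots> \<le> (\<Sum>i\<in>I. u i * \<epsilon>)"
    using assms by (intro order_trans[OF sum_abs] sum_mono) (auto simp: abs_mult intro!: mult_left_mono)
  also have "\<dots> = \<epsilon>" using assms(2) by (simp flip: sum_distrib_right)
  finally show ?thesis .
qed

text \<open>Both families of weights are probability vectors, so test functions may be shifted by
  constants; only their oscillation on \<open>S\<close> enters.\<close>

lemma uniform_convergence_by_rounding:
  fixes S :: "'a::metric_space set" and F :: "('a \<Rightarrow> real) set"
  assumes test: "uniform_test_class S F" and ne: "S \<noteq> {}"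
    and fin: "\<And>n. finite (I n)" "\<And>n. finite (J n)"
    and p: "\<And>n i. i \<in> I n \<Longrightarrow> p n i \<in> S" and q: "\<And>n j. j \<in> J n \<Longrightarrow> q n j \<in> S"
    and u: "\<forall>\<^sub>F n in sequentially. (\<forall>i\<in>I n. 0 \<le> u n i) \<and> sum (u n) (I n) = 1"
    and v: "\<forall>\<^sub>F n in sequentially. (\<forall>j\<in>J n. 0 \<le> v n j) \<and> sum (v n) (J n) = 1"
    and r: "\<And>k :: nat. finite (range (r k))" "\<And>k. range (r k) \<subseteq> S"
      "\<And>k x. x \<in> S \<Longrightarrow> dist x (r k x) < inverse (real (Suc k))"
    and lim: "\<And>k c. c \<in> range (r k) \<Longrightarrow>
      (\<lambda>n. (\<Sum>i\<in>I n. u n i * of_bool (r k (p n i) = c)) - (\<Sum>j\<in>J n. v n j * of_bool (r k (q n j) = c))) \<longlonglongrightarrow> 0"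
    and \<epsilon>: "0 < \<epsilon>"
  shows "\<forall>\<^sub>F n in sequentially. \<forall>f\<in>F. \<bar>(\<Sum>i\<in>I n. u n i * f (p n i)) - (\<Sum>j\<in>J n. v n j * f (q n j))\<bar> \<le> \<epsilon>"
proof -
  obtain c0 where c0: "c0 \<in> S" using ne by auto
  obtain C where C: "\<And>f x y. f \<in> F \<Longrightarrow> x \<in> S \<Longrightarrow> y \<in> S \<Longrightarrow> \<bar>f x - f y\<bar> \<le> C"
    using uniform_test_classD(2)[OF test] by blast
  obtain \<delta> where \<delta>: "0 < \<delta>" "\<And>f x y. f \<in> F \<Longrightarrow> x \<in> S \<Longrightarrow> y \<in> S \<Longrightarrow> dist x y < \<delta> \<Longrightarrow> \<bar>f x - f y\<bar> \<le> \<epsilon> / 3"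
    using uniform_test_classD(3)[OF test, of "\<epsilon> / 3"] \<epsilon> by auto
  \<comment> \<open>The partition is fixed by \<open>\<delta>\<close> before any \<open>f\<close> is
    chosen; its finitely many cell masses then control the whole class at once.\<close>
  obtain k where k: "inverse (real (Suc k)) < \<delta>" using reals_Archimedean[OF \<delta>(1)] by blast
  define \<Delta> where "\<Delta> n c = (\<Sum>i\<in>I n. u n i * of_bool (r k (p n i) = c)) - (\<Sum>j\<in>J n. v n j * of_bool (r k (q n j) = c))" for n c
  have "(\<lambda>n. \<Sum>c\<in>range (r k). C * \<bar>\<Delta> n c\<bar>) \<longlonglongrightarrow> (\<Sum>c\<in>range (r k). C * \<bar>0\<bar>)"
    using lim unfolding \<Delta>_def by (intro tendsto_intros) auto
  then have "(\<lambda>n. \<Sum>c\<in>range (r k). C * \<bar>\<Delta> n c\<bar>) \<longlonglongrightarrow> 0" by simp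
  then have "\<forall>\<^sub>F n in sequentially. (\<Sum>c\<in>range (r k). C * \<bar>\<Delta> n c\<bar>) < \<epsilon> / 3"
    using \<epsilon> by (intro order_tendstoD) auto
  with u v show ?thesis
  proof eventually_elim
    case (elim n)
    show ?case
    proof
      fix f assume f: "f \<in> F"
      have near: "\<bar>f x - f (r k x)\<bar> \<le> \<epsilon> / 3" if "x \<in> S" for x
        using r(2)[of k] r(3)[OF that, of k] k by (intro \<delta>(2)[OF f that]) auto
      have 1: "\<bar>(\<Sum>i\<in>I n. u n i * f (p n i)) - (\<Sum>i\<in>I n. u n i * f (r k (p n i)))\<bar> \<le> \<epsilon> / 3"
        using elim(1) near p by (intro abs_weighted_sum_diff_le) auto
      have 2: "\<bar>(\<Sum>j\<in>J n. v n j * f (q n j)) - (\<Sum>j\<in>J n. v n j * f (r k (q n j)))\<bar> \<le> \<epsilon> / 3"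
        using elim(2) near q by (intro abs_weighted_sum_diff_le) auto
      \<comment> \<open>Bounded on \<open>S\<close> by \<open>C\<close> uniformly over the class,
        which \<open>f\<close> itself need not be.\<close>
      let ?g = "\<lambda>x. f x - f c0"
      have "(\<Sum>i\<in>I n. u n i * f (r k (p n i))) - (\<Sum>j\<in>J n. v n j * f (r k (q n j)))
          = (\<Sum>i\<in>I n. u n i * ?g (r k (p n i))) - (\<Sum>j\<in>J n. v n j * ?g (r k (q n j)))"
        using elim(1,2) by (simp add: right_diff_distrib sum_subtractf flip: sum_distrib_right)
      also have "\<dots> = (\<Sum>c\<in>range (r k). ?g c * \<Delta> n c)"
        unfolding sum_rounding[OF r(1) fin(1), where f="?g"] sum_rounding[OF r(1) fin(2), where f="?g"]
        by (simp add: \<Delta>_def right_diff_distrib sum_subtractf)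
      also have "\<bar>\<dots>\<bar> \<le> (\<Sum>c\<in>range (r k). C * \<bar>\<Delta> n c\<bar>)"
        using C[OF f _ c0] r(2)[of k]
        by (intro order_trans[OF sum_abs] sum_mono) (auto simp: abs_mult intro!: mult_right_mono)
      finally have "\<bar>(\<Sum>i\<in>I n. u n i * f (r k (p n i))) - (\<Sum>j\<in>J n. v n j * f (r k (q n j)))\<bar> < \<epsilon> / 3"
        using elim(3) by linarith
      with 1 2 show "\<bar>(\<Sum>i\<in>I n. u n i * f (p n i)) - (\<Sum>j\<in>J n. v n j * f (q n j))\<bar> \<le> \<epsilon>"
        by linarith
    qed
  qed
qed

text \<open>Uniform continuity on \<open>K\<close> puts \<open>f\<close> within
  \<open>\<epsilon> / 3\<close> of a combination of cell indicators, both under the weights and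
  under \<open>Q\<close>. The assumed limits do not mention \<open>f\<close>, so a single null set
  serves all \<open>f\<close>.\<close>

lemma converges_in_distribution_by_rounding:
  fixes K :: "'a::metric_space set" and Q :: "'a measure"
  assumes K: "compact K" and x: "\<And>i. x i \<in> K"
    and v: "\<And>n i. i < n \<Longrightarrow> 0 \<le> v n i" "\<And>n. 0 < n \<Longrightarrow> (\<Sum>i<n. v n i) = 1"
    and Q: "prob_space Q" "sets Q = sets borel" "AE y in Q. y \<in> K"
    and r: "\<And>k :: nat. finite (range (r k))" "\<And>k. range (r k) \<subseteq> K" "\<And>k. r k \<in> borel \<rightarrow>\<^sub>M borel"
      "\<And>k x. x \<in> K \<Longrightarrow> dist x (r k x) < inverse (real (Suc k))"
    and lim: "\<And>k c. c \<in> range (r k) \<Longrightarrow>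
      (\<lambda>n. \<Sum>i<n. v n i * of_bool (r k (x i) = c)) \<longlonglongrightarrow> (\<integral>y. of_bool (r k y = c) \<partial>Q)"
  shows "converges_in_distribution (\<lambda>n. weighted_empirical n (v n) x) Q"
  unfolding converges_in_distribution_def
proof (intro allI impI, elim conjE)
  fix f :: "'a \<Rightarrow> real" assume fc: "continuous_on UNIV f" and fb: "bounded (range f)"
  interpret Q: prob_space Q by fact
  obtain C where C: "\<And>y. \<bar>f y\<bar> \<le> C" using fb by (auto simp: bounded_iff)
  have fm: "f \<in> borel_measurable borel" by (rule borel_measurable_continuous_onI[OF fc])
  have E: "integral\<^sup>L (weighted_empirical n (v n) x) f = (\<Sum>i<n. v n i * f (x i))" for n
    using v(1) by (rule integral_weighted_empirical(2)[OF fm])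
  have mQ: "h \<in> borel_measurable Q" if "h \<in> borel_measurable borel" for h :: "'a \<Rightarrow> real"
    using that unfolding measurable_cong_sets[OF Q(2) refl] .
  have fQ: "integrable Q f" using C mQ[OF fm] by (intro Q.integrable_const_bound[of _ C]) auto
  show "(\<lambda>n. integral\<^sup>L (weighted_empirical n (v n) x) f) \<longlonglongrightarrow> integral\<^sup>L Q f"
    unfolding E
  proof (rule LIMSEQ_I)
    fix \<epsilon> :: real assume \<epsilon>: "0 < \<epsilon>"
    have "uniformly_continuous_on K f"
      using continuous_on_subset[OF fc] K by (intro compact_uniformly_continuous) auto
    then obtain \<delta> where \<delta>: "0 < \<delta>" "\<And>y z. y \<in> K \<Longrightarrow> z \<in> K \<Longrightarrow> dist z y < \<delta> \<Longrightarrow> \<bar>f z - f y\<bar> < \<epsilon> / 3"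
      unfolding uniformly_continuous_on_def dist_real_def using \<epsilon> by (elim allE[of _ "\<epsilon> / 3"]) auto
    obtain k where k: "inverse (real (Suc k)) < \<delta>" using reals_Archimedean[OF \<delta>(1)] by blast
    have near: "\<bar>f y - f (r k y)\<bar> \<le> \<epsilon> / 3" if "y \<in> K" for y
      using r(2)[of k] r(4)[OF that, of k] k that by (intro less_imp_le \<delta>(2)) auto
    have frm: "(\<lambda>y. f (r k y)) \<in> borel_measurable borel" by (rule measurable_compose[OF r(3) fm])
    have frQ: "integrable Q (\<lambda>y. f (r k y))"
      using C mQ[OF frm] by (intro Q.integrable_const_bound[of _ C]) auto
    have bm: "(\<lambda>y. of_bool (r k y = c) :: real) \<in> borel_measurable Q" for c
    proof -
      have "{y. r k y = c} = r k -` {c} \<inter> space borel" by auto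
      also have "\<dots> \<in> sets borel" by (rule measurable_sets[OF r(3)]) simp
      finally have "(indicator {y. r k y = c} :: 'a \<Rightarrow> real) \<in> borel_measurable borel" by simp
      also have "(indicator {y. r k y = c} :: 'a \<Rightarrow> real) = (\<lambda>y. of_bool (r k y = c))"
        by (auto simp: indicator_def)
      finally show ?thesis by (rule mQ)
    qed
    have bQ: "integrable Q (\<lambda>y. of_bool (r k y = c) :: real)" for c
      using bm by (intro Q.integrable_const_bound[of _ 1]) auto
    have "(\<integral>y. f (r k y) \<partial>Q) = (\<integral>y. (\<Sum>c\<in>range (r k). f c * of_bool (r k y = c)) \<partial>Q)"
      \<comment> \<open>A one-point index set with weight \<open>1\<close> turns the regrouping of
        sums into a pointwise expansion over cells.\<close>
      using sum_rounding[OF r(1), of "{()}" "\<lambda>_. 1" f k "\<lambda>_. y" for y] by simp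
    also have "\<dots> = (\<Sum>c\<in>range (r k). f c * (\<integral>y. of_bool (r k y = c) \<partial>Q))"
      using bQ by simp
    finally have R: "(\<integral>y. f (r k y) \<partial>Q) = (\<Sum>c\<in>range (r k). f c * (\<integral>y. of_bool (r k y = c) \<partial>Q))" .
    have "(\<lambda>n. \<Sum>c\<in>range (r k). f c * (\<Sum>i<n. v n i * of_bool (r k (x i) = c))) \<longlonglongrightarrow> (\<integral>y. f (r k y) \<partial>Q)"
      unfolding R by (intro tendsto_intros lim)
    then have "(\<lambda>n. \<Sum>i<n. v n i * f (r k (x i))) \<longlonglongrightarrow> (\<integral>y. f (r k y) \<partial>Q)"
      by (simp add: sum_rounding[OF r(1)])
    from LIMSEQ_D[OF this, of "\<epsilon> / 3"] \<epsilon> obtain N where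
      N: "\<And>n. N \<le> n \<Longrightarrow> \<bar>(\<Sum>i<n. v n i * f (r k (x i))) - (\<integral>y. f (r k y) \<partial>Q)\<bar> < \<epsilon> / 3"
      by auto
    have Qd: "\<bar>(\<integral>y. f y \<partial>Q) - (\<integral>y. f (r k y) \<partial>Q)\<bar> \<le> \<epsilon> / 3"
    proof -
      have "\<bar>(\<integral>y. f y \<partial>Q) - (\<integral>y. f (r k y) \<partial>Q)\<bar> = \<bar>\<integral>y. f y - f (r k y) \<partial>Q\<bar>"
        using fQ frQ by simp
      also have "\<dots> \<le> (\<integral>y. \<bar>f y - f (r k y)\<bar> \<partial>Q)" by (rule integral_abs_bound)
      also have "\<dots> \<le> (\<integral>y. \<epsilon> / 3 \<partial>Q)"
        using fQ frQ Q(3) near by (intro integral_mono_AE) auto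
      finally show ?thesis by (simp add: Q.prob_space)
    qed
    show "\<exists>N. \<forall>n\<ge>N. norm ((\<Sum>i<n. v n i * f (x i)) - integral\<^sup>L Q f) < \<epsilon>"
    \<comment> \<open>The weights have total mass \<open>1\<close> only for positive
      \<open>n\<close>.\<close>
    proof (intro exI[of _ "max N 1"] allI impI)
      fix n assume n: "max N 1 \<le> n"
      have "\<bar>(\<Sum>i<n. v n i * f (x i)) - (\<Sum>i<n. v n i * f (r k (x i)))\<bar> \<le> \<epsilon> / 3"
        using v(1)[of _ n] v(2)[of n] n near x by (intro abs_weighted_sum_diff_le) auto
      then show "norm ((\<Sum>i<n. v n i * f (x i)) - integral\<^sup>L Q f) < \<epsilon>"
        using N[of n] n Qd unfolding real_norm_def by linarith
    qed
  qed
qed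

section \<open>Imbalance against the product of empirical marginals, and near-optimality\<close>

definition product_mean :: "nat \<Rightarrow> (nat \<Rightarrow> 'a \<times> 'b) \<Rightarrow> ('a \<times> 'b \<Rightarrow> real) \<Rightarrow> real" where
  "product_mean n z f = (\<Sum>i<n. \<Sum>j<n. f (fst (z i), snd (z j))) / (real n)\<^sup>2"

lemma ipm_weighted_empirical_product:
  fixes F :: "('a::second_countable_topology \<times> 'b::second_countable_topology \<Rightarrow> real) set"
  assumes F: "F \<subseteq> borel_measurable borel" and w: "\<And>i. i < n \<Longrightarrow> 0 \<le> w i"
  shows "ipm F (weighted_empirical n w z) (empirical n (\<lambda>i. fst (z i)) \<Otimes>\<^sub>M empirical n (\<lambda>i. snd (z i)))
    = (SUP f\<in>F. ereal \<bar>(\<Sum>i<n. w i * f (z i)) - product_mean n z f\<bar>)"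
  unfolding ipm_def
proof (rule SUP_cong[OF refl])
  fix f assume "f \<in> F"
  then have f: "f \<in> borel_measurable borel" using F by auto
  show "ereal \<bar>integral\<^sup>L (weighted_empirical n w z) f - integral\<^sup>L (empirical n (\<lambda>i. fst (z i)) \<Otimes>\<^sub>M empirical n (\<lambda>i. snd (z i))) f\<bar>
      = ereal \<bar>(\<Sum>i<n. w i * f (z i)) - product_mean n z f\<bar>"
    using integral_weighted_empirical(2)[OF f w] integral_empirical_prod[OF f] by (simp add: product_mean_def)
qed

text \<open>Optimality bounds the squared imbalance of \<open>w\<close> by that of any feasible
  competitor \<open>v\<close> plus \<open>lam\<close> times the difference of the penalties. Each
  penalty is \<open>n\<close> terms of size at most \<open>B\<close>, divided by
  \<open>n\<^sup>2\<close>.\<close>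

lemma cbdm_weights_imbalance_le:
  fixes F :: "('a::second_countable_topology \<times> 'b::second_countable_topology \<Rightarrow> real) set"
  assumes F: "F \<subseteq> borel_measurable borel"
    and w: "is_cbdm_weights F lam \<rho> W n z w"
    and v: "v \<in> weight_simplex n" "\<And>i. i < n \<Longrightarrow> v i \<le> W / real n"
    and near: "\<And>f. f \<in> F \<Longrightarrow> \<bar>(\<Sum>i<n. v i * f (z i)) - product_mean n z f\<bar> \<le> \<epsilon>"
    and \<rho>: "\<And>t. t \<in> {0..W} \<Longrightarrow> \<bar>\<rho> t\<bar> \<le> B" and lam: "0 \<le> lam" and n: "0 < n"
    and f: "f \<in> F"
  shows "((\<Sum>i<n. w i * f (z i)) - product_mean n z f)\<^sup>2 \<le> \<epsilon>\<^sup>2 + 2 * lam * B / real n"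
proof -
  define D where "D u f = \<bar>(\<Sum>i<n. u i * f (z i)) - product_mean n z f\<bar>" for u f
  have wf: "w \<in> weight_simplex n" "\<forall>i<n. w i \<le> W / real n"
    and opt: "\<not> cbdm_objective F lam \<rho> n z v < cbdm_objective F lam \<rho> n z w"
    using w v unfolding is_cbdm_weights_def is_arg_min_def by auto
  have pen: "\<bar>weight_penalty \<rho> n u\<bar> \<le> B / real n" if u: "u \<in> weight_simplex n" "\<forall>i<n. u i \<le> W / real n" for u
  proof -
    have "\<bar>\<Sum>i<n. \<rho> (real n * u i)\<bar> \<le> (\<Sum>i<n. B)"
      using u n by (intro order_trans[OF sum_abs] sum_mono \<rho>) (auto simp: weight_simplex_def field_simps)
    then have "\<bar>\<Sum>i<n. \<rho> (real n * u i)\<bar> / (real n)\<^sup>2 \<le> (real n * B) / (real n)\<^sup>2"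
      by (intro divide_right_mono) auto
    then show ?thesis
      using n by (simp add: weight_penalty_def abs_mult power2_eq_square)
  qed
  have obj: "cbdm_objective F lam \<rho> n z u = (SUP f\<in>F. ereal (D u f))\<^sup>2 + ereal (lam * weight_penalty \<rho> n u)"
    if "u \<in> weight_simplex n" for u
    unfolding cbdm_objective_def D_def
    using that by (subst ipm_weighted_empirical_product[OF F]) (auto simp: weight_simplex_def)
  have "(SUP f\<in>F. ereal (D v f)) \<le> ereal \<epsilon>"
    using near by (intro SUP_least) (simp add: D_def)
  moreover have "ereal (D v f) \<le> (SUP f\<in>F. ereal (D v f))" using f by (rule SUP_upper)
  moreover have "0 \<le> D v f" by (simp add: D_def)
  ultimately obtain a where a: "(SUP f\<in>F. ereal (D v f)) = ereal a" "0 \<le> a" "a \<le> \<epsilon>"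
    by (cases "SUP f\<in>F. ereal (D v f)") auto
  have wle: "ereal (D w f) \<le> (SUP f\<in>F. ereal (D w f))" using f by (rule SUP_upper)
  have "(SUP f\<in>F. ereal (D w f))\<^sup>2 + ereal (lam * weight_penalty \<rho> n w) \<le> ereal (a\<^sup>2 + lam * weight_penalty \<rho> n v)"
    using opt unfolding obj[OF wf(1)] obj[OF v(1)] a by (simp add: not_less)
  \<comment> \<open>The supremum at \<open>w\<close> could a priori be infinite; minimality against
    the finite objective of \<open>v\<close> excludes this.\<close>
  then obtain b where b: "(SUP f\<in>F. ereal (D w f)) = ereal b"
    "b\<^sup>2 + lam * weight_penalty \<rho> n w \<le> a\<^sup>2 + lam * weight_penalty \<rho> n v"
    using wle by (cases "SUP f\<in>F. ereal (D w f)") (auto simp: power2_eq_square)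
  have "D w f \<le> b" using wle b by simp
  then have "(D w f)\<^sup>2 \<le> b\<^sup>2" by (intro power_mono) (auto simp: D_def)
  also have "\<dots> \<le> a\<^sup>2 + lam * (weight_penalty \<rho> n v - weight_penalty \<rho> n w)"
    using b(2) by (simp add: right_diff_distrib)
  also have "\<dots> \<le> \<epsilon>\<^sup>2 + lam * (B / real n + B / real n)"
    using a pen[OF wf] pen[OF v(1)] v(2) lam by (intro add_mono power_mono mult_left_mono) auto
  finally show ?thesis by (simp add: D_def algebra_simps)
qed

text \<open>All that is retained of the minimisation, free of extended reals and of
  \<open>\<rho>\<close>. It reads only the entries of \<open>w\<close> below \<open>n\<close>, so it
  survives modifying \<open>w\<close> elsewhere; the bounds on single weights are kept
  separately.\<close>

definition near_optimal_weights ::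
  "('a \<times> 'b \<Rightarrow> real) set \<Rightarrow> real \<Rightarrow> real \<Rightarrow> nat \<Rightarrow> (nat \<Rightarrow> 'a \<times> 'b) \<Rightarrow> (nat \<Rightarrow> real) \<Rightarrow> bool" where
  "near_optimal_weights F W R n z w \<longleftrightarrow> (\<Sum>i<n. w i) = 1 \<and>
     (\<forall>v\<in>weight_simplex n. \<forall>\<epsilon>. (\<forall>i<n. v i \<le> W / real n) \<longrightarrow>
       (\<forall>f\<in>F. \<bar>(\<Sum>i<n. v i * f (z i)) - product_mean n z f\<bar> \<le> \<epsilon>) \<longrightarrow>
       (\<forall>f\<in>F. ((\<Sum>i<n. w i * f (z i)) - product_mean n z f)\<^sup>2 \<le> \<epsilon>\<^sup>2 + R / real n))"

lemma near_optimal_weights_cong: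
  assumes "\<And>i. i < n \<Longrightarrow> w i = v i"
  shows "near_optimal_weights F W R n z w \<longleftrightarrow> near_optimal_weights F W R n z v"
proof -
  have "(\<Sum>i<n. w i * h i) = (\<Sum>i<n. v i * h i)" for h
    using assms by (intro sum.cong) auto
  moreover have "(\<Sum>i<n. w i) = (\<Sum>i<n. v i)"
    using assms by (intro sum.cong) auto
  ultimately show ?thesis by (simp only: near_optimal_weights_def)
qed

lemma near_optimal_weightsD:
  assumes "near_optimal_weights F W R n z w" "v \<in> weight_simplex n" "\<forall>i<n. v i \<le> W / real n"
    and "\<forall>f\<in>F. \<bar>(\<Sum>i<n. v i * f (z i)) - product_mean n z f\<bar> \<le> \<epsilon>" and "f \<in> F"
  shows "((\<Sum>i<n. w i * f (z i)) - product_mean n z f)\<^sup>2 \<le> \<epsilon>\<^sup>2 + R / real n"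
  using assms unfolding near_optimal_weights_def by blast

lemma cbdm_weights_near_optimal:
  fixes F :: "('a::second_countable_topology \<times> 'b::second_countable_topology \<Rightarrow> real) set"
  assumes F: "F \<subseteq> borel_measurable borel"
    and w: "is_cbdm_weights F lam \<rho> W n z w"
    and \<rho>: "\<And>t. t \<in> {0..W} \<Longrightarrow> \<bar>\<rho> t\<bar> \<le> B" and lam: "0 \<le> lam" and n: "0 < n"
  shows "near_optimal_weights F W (2 * lam * B) n z w"
  unfolding near_optimal_weights_def
proof (intro conjI ballI allI impI)
  show "(\<Sum>i<n. w i) = 1"
    using w by (simp add: is_cbdm_weights_def is_arg_min_def weight_simplex_def)
  fix v \<epsilon> f
  assume "v \<in> weight_simplex n" "\<forall>i<n. v i \<le> W / real n"
    "\<forall>f\<in>F. \<bar>(\<Sum>i<n. v i * f (z i)) - product_mean n z f\<bar> \<le> \<epsilon>" "f \<in> F"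
  then show "((\<Sum>i<n. w i * f (z i)) - product_mean n z f)\<^sup>2 \<le> \<epsilon>\<^sup>2 + 2 * lam * B / real n"
    by (intro cbdm_weights_imbalance_le[OF F w _ _ _ \<rho> lam n]) auto
qed

lemma weighted_empirical_cong:
  assumes "\<And>i. i < n \<Longrightarrow> v i = w i"
  shows "weighted_empirical n v z = weighted_empirical n w z"
proof -
  have "point_measure {..<n} (\<lambda>i. ennreal (v i)) = point_measure {..<n} (\<lambda>i. ennreal (w i))"
    unfolding point_measure_def using assms by (intro density_cong) (auto simp: AE_count_space)
  then show ?thesis by (simp add: weighted_empirical_def)
qed

section \<open>Almost sure limits of the balanced sample\<close>

text \<open>The sampling setting with almost sure data replaced by everywhere valid versions where
  possible: \<open>g\<close> is a density bounded at every point and the caps on \<open>w\<close>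
  hold for every argument. Taking the covariate vector as the only argument of \<open>w\<close>
  expresses that the weights ignore the outcomes.\<close>

locale balanced_sampling = prob_space M for M :: "'w measure" +
  fixes V :: "nat \<Rightarrow> 'w \<Rightarrow> ('t::euclidean_space \<times> 'x::euclidean_space) \<times> real"
    and \<mu> :: "('t \<times> 'x) measure" and \<kappa> :: "'t \<times> 'x \<Rightarrow> real measure"
    and g :: "'t \<times> 'x \<Rightarrow> real" and W\<^sub>0 W R :: real
    and F :: "('t \<times> 'x \<Rightarrow> real) set"
    and w :: "nat \<Rightarrow> (nat \<Rightarrow> 't \<times> 'x) \<Rightarrow> nat \<Rightarrow> real"
  assumes mu: "prob_space \<mu>" "sets \<mu> = sets borel"
    and kappa: "\<kappa> \<in> borel \<rightarrow>\<^sub>M prob_algebra borel"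
    and indep: "indep_vars (\<lambda>_. borel) V UNIV"
    and law: "\<And>i. distr M borel (V i) = kernel_prod \<mu> \<kappa>"
    and compact_Z: "compact (msupport \<mu>)"
    and compact_Y: "compact (msupport (distr (kernel_prod \<mu> \<kappa>) borel snd))"
    and ac: "absolutely_continuous \<mu> (marginal_prod \<mu>)"
    and g: "g \<in> borel_measurable borel" "\<And>z. 0 \<le> g z" "\<And>z. g z \<le> W\<^sub>0"
    and marginal_density: "marginal_prod \<mu> = density \<mu> (\<lambda>z. ennreal (g z))"
    and W: "0 < W\<^sub>0" "W\<^sub>0 < W"
    and test: "uniform_test_class (msupport \<mu>) F"
    and w_measurable: "\<And>n i. i < n \<Longrightarrow> (\<lambda>z. w n z i) \<in> borel_measurable (\<Pi>\<^sub>M j\<in>{..<n}. borel)"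
    and w_bounds: "\<And>n z i. 0 \<le> w n z i \<and> w n z i \<le> W / real n"
    and near_optimal: "AE \<omega> in M. \<forall>n>0.
      near_optimal_weights F W R n (\<lambda>i. fst (V i \<omega>)) (w n (\<lambda>j\<in>{..<n}. fst (V j \<omega>)))"
begin

abbreviation "S \<equiv> msupport \<mu>"

definition Z :: "nat \<Rightarrow> 'w \<Rightarrow> 't \<times> 'x" where "Z i \<omega> = fst (V i \<omega>)"

definition wt :: "nat \<Rightarrow> 'w \<Rightarrow> nat \<Rightarrow> real" where "wt n \<omega> i = w n (\<lambda>j\<in>{..<n}. fst (V j \<omega>)) i"

text \<open>Self-normalised importance weights. Dividing by the sum of the densities instead of
  \<open>n\<close> gives total mass exactly \<open>1\<close> whenever that sum is nonzero; the price
  is that the cap \<open>W / n\<close> holds only eventually.\<close>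

definition ideal :: "nat \<Rightarrow> 'w \<Rightarrow> nat \<Rightarrow> real" where
  "ideal n \<omega> i = g (Z i \<omega>) / (\<Sum>j<n. g (Z j \<omega>))"

lemma kappa': "\<kappa> \<in> borel \<rightarrow>\<^sub>M subprob_algebra borel"
  using kappa by (rule measurable_prob_algebraD)

lemma measurable_mu: "h \<in> borel \<rightarrow>\<^sub>M N \<Longrightarrow> h \<in> \<mu> \<rightarrow>\<^sub>M N"
  by (simp add: measurable_cong_sets[OF mu(2) refl])

lemma sets_joint: "sets (kernel_prod \<mu> \<kappa>) = sets borel"
  by (rule sets_kernel_prod[OF mu(2) kappa'])

lemma measurable_joint: "h \<in> borel \<rightarrow>\<^sub>M N \<Longrightarrow> h \<in> kernel_prod \<mu> \<kappa> \<rightarrow>\<^sub>M N"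
  by (simp add: measurable_cong_sets[OF sets_joint refl])

sublocale \<mu>: prob_space \<mu> by (rule mu)

sublocale joint: prob_space "kernel_prod \<mu> \<kappa>"
  by (rule prob_space_kernel_prod[OF mu kappa])

lemma fst_borel: "fst \<in> borel \<rightarrow>\<^sub>M (borel :: 'c::second_countable_topology measure)"
  and snd_borel: "snd \<in> borel \<rightarrow>\<^sub>M (borel :: 'd::second_countable_topology measure)"
  by (auto intro!: borel_measurable_continuous_onI continuous_intros)

lemma distr_fst: "distr (kernel_prod \<mu> \<kappa>) borel fst = \<mu>"
  by (rule distr_fst_kernel_prod[OF mu(2) kappa])

lemma AE_joint_fst: "AE z in \<mu>. P z \<Longrightarrow> AE x in kernel_prod \<mu> \<kappa>. P (fst x)"
  using AE_distrD[OF measurable_joint[OF fst_borel]] distr_fst by metis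

lemma AE_law: "AE x in kernel_prod \<mu> \<kappa>. P x \<Longrightarrow> AE \<omega> in M. P (V i \<omega>)"
proof -
  assume "AE x in kernel_prod \<mu> \<kappa>. P x"
  then have "AE x in distr M borel (V i). P x" unfolding law .
  then show ?thesis using indep by (intro AE_distrD[of "V i" M borel]) (simp_all add: indep_vars_def)
qed

lemma AE_Z_in_S: "AE \<omega> in M. \<forall>i. Z i \<omega> \<in> S"
  unfolding AE_all_countable Z_def
  by (intro allI AE_law AE_joint_fst AE_msupport mu)

lemma S_rectangle: "z \<in> S \<Longrightarrow> z' \<in> S \<Longrightarrow> (fst z, snd z') \<in> S"
  using msupport_rectangle[OF mu ac, of "fst z" "snd z" "fst z'" "snd z'"] by simp

lemma S_nonempty: "S \<noteq> {}"
proof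
  assume "S = {}"
  then have "AE z in \<mu>. False" using AE_msupport[OF mu(2)] by simp
  then show False using \<mu>.AE_False by simp
qed

lemma slln:
  assumes u: "u \<in> borel_measurable borel" "\<And>z. z \<in> S \<Longrightarrow> \<bar>u z\<bar> \<le> C"
  shows "AE \<omega> in M. (\<lambda>n. (\<Sum>i<n. u (Z i \<omega>)) / real n) \<longlonglongrightarrow> (\<integral>z. u z \<partial>\<mu>)"
proof -
  have "AE \<omega> in M. (\<lambda>n. (\<Sum>i<n. u (fst (V i \<omega>))) / real n) \<longlonglongrightarrow> (\<integral>x. u (fst x) \<partial>kernel_prod \<mu> \<kappa>)"
  proof (rule bounded_slln[OF indep law])
    show "(\<lambda>x. u (fst x)) \<in> borel_measurable borel" by (rule measurable_compose[OF fst_borel u(1)])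
    show "AE x in kernel_prod \<mu> \<kappa>. \<bar>u (fst x)\<bar> \<le> C"
      using AE_msupport[OF mu(2)] by (intro AE_joint_fst) (auto elim!: eventually_mono intro: u(2))
  qed
  also have "(\<integral>x. u (fst x) \<partial>kernel_prod \<mu> \<kappa>) = (\<integral>z. u z \<partial>\<mu>)"
    using integral_distr[OF measurable_joint[OF fst_borel] u(1)] distr_fst by simp
  finally show ?thesis by (simp add: Z_def)
qed

lemma marginal_prob: "prob_space (marginal_prod \<mu>)"
proof -
  interpret A: prob_space "distr \<mu> borel fst" by (intro \<mu>.prob_space_distr measurable_mu fst_borel)
  interpret B: prob_space "distr \<mu> borel snd" by (intro \<mu>.prob_space_distr measurable_mu snd_borel)
  interpret pair_prob_space "distr \<mu> borel fst" "distr \<mu> borel snd" ..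
  show ?thesis unfolding marginal_prod_def by (rule prob_space_axioms)
qed

lemma integral_marginal:
  assumes "u \<in> borel_measurable borel"
  shows "(\<integral>z. u z \<partial>marginal_prod \<mu>) = (\<integral>z. g z * u z \<partial>\<mu>)"
  unfolding marginal_density using assms g by (subst integral_density) (auto intro: measurable_mu)

lemma integral_g: "(\<integral>z. g z \<partial>\<mu>) = 1"
  using integral_marginal[of "\<lambda>_. 1"] prob_space.prob_space[OF marginal_prob] by simp

lemma measure_marginal_Times:
  assumes "A \<in> sets borel" "B \<in> sets borel"
  shows "measure (marginal_prod \<mu>) (A \<times> B) = measure \<mu> (A \<times> UNIV) * measure \<mu> (UNIV \<times> B)"
proof -
  interpret B: prob_space "distr \<mu> borel snd" by (intro \<mu>.prob_space_distr measurable_mu snd_borel)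
  have sp: "space \<mu> = UNIV" using sets_eq_imp_space_eq[OF mu(2)] by simp
  have eq: "fst -` A \<inter> space \<mu> = A \<times> UNIV" "snd -` B \<inter> space \<mu> = UNIV \<times> B" by (auto simp: sp)
  have "measure (marginal_prod \<mu>) (A \<times> B) = measure (distr \<mu> borel fst) A * measure (distr \<mu> borel snd) B"
    unfolding marginal_prod_def measure_def
    using assms by (subst B.emeasure_pair_measure_Times) (auto simp: enn2real_mult)
  then show ?thesis
    using assms eq by (simp add: measure_distr measurable_mu[OF fst_borel] measurable_mu[OF snd_borel])
qed

text \<open>Rounding each coordinate separately makes the cells rectangles, on which the product of
  marginals factorises. The centres lie in \<open>S\<close> because \<open>S\<close> is a
  rectangle.\<close>

lemma roundings:
  "\<exists>(r1 :: nat \<Rightarrow> 't \<Rightarrow> 't) (r2 :: nat \<Rightarrow> 'x \<Rightarrow> 'x). \<forall>k. r1 k \<in> borel \<rightarrow>\<^sub>M borel \<and> r2 k \<in> borel \<rightarrow>\<^sub>M borel \<and>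
    finite (range (\<lambda>z. (r1 k (fst z), r2 k (snd z)))) \<and>
    range (\<lambda>z. (r1 k (fst z), r2 k (snd z))) \<subseteq> S \<and>
    (\<forall>z\<in>S. dist z (r1 k (fst z), r2 k (snd z)) < inverse (real (Suc k)))"
proof -
  have c: "compact (fst ` S)" "compact (snd ` S)"
    using compact_Z by (auto intro!: compact_continuous_image continuous_intros)
  have ne: "fst ` S \<noteq> {}" "snd ` S \<noteq> {}" using S_nonempty by auto
  \<comment> \<open>Half of the scale for each coordinate, as the two errors add up in the product
    metric.\<close>
  have h: "(0::real) < 1 / 2" by simp
  from finite_rounding_sequence[OF c(1) ne(1) h] obtain r1 :: "nat \<Rightarrow> 't \<Rightarrow> 't" where
    r1: "\<forall>k. r1 k \<in> borel \<rightarrow>\<^sub>M borel \<and> finite (range (r1 k)) \<and> range (r1 k) \<subseteq> fst ` S \<and>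
      (\<forall>x\<in>fst ` S. dist x (r1 k x) < 1 / 2 * inverse (real (Suc k)))" ..
  from finite_rounding_sequence[OF c(2) ne(2) h] obtain r2 :: "nat \<Rightarrow> 'x \<Rightarrow> 'x" where
    r2: "\<forall>k. r2 k \<in> borel \<rightarrow>\<^sub>M borel \<and> finite (range (r2 k)) \<and> range (r2 k) \<subseteq> snd ` S \<and>
      (\<forall>x\<in>snd ` S. dist x (r2 k x) < 1 / 2 * inverse (real (Suc k)))" ..
  show ?thesis
  proof (intro exI[of _ r1] exI[of _ r2] allI conjI ballI)
    fix k
    show "r1 k \<in> borel \<rightarrow>\<^sub>M borel" "r2 k \<in> borel \<rightarrow>\<^sub>M borel" using r1 r2 by blast+
    have fin: "finite (range (r1 k))" "finite (range (r2 k))" using r1 r2 by blast+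
    have rng: "range (r1 k) \<subseteq> fst ` S" "range (r2 k) \<subseteq> snd ` S" using r1 r2 by blast+
    have sub: "range (\<lambda>z. (r1 k (fst z), r2 k (snd z))) \<subseteq> range (r1 k) \<times> range (r2 k)" by auto
    then show "finite (range (\<lambda>z. (r1 k (fst z), r2 k (snd z))))"
      by (rule finite_subset) (use fin in simp)
    have "range (r1 k) \<times> range (r2 k) \<subseteq> S"
    proof
      fix p assume "p \<in> range (r1 k) \<times> range (r2 k)"
      then have "fst p \<in> fst ` S" "snd p \<in> snd ` S"
        using rng by auto
      then obtain z z' where "z \<in> S" "z' \<in> S" "p = (fst z, snd z')"
        by (cases p) auto
      then show "p \<in> S" using S_rectangle[of z z'] by simp
    qed
    with sub show "range (\<lambda>z. (r1 k (fst z), r2 k (snd z))) \<subseteq> S" by (rule subset_trans)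
    fix z assume z: "z \<in> S"
    have "dist z (r1 k (fst z), r2 k (snd z)) \<le> dist (fst z) (r1 k (fst z)) + dist (snd z) (r2 k (snd z))"
      using dist_Pair_le[of "fst z" "snd z"] by simp
    also have "\<dots> < 1 / 2 * inverse (real (Suc k)) + 1 / 2 * inverse (real (Suc k))"
      using z r1 r2 by (intro add_strict_mono) blast+
    finally show "dist z (r1 k (fst z), r2 k (snd z)) < inverse (real (Suc k))" by simp
  qed
qed

section \<open>The density weights: limits, feasibility and balance\<close>

lemma ideal_sum:
  assumes "0 < n"
  shows "(\<Sum>i<n. ideal n \<omega> i * u (Z i \<omega>)) = ((\<Sum>i<n. g (Z i \<omega>) * u (Z i \<omega>)) / real n) / ((\<Sum>i<n. g (Z i \<omega>)) / real n)"
proof -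
  have "(\<Sum>i<n. ideal n \<omega> i * u (Z i \<omega>)) = (\<Sum>i<n. g (Z i \<omega>) * u (Z i \<omega>)) / (\<Sum>i<n. g (Z i \<omega>))"
    by (simp add: ideal_def sum_divide_distrib)
  then show ?thesis using assms by simp
qed

lemma ideal_mean:
  assumes u: "u \<in> borel_measurable borel" "\<And>z. z \<in> S \<Longrightarrow> \<bar>u z\<bar> \<le> C"
  shows "AE \<omega> in M. (\<lambda>n. \<Sum>i<n. ideal n \<omega> i * u (Z i \<omega>)) \<longlonglongrightarrow> (\<integral>z. g z * u z \<partial>\<mu>)"
proof -
  have C: "0 \<le> C" using S_nonempty u(2) by (meson abs_ge_zero all_not_in_conv order_trans)
  have 1: "AE \<omega> in M. (\<lambda>n. (\<Sum>i<n. g (Z i \<omega>) * u (Z i \<omega>)) / real n) \<longlonglongrightarrow> (\<integral>z. g z * u z \<partial>\<mu>)"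
  proof (rule slln)
    show "(\<lambda>z. g z * u z) \<in> borel_measurable borel" using g u by measurable
    show "\<bar>g z * u z\<bar> \<le> W\<^sub>0 * C" if "z \<in> S" for z
      using g(2,3)[of z] u(2)[OF that] W by (auto simp: abs_mult intro!: mult_mono)
  qed
  have 2: "AE \<omega> in M. (\<lambda>n. (\<Sum>i<n. g (Z i \<omega>)) / real n) \<longlonglongrightarrow> (\<integral>z. g z \<partial>\<mu>)"
    using g by (intro slln[where C=W\<^sub>0]) auto
  from 1 2 show ?thesis
  proof eventually_elim
    case (elim \<omega>)
    have "(\<lambda>n. ((\<Sum>i<n. g (Z i \<omega>) * u (Z i \<omega>)) / real n) / ((\<Sum>i<n. g (Z i \<omega>)) / real n)) \<longlonglongrightarrow> (\<integral>z. g z * u z \<partial>\<mu>) / (\<integral>z. g z \<partial>\<mu>)"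
      using elim by (intro tendsto_divide) (auto simp: integral_g)
    moreover have "\<forall>\<^sub>F n in sequentially. ((\<Sum>i<n. g (Z i \<omega>) * u (Z i \<omega>)) / real n) / ((\<Sum>i<n. g (Z i \<omega>)) / real n) = (\<Sum>i<n. ideal n \<omega> i * u (Z i \<omega>))"
      using eventually_gt_at_top[of 0] by eventually_elim (rule ideal_sum[symmetric])
    ultimately show ?case by (simp add: integral_g tendsto_cong)
  qed
qed

text \<open>The averages of \<open>g\<close> tend to \<open>1\<close>, which exceeds
  \<open>W\<^sub>0 / W\<close>. Once they pass this threshold, a weight is at most
  \<open>W\<^sub>0\<close> divided by \<open>n * W\<^sub>0 / W\<close>, that is
  \<open>W / n\<close>.\<close>

lemma ideal_feasible:
  "AE \<omega> in M. \<forall>\<^sub>F n in sequentially. ideal n \<omega> \<in> weight_simplex n \<and> (\<forall>i<n. ideal n \<omega> i \<le> W / real n)"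
proof -
  have "AE \<omega> in M. (\<lambda>n. (\<Sum>i<n. g (Z i \<omega>)) / real n) \<longlonglongrightarrow> (\<integral>z. g z \<partial>\<mu>)"
    using g by (intro slln[where C=W\<^sub>0]) auto
  then show ?thesis
  proof eventually_elim
    case (elim \<omega>)
    have "\<forall>\<^sub>F n in sequentially. W\<^sub>0 / W < (\<Sum>i<n. g (Z i \<omega>)) / real n"
      using elim W by (intro order_tendstoD(1)[OF elim]) (simp add: integral_g)
    with eventually_gt_at_top[of 0] show ?case
    proof eventually_elim
      case (elim n)
      define G where "G = (\<Sum>i<n. g (Z i \<omega>))"
      have GW: "W\<^sub>0 * real n < W * G" using elim W by (simp add: G_def field_simps)
      moreover have "0 < W\<^sub>0 * real n" using elim W by simp
      ultimately have "0 < W * G" by linarith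
      then have G: "0 < G" using W by (simp add: zero_less_mult_iff)
      have "ideal n \<omega> i \<le> W / real n" for i
      proof -
        have "g (Z i \<omega>) * real n \<le> W\<^sub>0 * real n" using g(3) by (intro mult_right_mono) auto
        then have "g (Z i \<omega>) * real n \<le> W * G" using GW by linarith
        then show ?thesis using G elim by (simp add: ideal_def G_def[symmetric] field_simps)
      qed
      moreover have "ideal n \<omega> \<in> weight_simplex n"
        using G g(2) by (simp add: weight_simplex_def ideal_def G_def[symmetric] flip: sum_divide_distrib)
      ultimately show ?case by blast
    qed
  qed
qed

lemma product_mean_cell:
  "product_mean n (\<lambda>i. Z i \<omega>) (\<lambda>z. of_bool ((r1 (fst z), r2 (snd z)) = (a, b)))
    = ((\<Sum>i<n. of_bool (r1 (fst (Z i \<omega>)) = a)) / real n) * ((\<Sum>j<n. of_bool (r2 (snd (Z j \<omega>)) = b)) / real n)"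
proof -
  have "(\<Sum>i<n. \<Sum>j<n. of_bool ((r1 (fst (Z i \<omega>)), r2 (snd (Z j \<omega>))) = (a, b)) :: real)
      = (\<Sum>i<n. of_bool (r1 (fst (Z i \<omega>)) = a)) * (\<Sum>j<n. of_bool (r2 (snd (Z j \<omega>)) = b))"
    unfolding sum_product by (intro sum.cong refl) auto
  moreover have "x * y / (real n)\<^sup>2 = (x / real n) * (y / real n)" for x y
    by (simp add: power2_eq_square)
  ultimately show ?thesis by (simp only: product_mean_def fst_conv snd_conv)
qed

text \<open>The mixed pairs are dependent, so the strong law does not apply to
  \<open>product_mean\<close> directly. On a rectangular cell it is a product of two averages, and
  the limit of that product is the mass that the density weights also produce. Rounding then makes
  the balance uniform over \<open>F\<close>.\<close>

lemma ideal_balance: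
  "AE \<omega> in M. \<forall>\<epsilon>>0. \<forall>\<^sub>F n in sequentially. \<forall>f\<in>F. \<bar>(\<Sum>i<n. ideal n \<omega> i * f (Z i \<omega>)) - product_mean n (\<lambda>i. Z i \<omega>) f\<bar> \<le> \<epsilon>"
proof -
  from roundings obtain r1 :: "nat \<Rightarrow> 't \<Rightarrow> 't" and r2 :: "nat \<Rightarrow> 'x \<Rightarrow> 'x" where
    rr: "\<forall>k. r1 k \<in> borel \<rightarrow>\<^sub>M borel \<and> r2 k \<in> borel \<rightarrow>\<^sub>M borel \<and>
      finite (range (\<lambda>z. (r1 k (fst z), r2 k (snd z)))) \<and>
      range (\<lambda>z. (r1 k (fst z), r2 k (snd z))) \<subseteq> S \<and>
      (\<forall>z\<in>S. dist z (r1 k (fst z), r2 k (snd z)) < inverse (real (Suc k)))"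
    by (elim exE)
  have r1: "r1 k \<in> borel \<rightarrow>\<^sub>M borel" and r2: "r2 k \<in> borel \<rightarrow>\<^sub>M borel" and
    fin: "finite (range (\<lambda>z. (r1 k (fst z), r2 k (snd z))))" and
    sub: "range (\<lambda>z. (r1 k (fst z), r2 k (snd z))) \<subseteq> S" and
    near: "z \<in> S \<Longrightarrow> dist z (r1 k (fst z), r2 k (snd z)) < inverse (real (Suc k))" for k z
    using rr by blast+
  define r where "r k z = (r1 k (fst z), r2 k (snd z))" for k z
  note fin = fin[folded r_def] and sub = sub[folded r_def] and near = near[folded r_def]
  have m1: "(\<lambda>z. r1 k (fst z)) \<in> borel \<rightarrow>\<^sub>M borel" and m2: "(\<lambda>z. r2 k (snd z)) \<in> borel \<rightarrow>\<^sub>M borel" for k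
    by (rule measurable_compose[OF fst_borel r1] measurable_compose[OF snd_borel r2])+
  have r: "r k \<in> borel \<rightarrow>\<^sub>M borel" for k
    unfolding r_def borel_prod[symmetric]
    using m1 m2 by (intro measurable_Pair) (auto simp: borel_prod)
  have cell: "AE \<omega> in M. (\<lambda>n. (\<Sum>i<n. ideal n \<omega> i * of_bool (r k (Z i \<omega>) = c)) - product_mean n (\<lambda>i. Z i \<omega>) (\<lambda>z. of_bool (r k z = c))) \<longlonglongrightarrow> 0" for k c
  proof -
    obtain a b where c: "c = (a, b)" by fastforce
    define A where "A = r1 k -` {a}"
    define B where "B = r2 k -` {b}"
    have A: "A \<in> sets borel" using measurable_sets[OF r1, of "{a}" k] by (simp add: A_def)
    have B: "B \<in> sets borel" using measurable_sets[OF r2, of "{b}" k] by (simp add: B_def)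
    have "(\<integral>z. g z * of_bool (r k z = c) \<partial>\<mu>) = (\<integral>z. of_bool (r k z = c) \<partial>marginal_prod \<mu>)"
      by (rule integral_marginal[symmetric, OF of_bool_eq_measurable[OF r]])
    also have "\<dots> = (\<integral>z. indicator (A \<times> B) z \<partial>marginal_prod \<mu>)"
      by (intro Bochner_Integration.integral_cong) (auto simp: r_def c A_def B_def indicator_def)
    also have "(\<integral>z. indicator (A \<times> B) z \<partial>marginal_prod \<mu>) = measure (marginal_prod \<mu>) (A \<times> B)"
    proof -
      have "space (marginal_prod \<mu>) = UNIV" by (simp add: marginal_prod_def space_pair_measure)
      then show ?thesis by simp
    qed
    also have "\<dots> = measure \<mu> (A \<times> UNIV) * measure \<mu> (UNIV \<times> B)"
      by (rule measure_marginal_Times[OF A B])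
    also have "measure \<mu> (A \<times> UNIV) = (\<integral>z. of_bool (r1 k (fst z) = a) \<partial>\<mu>)"
    proof -
      have "(\<lambda>z :: 't \<times> 'x. of_bool (r1 k (fst z) = a) :: real) = indicator (A \<times> UNIV)"
        by (auto simp: A_def indicator_def fun_eq_iff)
      moreover have "space \<mu> = UNIV" using sets_eq_imp_space_eq[OF mu(2)] by simp
      ultimately show ?thesis by simp
    qed
    also have "measure \<mu> (UNIV \<times> B) = (\<integral>z. of_bool (r2 k (snd z) = b) \<partial>\<mu>)"
    proof -
      have "(\<lambda>z :: 't \<times> 'x. of_bool (r2 k (snd z) = b) :: real) = indicator (UNIV \<times> B)"
        by (auto simp: B_def indicator_def fun_eq_iff)
      moreover have "space \<mu> = UNIV" using sets_eq_imp_space_eq[OF mu(2)] by simp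
      ultimately show ?thesis by simp
    qed
    \<comment> \<open>The density \<open>g\<close> represents the product of the marginals, so the
      limit for the density weights splits like the limit for the empirical product.\<close>
    finally have I: "(\<integral>z. g z * of_bool (r k z = c) \<partial>\<mu>)
        = (\<integral>z. of_bool (r1 k (fst z) = a) \<partial>\<mu>) * (\<integral>z. of_bool (r2 k (snd z) = b) \<partial>\<mu>)" .
    have 1: "AE \<omega> in M. (\<lambda>n. \<Sum>i<n. ideal n \<omega> i * of_bool (r k (Z i \<omega>) = c)) \<longlonglongrightarrow> (\<integral>z. g z * of_bool (r k z = c) \<partial>\<mu>)"
      by (rule ideal_mean[where C=1, OF of_bool_eq_measurable[OF r]]) simp
    have 2: "AE \<omega> in M. (\<lambda>n. (\<Sum>i<n. of_bool (r1 k (fst (Z i \<omega>)) = a)) / real n) \<longlonglongrightarrow> (\<integral>z. of_bool (r1 k (fst z) = a) \<partial>\<mu>)"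
      by (rule slln[where C=1, OF of_bool_eq_measurable[OF m1]]) simp
    have 3: "AE \<omega> in M. (\<lambda>n. (\<Sum>i<n. of_bool (r2 k (snd (Z i \<omega>)) = b)) / real n) \<longlonglongrightarrow> (\<integral>z. of_bool (r2 k (snd z) = b) \<partial>\<mu>)"
      by (rule slln[where C=1, OF of_bool_eq_measurable[OF m2]]) simp
    from 1 2 3 show ?thesis
    proof eventually_elim
      case (elim \<omega>)
      have "(\<lambda>n. product_mean n (\<lambda>i. Z i \<omega>) (\<lambda>z. of_bool (r k z = c))) \<longlonglongrightarrow> (\<integral>z. g z * of_bool (r k z = c) \<partial>\<mu>)"
        unfolding I unfolding r_def c product_mean_cell by (intro tendsto_mult elim(2,3))
      from tendsto_diff[OF elim(1) this] show ?case by simp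
    qed
  qed
  have "AE \<omega> in M. \<forall>k. \<forall>c\<in>range (r k). (\<lambda>n. (\<Sum>i<n. ideal n \<omega> i * of_bool (r k (Z i \<omega>) = c)) - product_mean n (\<lambda>i. Z i \<omega>) (\<lambda>z. of_bool (r k z = c))) \<longlonglongrightarrow> 0"
    unfolding AE_all_countable using fin cell
    by (intro allI) (subst AE_ball_countable, auto intro: countable_finite)
  with AE_Z_in_S ideal_feasible show ?thesis
  proof eventually_elim
    case (elim \<omega>)
    \<comment> \<open>As a sum over index pairs with weights \<open>1 / n\<^sup>2\<close>, the
      empirical product is itself a weighted sample, which is the form the rounding lemma
      compares.\<close>
    have pm: "product_mean n (\<lambda>i. Z i \<omega>) f = (\<Sum>p\<in>{..<n} \<times> {..<n}. 1 / (real n)\<^sup>2 * f (fst (Z (fst p) \<omega>), snd (Z (snd p) \<omega>)))" for n f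
      by (simp add: product_mean_def sum.cartesian_product case_prod_beta' sum_divide_distrib)
    show ?case
    proof (intro allI impI)
      fix \<epsilon> :: real assume \<epsilon>: "0 < \<epsilon>"
      show "\<forall>\<^sub>F n in sequentially. \<forall>f\<in>F. \<bar>(\<Sum>i<n. ideal n \<omega> i * f (Z i \<omega>)) - product_mean n (\<lambda>i. Z i \<omega>) f\<bar> \<le> \<epsilon>"
        unfolding pm
      proof (rule uniform_convergence_by_rounding[OF test S_nonempty, where r=r])
        show "\<forall>\<^sub>F n in sequentially. (\<forall>i\<in>{..<n}. 0 \<le> ideal n \<omega> i) \<and> sum (ideal n \<omega>) {..<n} = 1"
          using elim(2) by eventually_elim (auto simp: weight_simplex_def)
        show "\<forall>\<^sub>F n in sequentially. (\<forall>j\<in>{..<n} \<times> {..<n}. 0 \<le> 1 / (real n)\<^sup>2) \<and> (\<Sum>j\<in>{..<n} \<times> {..<n}. 1 / (real n)\<^sup>2) = 1"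
          using eventually_gt_at_top[of 0] by eventually_elim (simp add: power2_eq_square)
        show "(\<lambda>n. (\<Sum>i<n. ideal n \<omega> i * of_bool (r k (Z i \<omega>) = c)) -
          (\<Sum>p\<in>{..<n} \<times> {..<n}. 1 / (real n)\<^sup>2 * of_bool (r k (fst (Z (fst p) \<omega>), snd (Z (snd p) \<omega>)) = c))) \<longlonglongrightarrow> 0"
          if "c \<in> range (r k)" for k c
          using elim(3) that unfolding pm by blast
      qed (use elim(1) S_rectangle fin sub near \<epsilon> in auto)
    qed
  qed
qed

section \<open>Covariate averages under the CBDM weights\<close>

lemma wt_bounds: "0 \<le> wt n \<omega> i" "wt n \<omega> i \<le> W / real n"
  using w_bounds by (auto simp: wt_def)

text \<open>Near-optimality, with the density weights as competitor, forces the imbalance of the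
  CBDM weights to vanish; only the limit under the density weights has to be known. The exceptional
  null set may depend on \<open>f\<close>, which is harmless since only countably many
  \<open>f\<close> are used later.\<close>

lemma test_function_limit:
  assumes f: "f \<in> F"
  shows "AE \<omega> in M. (\<lambda>n. \<Sum>i<n. wt n \<omega> i * f (Z i \<omega>)) \<longlonglongrightarrow> (\<integral>z. g z * f z \<partial>\<mu>)"
proof -
  obtain c0 where c0: "c0 \<in> S" using S_nonempty by auto
  from uniform_test_classD(2)[OF test] obtain C where C: "\<forall>f\<in>F. \<forall>x\<in>S. \<forall>y\<in>S. \<bar>f x - f y\<bar> \<le> C" ..
  have fm: "f \<in> borel_measurable borel" using uniform_test_classD(1)[OF test] f by (rule subsetD)
  have fb: "\<bar>f z\<bar> \<le> C + \<bar>f c0\<bar>" if "z \<in> S" for z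
  proof -
    have "\<bar>f z - f c0\<bar> \<le> C" using C f that c0 by blast
    then show ?thesis by linarith
  qed
  have "AE \<omega> in M. (\<lambda>n. \<Sum>i<n. ideal n \<omega> i * f (Z i \<omega>)) \<longlonglongrightarrow> (\<integral>z. g z * f z \<partial>\<mu>)"
    by (rule ideal_mean[OF fm fb])
  from this ideal_balance ideal_feasible near_optimal show ?thesis
  proof eventually_elim
    fix \<omega>
    assume e1: "(\<lambda>n. \<Sum>i<n. ideal n \<omega> i * f (Z i \<omega>)) \<longlonglongrightarrow> (\<integral>z. g z * f z \<partial>\<mu>)"
      and e2: "\<forall>\<epsilon>>0. \<forall>\<^sub>F n in sequentially. \<forall>f\<in>F. \<bar>(\<Sum>i<n. ideal n \<omega> i * f (Z i \<omega>)) - product_mean n (\<lambda>i. Z i \<omega>) f\<bar> \<le> \<epsilon>"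
      and e3: "\<forall>\<^sub>F n in sequentially. ideal n \<omega> \<in> weight_simplex n \<and> (\<forall>i<n. ideal n \<omega> i \<le> W / real n)"
      and e4: "\<forall>n>0. near_optimal_weights F W R n (\<lambda>i. fst (V i \<omega>)) (w n (\<lambda>j\<in>{..<n}. fst (V j \<omega>)))"
    define D where "D n = (\<Sum>i<n. wt n \<omega> i * f (Z i \<omega>)) - product_mean n (\<lambda>i. Z i \<omega>) f" for n
    define E where "E n = (\<Sum>i<n. ideal n \<omega> i * f (Z i \<omega>)) - product_mean n (\<lambda>i. Z i \<omega>) f" for n
    have D: "D \<longlonglongrightarrow> 0"
    proof (rule tendstoI)
      fix e :: real assume e: "0 < e"
      \<comment> \<open>Both \<open>\<epsilon>\<^sup>2\<close> and the slack \<open>R / n\<close>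
        are to be absorbed: twice \<open>\<epsilon>\<^sup>2\<close> is
        \<open>e\<^sup>2 / 2\<close>.\<close>
      define \<epsilon> where "\<epsilon> = e / 2"
      have \<epsilon>: "0 < \<epsilon>" using e by (simp add: \<epsilon>_def)
      have "(\<lambda>n. R / real n) \<longlonglongrightarrow> 0" by (rule lim_const_over_n)
      moreover have "0 < \<epsilon>\<^sup>2" using \<epsilon> by simp
      ultimately have Rn: "\<forall>\<^sub>F n in sequentially. R / real n < \<epsilon>\<^sup>2" by (rule order_tendstoD(2))
      show "\<forall>\<^sub>F n in sequentially. dist (D n) 0 < e"
        using e2[THEN spec, THEN mp, OF \<epsilon>] e3 eventually_gt_at_top[of 0] Rn
      proof eventually_elim
        case el: (elim n)
        have opt: "near_optimal_weights F W R n (\<lambda>i. Z i \<omega>) (wt n \<omega>)"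
          using e4 el(3) unfolding Z_def wt_def by blast
        have "(D n)\<^sup>2 \<le> \<epsilon>\<^sup>2 + R / real n"
          unfolding D_def using el(1,2) f by (intro near_optimal_weightsD[OF opt]) blast+
        also have "\<dots> < \<epsilon>\<^sup>2 + \<epsilon>\<^sup>2" using el(4) by simp
        also have "\<dots> \<le> e\<^sup>2" by (simp add: \<epsilon>_def power2_eq_square)
        finally have "\<bar>D n\<bar>\<^sup>2 < e\<^sup>2" by simp
        then have "\<bar>D n\<bar> < e" by (rule power2_less_imp_less) (use e in simp)
        then show ?case by simp
      qed
    qed
    have E: "E \<longlonglongrightarrow> 0"
    proof (rule tendstoI)
      fix e :: real assume e: "0 < e"
      from e2[THEN spec, THEN mp, OF half_gt_zero[OF e]]
      show "\<forall>\<^sub>F n in sequentially. dist (E n) 0 < e"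
      proof eventually_elim
        case (elim n)
        then have "\<bar>E n\<bar> \<le> e / 2" using f unfolding E_def by (rule bspec)
        then show ?case using e by simp
      qed
    qed
    have "(\<lambda>n. D n - E n + (\<Sum>i<n. ideal n \<omega> i * f (Z i \<omega>))) \<longlonglongrightarrow> 0 - 0 + (\<integral>z. g z * f z \<partial>\<mu>)"
      by (intro tendsto_add tendsto_diff D E e1)
    then show "(\<lambda>n. \<Sum>i<n. wt n \<omega> i * f (Z i \<omega>)) \<longlonglongrightarrow> (\<integral>z. g z * f z \<partial>\<mu>)"
      by (simp add: D_def E_def)
  qed
qed

text \<open>Half of \<open>\<epsilon>\<close> goes to a Lipschitz approximation in
  \<open>L\<^sup>1\<close>, half to a uniform approximation on \<open>S\<close>, which has full
  measure, by a multiple of a test function.\<close>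

lemma test_function_dense:
  assumes m: "integrable \<mu> m" and \<epsilon>: "0 < \<epsilon>"
  shows "\<exists>f\<in>F. \<exists>c. (\<integral>z. \<bar>m z - c * f z\<bar> \<partial>\<mu>) < \<epsilon> \<and> integrable \<mu> f"
proof -
  have e2: "0 < \<epsilon> / 2" using \<epsilon> by simp
  from lipschitz_dense_L1[OF \<mu>.finite_measure_axioms mu(2) m e2] obtain h L C where
    h: "L-lipschitz_on UNIV h" "\<forall>x. \<bar>h x\<bar> \<le> C" "(\<integral>x. \<bar>m x - h x\<bar> \<partial>\<mu>) < \<epsilon> / 2" by blast
  from uniform_test_classD(4)[OF test h(1) e2] obtain f c where
    f: "f \<in> F" and fc: "\<forall>x\<in>S. \<bar>h x - c * f x\<bar> < \<epsilon> / 2" by blast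
  have fm: "f \<in> borel_measurable \<mu>"
    by (rule measurable_mu) (use uniform_test_classD(1)[OF test] f in blast)
  have hm: "h \<in> borel_measurable \<mu>"
    by (rule measurable_mu, rule borel_measurable_continuous_onI, rule lipschitz_on_continuous_on[OF h(1)])
  have S: "AE z in \<mu>. z \<in> S" by (rule AE_msupport[OF mu(2)])
  obtain c0 where c0: "c0 \<in> S" using S_nonempty by auto
  from uniform_test_classD(2)[OF test] obtain D where D: "\<forall>f\<in>F. \<forall>x\<in>S. \<forall>y\<in>S. \<bar>f x - f y\<bar> \<le> D" ..
  have fi: "integrable \<mu> f"
  proof (rule \<mu>.integrable_const_bound[of _ "D + \<bar>f c0\<bar>"])
    show "AE z in \<mu>. norm (f z) \<le> D + \<bar>f c0\<bar>"
      using S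
    proof eventually_elim
      case (elim z)
      then have "\<bar>f z - f c0\<bar> \<le> D" using D f c0 by blast
      then show ?case by simp
    qed
  qed (rule fm)
  have hi: "integrable \<mu> h"
    using h(2) hm by (intro \<mu>.integrable_const_bound[of _ C]) auto
  have i: "integrable \<mu> (\<lambda>z. \<bar>m z - h z\<bar>)" "integrable \<mu> (\<lambda>z. \<bar>h z - c * f z\<bar>)"
    using m hi fi by auto
  have "(\<integral>z. \<bar>m z - c * f z\<bar> \<partial>\<mu>) \<le> (\<integral>z. \<bar>m z - h z\<bar> + \<bar>h z - c * f z\<bar> \<partial>\<mu>)"
    using i by (intro integral_mono') auto
  also have "\<dots> = (\<integral>z. \<bar>m z - h z\<bar> \<partial>\<mu>) + (\<integral>z. \<bar>h z - c * f z\<bar> \<partial>\<mu>)" using i by simp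
  also have "(\<integral>z. \<bar>h z - c * f z\<bar> \<partial>\<mu>) \<le> (\<integral>z. \<epsilon> / 2 \<partial>\<mu>)"
    using i(2) S fc by (intro integral_mono_AE) (auto intro: less_imp_le)
  also have "(\<integral>z. \<epsilon> / 2 \<partial>\<mu>) = \<epsilon> / 2" by (simp add: \<mu>.prob_space)
  finally have "(\<integral>z. \<bar>m z - c * f z\<bar> \<partial>\<mu>) < \<epsilon>" using h(3) by linarith
  with f fi show ?thesis by blast
qed

text \<open>The cap on the weights bounds the weighted error by \<open>W\<close> times the plain
  average of \<open>d = \<bar>m - c * f\<bar>\<close>, to which the strong law applies although the
  weights are data-dependent. Continuity of \<open>m\<close> is nowhere used, so conditional means
  are admissible.\<close>

lemma bounded_function_limit:
  assumes m: "m \<in> borel_measurable borel" "\<And>z. \<bar>m z\<bar> \<le> C"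
  shows "AE \<omega> in M. (\<lambda>n. \<Sum>i<n. wt n \<omega> i * m (Z i \<omega>)) \<longlonglongrightarrow> (\<integral>z. g z * m z \<partial>\<mu>)"
proof -
  \<comment> \<open>One summand per error: \<open>W\<close> for replacing \<open>m\<close> by
    \<open>c * f\<close> in the sample, \<open>1\<close> for the convergence at
    \<open>c * f\<close>, \<open>W\<^sub>0\<close> for the same replacement in the limit
    integral.\<close>
  define A where "A = W + 1 + W\<^sub>0"
  have A: "0 < A" using W by (simp add: A_def)
  have mi: "integrable \<mu> m"
    using m(2) measurable_mu[OF m(1)] by (intro \<mu>.integrable_const_bound[of _ C]) auto
  have gi: "integrable \<mu> (\<lambda>z. g z * u z)" if "integrable \<mu> u" for u
  proof (rule Bochner_Integration.integrable_bound[OF integrable_mult_right[OF that, of W\<^sub>0]])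
    show "(\<lambda>z. g z * u z) \<in> borel_measurable \<mu>"
      using measurable_mu[OF g(1)] that by measurable
    show "AE z in \<mu>. norm (g z * u z) \<le> norm (W\<^sub>0 * u z)"
      using g W by (intro AE_I2) (auto simp: abs_mult intro!: mult_right_mono)
  qed
  have "AE \<omega> in M. \<forall>\<^sub>F n in sequentially. \<bar>(\<Sum>i<n. wt n \<omega> i * m (Z i \<omega>)) - (\<integral>z. g z * m z \<partial>\<mu>)\<bar> < A * \<epsilon>"
    if \<epsilon>: "0 < \<epsilon>" for \<epsilon>
  proof -
    from test_function_dense[OF mi \<epsilon>] obtain f c where
      f: "f \<in> F" and fc: "(\<integral>z. \<bar>m z - c * f z\<bar> \<partial>\<mu>) < \<epsilon>" and fi: "integrable \<mu> f" by blast
    define d where "d z = \<bar>m z - c * f z\<bar>" for z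
    have fm: "f \<in> borel_measurable borel" using uniform_test_classD(1)[OF test] f by blast
    obtain c0 where c0: "c0 \<in> S" using S_nonempty by auto
    from uniform_test_classD(2)[OF test] obtain D where D: "\<forall>f\<in>F. \<forall>x\<in>S. \<forall>y\<in>S. \<bar>f x - f y\<bar> \<le> D" ..
    have di: "integrable \<mu> d" unfolding d_def using mi fi by auto
    have "AE \<omega> in M. (\<lambda>n. (\<Sum>i<n. d (Z i \<omega>)) / real n) \<longlonglongrightarrow> (\<integral>z. d z \<partial>\<mu>)"
    proof (rule slln)
      show "d \<in> borel_measurable borel" unfolding d_def using m(1) fm by measurable
      show "\<bar>d z\<bar> \<le> C + \<bar>c\<bar> * (D + \<bar>f c0\<bar>)" if z: "z \<in> S" for z
      proof -
        have "\<bar>f z - f c0\<bar> \<le> D" using D f c0 z by blast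
        then have "\<bar>f z\<bar> \<le> D + \<bar>f c0\<bar>" by linarith
        then have "\<bar>c * f z\<bar> \<le> \<bar>c\<bar> * (D + \<bar>f c0\<bar>)"
          unfolding abs_mult by (rule mult_left_mono) simp
        then show ?thesis using m(2)[of z] by (simp add: d_def)
      qed
    qed
    from this test_function_limit[OF f] show ?thesis
    proof eventually_elim
      fix \<omega>
      assume e1: "(\<lambda>n. (\<Sum>i<n. d (Z i \<omega>)) / real n) \<longlonglongrightarrow> (\<integral>z. d z \<partial>\<mu>)"
        and e2: "(\<lambda>n. \<Sum>i<n. wt n \<omega> i * f (Z i \<omega>)) \<longlonglongrightarrow> (\<integral>z. g z * f z \<partial>\<mu>)"
      have "(\<integral>z. d z \<partial>\<mu>) < \<epsilon>" using fc by (simp add: d_def)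
      from order_tendstoD(2)[OF e1 this]
      have 1: "\<forall>\<^sub>F n in sequentially. (\<Sum>i<n. d (Z i \<omega>)) / real n < \<epsilon>" .
      have "(\<lambda>n. c * (\<Sum>i<n. wt n \<omega> i * f (Z i \<omega>))) \<longlonglongrightarrow> c * (\<integral>z. g z * f z \<partial>\<mu>)"
        by (intro tendsto_mult_left e2)
      from tendstoD[OF this \<epsilon>]
      have 2: "\<forall>\<^sub>F n in sequentially. \<bar>c * (\<Sum>i<n. wt n \<omega> i * f (Z i \<omega>)) - c * (\<integral>z. g z * f z \<partial>\<mu>)\<bar> < \<epsilon>"
        by (simp add: dist_real_def)
      have 3: "\<bar>c * (\<integral>z. g z * f z \<partial>\<mu>) - (\<integral>z. g z * m z \<partial>\<mu>)\<bar> \<le> W\<^sub>0 * \<epsilon>"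
      proof -
        have "c * (\<integral>z. g z * f z \<partial>\<mu>) - (\<integral>z. g z * m z \<partial>\<mu>) = (\<integral>z. c * (g z * f z) - g z * m z \<partial>\<mu>)"
          using gi[OF fi] gi[OF mi] by simp
        also have "\<bar>\<dots>\<bar> \<le> (\<integral>z. \<bar>c * (g z * f z) - g z * m z\<bar> \<partial>\<mu>)" by (rule integral_abs_bound)
        also have "\<dots> \<le> (\<integral>z. W\<^sub>0 * d z \<partial>\<mu>)"
        proof (rule integral_mono)
          show "integrable \<mu> (\<lambda>z. \<bar>c * (g z * f z) - g z * m z\<bar>)" using gi[OF fi] gi[OF mi] by simp
          show "integrable \<mu> (\<lambda>z. W\<^sub>0 * d z)" using di by simp
          fix z
          have "c * (g z * f z) - g z * m z = - (g z * (m z - c * f z))" by (simp add: algebra_simps)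
          then have "\<bar>c * (g z * f z) - g z * m z\<bar> = g z * d z"
            using g(2)[of z] by (simp add: abs_mult d_def)
          also have "\<dots> \<le> W\<^sub>0 * d z" using g(3)[of z] by (intro mult_right_mono) (auto simp: d_def)
          finally show "\<bar>c * (g z * f z) - g z * m z\<bar> \<le> W\<^sub>0 * d z" .
        qed
        also have "\<dots> = W\<^sub>0 * (\<integral>z. d z \<partial>\<mu>)" by simp
        also have "\<dots> \<le> W\<^sub>0 * \<epsilon>" using fc W by (intro mult_left_mono) (auto simp: d_def)
        finally show ?thesis .
      qed
      from 1 2 show "\<forall>\<^sub>F n in sequentially. \<bar>(\<Sum>i<n. wt n \<omega> i * m (Z i \<omega>)) - (\<integral>z. g z * m z \<partial>\<mu>)\<bar> < A * \<epsilon>"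
      proof eventually_elim
        case (elim n)
        have "(\<Sum>i<n. wt n \<omega> i * m (Z i \<omega>)) - c * (\<Sum>i<n. wt n \<omega> i * f (Z i \<omega>)) = (\<Sum>i<n. wt n \<omega> i * (m (Z i \<omega>) - c * f (Z i \<omega>)))"
          by (simp add: sum_distrib_left right_diff_distrib sum_subtractf mult.left_commute)
        also have "\<bar>\<dots>\<bar> \<le> (\<Sum>i<n. W / real n * d (Z i \<omega>))"
        proof (intro order_trans[OF sum_abs] sum_mono)
          fix i
          have "\<bar>wt n \<omega> i * (m (Z i \<omega>) - c * f (Z i \<omega>))\<bar> = wt n \<omega> i * d (Z i \<omega>)"
            using wt_bounds(1) by (simp add: abs_mult d_def)
          also have "\<dots> \<le> W / real n * d (Z i \<omega>)"
            using wt_bounds(2) by (rule mult_right_mono) (simp add: d_def)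
          finally show "\<bar>wt n \<omega> i * (m (Z i \<omega>) - c * f (Z i \<omega>))\<bar> \<le> W / real n * d (Z i \<omega>)" .
        qed
        also have "\<dots> = W * ((\<Sum>i<n. d (Z i \<omega>)) / real n)" by (simp add: sum_distrib_left sum_divide_distrib)
        also have "\<dots> \<le> W * \<epsilon>" using elim(1) W by (intro mult_left_mono) auto
        finally show ?case using elim(2) 3 by (simp add: A_def algebra_simps)
      qed
    qed
  qed
  \<comment> \<open>The approximant, and with it the null set, depends on \<open>\<epsilon>\<close>;
    a countable sequence of tolerances leaves one null set.\<close>
  then have "AE \<omega> in M. \<forall>k. \<forall>\<^sub>F n in sequentially. \<bar>(\<Sum>i<n. wt n \<omega> i * m (Z i \<omega>)) - (\<integral>z. g z * m z \<partial>\<mu>)\<bar> < A * inverse (real (Suc k))"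
    unfolding AE_all_countable by simp
  then show ?thesis
  proof eventually_elim
    case (elim \<omega>)
    show ?case
    proof (rule tendstoI)
      fix e :: real assume "0 < e"
      then have "0 < e / A" using A by simp
      from reals_Archimedean[OF this] obtain k where "inverse (real (Suc k)) < e / A" ..
      then have k: "A * inverse (real (Suc k)) < e" using A by (simp add: field_simps)
      from elim[THEN spec, of k]
      show "\<forall>\<^sub>F n in sequentially. dist (\<Sum>i<n. wt n \<omega> i * m (Z i \<omega>)) (\<integral>z. g z * m z \<partial>\<mu>) < e"
        by eventually_elim (use k in \<open>simp add: dist_real_def\<close>)
    qed
  qed
qed

section \<open>Adding the outcomes, and the weak limit\<close>

lemma sets_marginal: "sets (marginal_prod \<mu>) = sets borel"
  unfolding marginal_density by (simp add: mu)

text \<open>Subtract and add the conditional mean \<open>m (Z i)\<close>: the centred part is noise,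
  the rest is a covariate average. The limit has the required form because \<open>Q\<close> keeps
  the kernel \<open>\<kappa>\<close> and changes only the covariate law.\<close>

lemma joint_function_limit:
  assumes f: "f \<in> borel_measurable borel" "\<And>x. \<bar>f x\<bar> \<le> C"
  shows "AE \<omega> in M. (\<lambda>n. \<Sum>i<n. wt n \<omega> i * f (V i \<omega>)) \<longlonglongrightarrow> (\<integral>x. f x \<partial>kernel_prod (marginal_prod \<mu>) \<kappa>)"
proof -
  define m where "m z = (\<integral>y. f (z, y) \<partial>\<kappa> z)" for z
  have mm: "m \<in> borel_measurable borel"
    unfolding m_def by (rule measurable_kernel_integral[OF kappa' f(1)])
  have mb: "\<bar>m z\<bar> \<le> C" for z
  proof -
    interpret K: prob_space "\<kappa> z"
      using measurable_space[OF kappa, of z] by (simp add: space_prob_algebra)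
    have sK: "sets (\<kappa> z) = sets borel" using sets_kernel[OF kappa', of z] by simp
    have "(\<lambda>y. f (z, y)) \<in> borel_measurable (\<kappa> z)"
      unfolding measurable_cong_sets[OF sK refl]
      by (rule measurable_compose[OF _ f(1)]) (intro borel_measurable_continuous_onI continuous_intros)
    then have i: "integrable (\<kappa> z) (\<lambda>y. f (z, y))"
      using f(2) by (intro K.integrable_const_bound[of _ C]) auto
    have "\<bar>m z\<bar> \<le> (\<integral>y. \<bar>f (z, y)\<bar> \<partial>\<kappa> z)" unfolding m_def by (rule integral_abs_bound)
    also have "\<dots> \<le> (\<integral>y. C \<partial>\<kappa> z)" using i f(2) by (intro integral_mono) auto
    finally show ?thesis by (simp add: K.prob_space)
  qed
  have C: "0 \<le> C" using f(2)[of undefined] by linarith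
  have "AE \<omega> in M. (\<lambda>n. \<Sum>i<n. w n (\<lambda>j\<in>{..<n}. fst (V j \<omega>)) i *
            (f (V i \<omega>) - (\<integral>y. f (fst (V i \<omega>), y) \<partial>\<kappa> (fst (V i \<omega>))))) \<longlonglongrightarrow> 0"
  proof (rule weighted_noise_tendsto_0[OF indep law mu kappa w_measurable w_bounds f(1)])
    \<comment> \<open>The noise bound needs a positive constant, and \<open>C\<close> may be
      \<open>0\<close>.\<close>
    show "\<bar>f x\<bar> \<le> C + 1" for x using f(2)[of x] by linarith
    show "0 < W" using W by linarith
    show "0 < C + 1" using C by linarith
  qed
  then have noise: "AE \<omega> in M. (\<lambda>n. \<Sum>i<n. wt n \<omega> i * (f (V i \<omega>) - m (Z i \<omega>))) \<longlonglongrightarrow> 0"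
    by (simp add: wt_def m_def Z_def)
  have lim: "(\<integral>z. g z * m z \<partial>\<mu>) = (\<integral>x. f x \<partial>kernel_prod (marginal_prod \<mu>) \<kappa>)"
    unfolding integral_kernel_prod[OF marginal_prob sets_marginal kappa f]
    using integral_marginal[OF mm] by (simp add: m_def)
  from noise bounded_function_limit[OF mm mb] show ?thesis
  proof eventually_elim
    case (elim \<omega>)
    from tendsto_add[OF elim] show ?case
      by (simp add: lim right_diff_distrib sum_subtractf)
  qed
qed

lemma weak_limit:
  "AE \<omega> in M. converges_in_distribution (\<lambda>n. weighted_empirical n (wt n \<omega>) (\<lambda>i. V i \<omega>)) (kernel_prod (marginal_prod \<mu>) \<kappa>)"
proof -
  let ?P = "kernel_prod \<mu> \<kappa>" and ?Q = "kernel_prod (marginal_prod \<mu>) \<kappa>"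
  define Y where "Y = msupport (distr ?P borel snd)"
  have "AE y in distr ?P borel snd. y \<in> Y" unfolding Y_def by (rule AE_msupport) simp
  then have AE_Y: "AE x in ?P. snd x \<in> Y" by (rule AE_distrD[OF measurable_joint[OF snd_borel]])
  have AE_S: "AE x in ?P. fst x \<in> S" by (rule AE_joint_fst[OF AE_msupport[OF mu(2)]])
  have AE_P: "AE x in ?P. x \<in> S \<times> Y" using AE_S AE_Y by eventually_elim (simp add: mem_Times_iff)
  \<comment> \<open>Through this density, the almost sure localisation of the sample in
    \<open>S \<times> Y\<close> carries over to \<open>Q\<close>.\<close>
  have Q: "?Q = density ?P (\<lambda>x. ennreal (g (fst x)))"
    unfolding marginal_density using g(1) by (intro kernel_prod_density[OF mu(2) kappa']) simp
  have AE_Q: "AE x in ?Q. x \<in> S \<times> Y"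
    unfolding Q
  proof (subst AE_density)
    show "(\<lambda>x. ennreal (g (fst x))) \<in> borel_measurable ?P"
      by (rule measurable_joint) (intro measurable_compose[OF measurable_compose[OF fst_borel g(1)]] measurable_ennreal)
    show "AE x in ?P. 0 < ennreal (g (fst x)) \<longrightarrow> x \<in> S \<times> Y" using AE_P by eventually_elim simp
  qed
  have K: "compact (S \<times> Y)" unfolding Y_def by (intro compact_Times compact_Z compact_Y)
  have ne: "S \<times> Y \<noteq> {}"
  proof
    assume empty: "S \<times> Y = {}"
    have "AE x in ?P. False" using AE_P unfolding empty by simp
    then show False using joint.AE_False by simp
  qed
  from finite_rounding_sequence[OF K ne zero_less_one] obtain r where
    rr: "\<forall>k. r k \<in> borel \<rightarrow>\<^sub>M borel \<and> finite (range (r k)) \<and> range (r k) \<subseteq> S \<times> Y \<and>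
      (\<forall>x\<in>S \<times> Y. dist x (r k x) < 1 * inverse (real (Suc k)))" ..
  have r: "finite (range (r k))" "range (r k) \<subseteq> S \<times> Y" "r k \<in> borel \<rightarrow>\<^sub>M borel"
    "x \<in> S \<times> Y \<Longrightarrow> dist x (r k x) < inverse (real (Suc k))" for k x
    using rr[THEN spec, of k] unfolding mult_1 by blast+
  have cells: "AE \<omega> in M. \<forall>k. \<forall>c\<in>range (r k). (\<lambda>n. \<Sum>i<n. wt n \<omega> i * of_bool (r k (V i \<omega>) = c)) \<longlonglongrightarrow> (\<integral>x. of_bool (r k x = c) \<partial>?Q)"
    unfolding AE_all_countable
  proof
    fix k
    have "AE \<omega> in M. (\<lambda>n. \<Sum>i<n. wt n \<omega> i * of_bool (r k (V i \<omega>) = c)) \<longlonglongrightarrow> (\<integral>x. of_bool (r k x = c) \<partial>?Q)" for c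
      by (rule joint_function_limit[where C=1, OF of_bool_eq_measurable[OF r(3)]]) simp
    then show "AE \<omega> in M. \<forall>c\<in>range (r k). (\<lambda>n. \<Sum>i<n. wt n \<omega> i * of_bool (r k (V i \<omega>) = c)) \<longlonglongrightarrow> (\<integral>x. of_bool (r k x = c) \<partial>?Q)"
      by (subst AE_ball_countable[OF countable_finite[OF r(1)]]) blast
  qed
  have AE_V: "AE \<omega> in M. \<forall>i. V i \<omega> \<in> S \<times> Y"
    unfolding AE_all_countable by (intro allI AE_law AE_P)
  \<comment> \<open>Near-optimality enters here only to supply total mass \<open>1\<close>.\<close>
  from cells AE_V near_optimal show ?thesis
  proof eventually_elim
    fix \<omega>
    assume cells: "\<forall>k. \<forall>c\<in>range (r k). (\<lambda>n. \<Sum>i<n. wt n \<omega> i * of_bool (r k (V i \<omega>) = c)) \<longlonglongrightarrow> (\<integral>x. of_bool (r k x = c) \<partial>?Q)"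
      and V: "\<forall>i. V i \<omega> \<in> S \<times> Y"
      and opt: "\<forall>n>0. near_optimal_weights F W R n (\<lambda>i. fst (V i \<omega>)) (w n (\<lambda>j\<in>{..<n}. fst (V j \<omega>)))"
    have sum1: "(\<Sum>i<n. wt n \<omega> i) = 1" if "0 < n" for n
      using opt that unfolding wt_def near_optimal_weights_def by blast
    show "converges_in_distribution (\<lambda>n. weighted_empirical n (wt n \<omega>) (\<lambda>i. V i \<omega>)) ?Q"
    proof (rule converges_in_distribution_by_rounding[OF K, where r=r])
      show "V i \<omega> \<in> S \<times> Y" for i using V by blast
      show "prob_space ?Q" by (rule prob_space_kernel_prod[OF marginal_prob sets_marginal kappa])
      show "sets ?Q = sets borel" by (rule sets_kernel_prod[OF sets_marginal kappa'])
      show "(\<lambda>n. \<Sum>i<n. wt n \<omega> i * of_bool (r k (V i \<omega>) = c)) \<longlonglongrightarrow> (\<integral>x. of_bool (r k x = c) \<partial>?Q)"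
        if "c \<in> range (r k)" for k c using cells that by blast
    qed (rule wt_bounds(1) sum1 AE_Q r | assumption)+
  qed
qed

end

theorem theorem4:
  fixes M :: "'w measure"
    and T :: "nat \<Rightarrow> 'w \<Rightarrow> 't::euclidean_space"
    and X :: "nat \<Rightarrow> 'w \<Rightarrow> 'x::euclidean_space"
    and Y :: "nat \<Rightarrow> 'w \<Rightarrow> real"
    and P\<^sub>T\<^sub>X :: "('t \<times> 'x) measure"
    and \<kappa> :: "'t \<times> 'x \<Rightarrow> real measure"
    and F :: "('t \<times> 'x \<Rightarrow> real) set"
    and \<rho> :: "real \<Rightarrow> real"
    and lam W W\<^sub>0 :: real
    and w :: "nat \<Rightarrow> (nat \<Rightarrow> 't \<times> 'x) \<Rightarrow> nat \<Rightarrow> real"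
  assumes "prob_space M"
    and "prob_space P\<^sub>T\<^sub>X" and "sets P\<^sub>T\<^sub>X = sets borel"
    and "\<kappa> \<in> borel \<rightarrow>\<^sub>M prob_algebra borel"
    and iid_indep: "prob_space.indep_vars M (\<lambda>_. borel) (\<lambda>i \<omega>. ((T i \<omega>, X i \<omega>), Y i \<omega>)) UNIV"
    and iid_law: "\<And>i. distr M borel (\<lambda>\<omega>. ((T i \<omega>, X i \<omega>), Y i \<omega>)) = kernel_prod P\<^sub>T\<^sub>X \<kappa>"
    and "compact (msupport P\<^sub>T\<^sub>X)"
    and "compact (msupport (distr (kernel_prod P\<^sub>T\<^sub>X \<kappa>) borel snd))"
    and "0 \<le> lam"
    and "strictly_convex_on {0..W} \<rho>"
    and "continuous_on {0..W} \<rho>"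
    and "\<rho> differentiable_on {0<..<W}"
    and overlap: "absolutely_continuous P\<^sub>T\<^sub>X (marginal_prod P\<^sub>T\<^sub>X)"
    and overlap_bound: "AE z in P\<^sub>T\<^sub>X. RN_deriv P\<^sub>T\<^sub>X (marginal_prod P\<^sub>T\<^sub>X) z \<le> ennreal W\<^sub>0"
    and "0 < W\<^sub>0" and "W\<^sub>0 < W"
    and ipm_class: "F = lipschitz_class \<or>
      (\<exists>K H ip. is_rkhs (msupport P\<^sub>T\<^sub>X) K H ip \<and> universal_kernel (msupport P\<^sub>T\<^sub>X) K H \<and>
        F = rkhs_unit_ball H ip)"
    and weights_measurable: "\<And>n i. i < n \<Longrightarrow> (\<lambda>z. w n z i) \<in> borel_measurable (\<Pi>\<^sub>M j\<in>{..<n}. borel)"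
    and weights_argmin: "\<And>n. 0 < n \<Longrightarrow>
      AE \<omega> in M. is_cbdm_weights F lam \<rho> W n (\<lambda>j. (T j \<omega>, X j \<omega>)) (w n (\<lambda>j\<in>{..<n}. (T j \<omega>, X j \<omega>)))"
  shows "AE \<omega> in M. converges_in_distribution
      (\<lambda>n. weighted_empirical n (w n (\<lambda>j\<in>{..<n}. (T j \<omega>, X j \<omega>)))
         (\<lambda>i. ((T i \<omega>, X i \<omega>), Y i \<omega>)))
      (kernel_prod (marginal_prod P\<^sub>T\<^sub>X) \<kappa>)"
proof -
  interpret M: prob_space M by fact
  interpret P: prob_space "P\<^sub>T\<^sub>X" by fact
  define V where "V = (\<lambda>i \<omega>. ((T i \<omega>, X i \<omega>), Y i \<omega>))"
  \<comment> \<open>The overlap bound holds almost everywhere; the minimum enforces it at every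
    point and leaves the represented measure unchanged.\<close>
  define g where "g z = min W\<^sub>0 (enn2real (RN_deriv P\<^sub>T\<^sub>X (marginal_prod P\<^sub>T\<^sub>X) z))" for z
  \<comment> \<open>The feasibility bounds hold almost surely for \<open>w\<close>; clipping makes them hold everywhere.\<close>
  define w' where "w' n z i = max 0 (min (W / real n) (w n z i))" for n z i
  have test: "uniform_test_class (msupport P\<^sub>T\<^sub>X) F"
    using ipm_class uniform_test_class_lipschitz uniform_test_class_rkhs assms(7) by blast
  have "bounded (\<rho> ` {0..W})"
    using assms(11) by (intro compact_imp_bounded compact_continuous_image) auto
  then obtain B where "\<forall>t\<in>{0..W}. \<bar>\<rho> t\<bar> \<le> B" by (auto simp: bounded_iff)
  then have B: "\<bar>\<rho> t\<bar> \<le> B" if "t \<in> {0..W}" for t using that by blast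
  have RN: "RN_deriv P\<^sub>T\<^sub>X (marginal_prod P\<^sub>T\<^sub>X) \<in> borel_measurable borel"
    using borel_measurable_RN_deriv[of "P\<^sub>T\<^sub>X" "marginal_prod P\<^sub>T\<^sub>X"] unfolding measurable_cong_sets[OF assms(3) refl] .
  have g: "g \<in> borel_measurable borel"
    unfolding g_def using RN by measurable
  have sets_marg: "sets (marginal_prod P\<^sub>T\<^sub>X) = sets P\<^sub>T\<^sub>X"
    unfolding assms(3) marginal_prod_def borel_prod[symmetric] by (intro sets_pair_measure_cong) simp_all
  have dens: "marginal_prod P\<^sub>T\<^sub>X = density P\<^sub>T\<^sub>X (\<lambda>z. ennreal (g z))"
  proof -
    have "marginal_prod P\<^sub>T\<^sub>X = density P\<^sub>T\<^sub>X (RN_deriv P\<^sub>T\<^sub>X (marginal_prod P\<^sub>T\<^sub>X))"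
      by (rule P.density_RN_deriv[OF overlap sets_marg, symmetric])
    also have "\<dots> = density P\<^sub>T\<^sub>X (\<lambda>z. ennreal (g z))"
    proof (rule density_cong)
      show "AE z in P\<^sub>T\<^sub>X. RN_deriv P\<^sub>T\<^sub>X (marginal_prod P\<^sub>T\<^sub>X) z = ennreal (g z)"
        using overlap_bound
      proof eventually_elim
        case (elim z)
        then have "RN_deriv P\<^sub>T\<^sub>X (marginal_prod P\<^sub>T\<^sub>X) z < \<top>" by (rule le_less_trans) simp
        moreover have "enn2real (RN_deriv P\<^sub>T\<^sub>X (marginal_prod P\<^sub>T\<^sub>X) z) \<le> W\<^sub>0"
          using elim assms(15) by (intro enn2real_leI) auto
        ultimately show ?case by (simp add: g_def min_absorb2)
      qed
    qed (use g RN in \<open>auto simp: measurable_cong_sets[OF assms(3) refl]\<close>)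
    finally show ?thesis .
  qed
  \<comment> \<open>Entries of feasible weights below \<open>n\<close> already satisfy the bounds,
    so clipping does not move them; entries from \<open>n\<close> on are unconstrained.\<close>
  have w'_eq: "w' n (\<lambda>j\<in>{..<n}. fst (V j \<omega>)) i = w n (\<lambda>j\<in>{..<n}. (T j \<omega>, X j \<omega>)) i"
    if "is_cbdm_weights F lam \<rho> W n (\<lambda>j. (T j \<omega>, X j \<omega>)) (w n (\<lambda>j\<in>{..<n}. (T j \<omega>, X j \<omega>)))" "i < n" for n \<omega> i
    using that by (auto simp: is_cbdm_weights_def is_arg_min_def weight_simplex_def w'_def V_def)
  have argmin: "AE \<omega> in M. \<forall>n>0. is_cbdm_weights F lam \<rho> W n (\<lambda>j. (T j \<omega>, X j \<omega>)) (w n (\<lambda>j\<in>{..<n}. (T j \<omega>, X j \<omega>)))"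
    unfolding AE_all_countable using weights_argmin by simp
  \<comment> \<open>The slack \<open>2 * lam * B\<close> is \<open>lam\<close> times two penalties
    of modulus at most \<open>B / n\<close>, with the \<open>1 / n\<close> split off;
    \<open>B\<close> bounds \<open>\<rho>\<close> on the compact interval
    \<open>{0..W}\<close>.\<close>
  interpret balanced_sampling M V "P\<^sub>T\<^sub>X" \<kappa> g "W\<^sub>0" W "2 * lam * B" F w'
  proof (unfold_locales)
    show "M.indep_vars (\<lambda>_. borel) V UNIV" unfolding V_def by (rule iid_indep)
    show "distr M borel (V i) = kernel_prod P\<^sub>T\<^sub>X \<kappa>" for i unfolding V_def by (rule iid_law)
    show "0 \<le> g z" "g z \<le> W\<^sub>0" for z using assms(15) by (simp_all add: g_def)
    show "(\<lambda>z. w' n z i) \<in> borel_measurable (\<Pi>\<^sub>M j\<in>{..<n}. borel)" if "i < n" for n i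
      unfolding w'_def using weights_measurable[OF that] by measurable
    show "0 \<le> w' n z i \<and> w' n z i \<le> W / real n" for n z i
      using assms(15,16) by (simp add: w'_def)
    show "AE \<omega> in M. \<forall>n>0. near_optimal_weights F W (2 * lam * B) n (\<lambda>i. fst (V i \<omega>)) (w' n (\<lambda>j\<in>{..<n}. fst (V j \<omega>)))"
      using argmin
    proof eventually_elim
      case (elim \<omega>)
      show ?case
      proof (intro allI impI)
        fix n :: nat assume n: "0 < n"
        then have opt: "is_cbdm_weights F lam \<rho> W n (\<lambda>j. (T j \<omega>, X j \<omega>)) (w n (\<lambda>j\<in>{..<n}. (T j \<omega>, X j \<omega>)))"
          using elim by blast
        have fV: "fst (V i \<omega>) = (T i \<omega>, X i \<omega>)" for i by (simp add: V_def)
        have "near_optimal_weights F W (2 * lam * B) n (\<lambda>i. fst (V i \<omega>)) (w n (\<lambda>j\<in>{..<n}. (T j \<omega>, X j \<omega>)))"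
          unfolding fV by (rule cbdm_weights_near_optimal[OF uniform_test_classD(1)[OF test] opt B assms(9) n])
        then show "near_optimal_weights F W (2 * lam * B) n (\<lambda>i. fst (V i \<omega>)) (w' n (\<lambda>j\<in>{..<n}. fst (V j \<omega>)))"
          by (rule near_optimal_weights_cong[THEN iffD2, rotated]) (rule w'_eq[OF opt])
      qed
    qed
  qed (rule assms overlap dens g test)+
  from weak_limit argmin show ?thesis
  proof eventually_elim
    case (elim \<omega>)
    have "weighted_empirical n (w n (\<lambda>j\<in>{..<n}. (T j \<omega>, X j \<omega>))) (\<lambda>i. ((T i \<omega>, X i \<omega>), Y i \<omega>)) = weighted_empirical n (wt n \<omega>) (\<lambda>i. V i \<omega>)" for n
    proof -
      have "weighted_empirical n (w n (\<lambda>j\<in>{..<n}. (T j \<omega>, X j \<omega>))) (\<lambda>i. V i \<omega>) = weighted_empirical n (wt n \<omega>) (\<lambda>i. V i \<omega>)"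
      proof (rule weighted_empirical_cong)
        fix i assume i: "i < n"
        then have "is_cbdm_weights F lam \<rho> W n (\<lambda>j. (T j \<omega>, X j \<omega>)) (w n (\<lambda>j\<in>{..<n}. (T j \<omega>, X j \<omega>)))"
          using elim(2) by auto
        from w'_eq[OF this i] show "w n (\<lambda>j\<in>{..<n}. (T j \<omega>, X j \<omega>)) i = wt n \<omega> i"
          by (simp add: wt_def)
      qed
      then show ?thesis by (simp add: V_def)
    qed
    then show ?case using elim(1) by simp
  qed
qed

end
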